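(* There exist a compact geodesic metric space $X$ and a family $\{\mu_w\}_{w\in(0,1)}$ of doubling Borel probability measures on $X$ such that: (i) for each $w\in(0,1)$ the metric measure space $(X,\mu_w)$ supports a $(1,1)$-Poincar\'e inequality; (ii) for all $w,w'\in(0,1)$ with $w\neq w'$, the measures $\mu_w$ and $\mu_{w'}$ are mutually singular.
   Context: A Borel measure $\mu$ on a metric space $X$ is doubling if there is $C\ge 1$ such that $0<\mu(B(x,2r))\le C\,\mu(B(x,r))<\infty$ for all $x\in X$ and $r>0$. A metric measure space $(X,\mu)$ supports a $(1,1)$-Poincar\'e inequality (in the sense of Heinonen--Koskela) if there are constants $C>0$ and $\lambda\ge 1$ such that for every open ball $B=B(x,r)$, every function $u$ that is integrable on balls, and every upper gradient $\rho\ge 0$ of $u$ (a Borel function with $|u(\gamma(a))-u(\gamma(b))|\le\int_\gamma \rho\,ds$ for every rectifiable curve $\gamma:[a,b]\to X$), one has $\frac{1}{\mu(B)}\int_B |u-u_B|\,d\mu \le C\,r\,\frac{1}{\mu(\lambda B)}\int_{\lambda B}\rho\,d\mu$, where $u_B=\frac{1}{\mu(B)}\int_B u\,d\mu$ and $\lambda B=B(x,\lambda r)$. Two measures are mutually singular if there is a Borel set of full measure for one and zero measure for the other. *)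

theory Defs
  imports "HOL-Probability.Probability"
begin

definition metric_borel :: "'a set \<Rightarrow> ('a \<Rightarrow> 'a \<Rightarrow> real) \<Rightarrow> 'a set set" where
  "metric_borel M d = sigma_sets M {U. openin (Metric_space.mtopology M d) U}"

definition geodesic_space :: "'a set \<Rightarrow> ('a \<Rightarrow> 'a \<Rightarrow> real) \<Rightarrow> bool" where
  "geodesic_space M d \<longleftrightarrow>
     (\<forall>x\<in>M. \<forall>y\<in>M. \<exists>\<gamma>::real \<Rightarrow> 'a. \<gamma> 0 = x \<and> \<gamma> (d x y) = y \<and>
        (\<forall>s\<in>{0..d x y}. \<forall>t\<in>{0..d x y}. \<gamma> s \<in> M \<and> d (\<gamma> s) (\<gamma> t) = \<bar>s - t\<bar>))"

definition borel_prob_measure :: "'a set \<Rightarrow> ('a \<Rightarrow> 'a \<Rightarrow> real) \<Rightarrow> 'a measure \<Rightarrow> bool" where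
  "borel_prob_measure M d \<mu> \<longleftrightarrow>
     prob_space \<mu> \<and> space \<mu> = M \<and> sets \<mu> = metric_borel M d"

definition doubling_measure :: "'a set \<Rightarrow> ('a \<Rightarrow> 'a \<Rightarrow> real) \<Rightarrow> 'a measure \<Rightarrow> bool" where
  "doubling_measure M d \<mu> \<longleftrightarrow>
     (\<exists>C\<ge>1. \<forall>x\<in>M. \<forall>r>0.
        0 < emeasure \<mu> (Metric_space.mball M d x (2*r)) \<and>
        emeasure \<mu> (Metric_space.mball M d x (2*r)) \<le> ennreal C * emeasure \<mu> (Metric_space.mball M d x r) \<and>
        emeasure \<mu> (Metric_space.mball M d x r) < \<infinity>)"

definition curve :: "'a set \<Rightarrow> ('a \<Rightarrow> 'a \<Rightarrow> real) \<Rightarrow> (real \<Rightarrow> 'a) \<Rightarrow> real \<Rightarrow> real \<Rightarrow> bool" where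
  "curve M d \<gamma> a b \<longleftrightarrow> a \<le> b \<and>
     continuous_map (top_of_set {a..b}) (Metric_space.mtopology M d) \<gamma>"

definition curve_length :: "('a \<Rightarrow> 'a \<Rightarrow> real) \<Rightarrow> (real \<Rightarrow> 'a) \<Rightarrow> real \<Rightarrow> real \<Rightarrow> ereal" where
  "curve_length d \<gamma> a b =
     (SUP (n, t) \<in> {(n, t). t 0 = a \<and> t n = b \<and> (\<forall>i<n. t i \<le> t (Suc i))}.
        ereal (\<Sum>i<n. d (\<gamma> (t i)) (\<gamma> (t (Suc i)))))"

definition rectifiable_curve :: "'a set \<Rightarrow> ('a \<Rightarrow> 'a \<Rightarrow> real) \<Rightarrow> (real \<Rightarrow> 'a) \<Rightarrow> real \<Rightarrow> real \<Rightarrow> bool" where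
  "rectifiable_curve M d \<gamma> a b \<longleftrightarrow> curve M d \<gamma> a b \<and> curve_length d \<gamma> a b < \<infinity>"

text \<open>Length function s(t) = length of the restriction of the curve to [a,t]
  (clamped to [a,b]); it is nondecreasing and continuous for rectifiable curves.\<close>

definition length_function :: "('a \<Rightarrow> 'a \<Rightarrow> real) \<Rightarrow> (real \<Rightarrow> 'a) \<Rightarrow> real \<Rightarrow> real \<Rightarrow> real \<Rightarrow> real" where
  "length_function d \<gamma> a b t = real_of_ereal (curve_length d \<gamma> a (max a (min t b)))"

text \<open>Line integral of a nonnegative Borel function along a rectifiable curve,
  as the Lebesgue--Stieltjes integral with respect to the length function
  (equivalently, the integral along the arc-length parametrisation).\<close>

definition line_integral :: "('a \<Rightarrow> 'a \<Rightarrow> real) \<Rightarrow> ('a \<Rightarrow> ennreal) \<Rightarrow> (real \<Rightarrow> 'a) \<Rightarrow> real \<Rightarrow> real \<Rightarrow> ennreal" where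
  "line_integral d \<rho> \<gamma> a b =
     (\<integral>\<^sup>+ t. \<rho> (\<gamma> t) * indicator {a..b} t \<partial>interval_measure (length_function d \<gamma> a b))"

definition upper_gradient :: "'a set \<Rightarrow> ('a \<Rightarrow> 'a \<Rightarrow> real) \<Rightarrow> ('a \<Rightarrow> real) \<Rightarrow> ('a \<Rightarrow> ennreal) \<Rightarrow> bool" where
  "upper_gradient M d u \<rho> \<longleftrightarrow>
     \<rho> \<in> borel_measurable (sigma M (metric_borel M d)) \<and>
     (\<forall>\<gamma> a b. rectifiable_curve M d \<gamma> a b \<longrightarrow>
        ennreal \<bar>u (\<gamma> a) - u (\<gamma> b)\<bar> \<le> line_integral d \<rho> \<gamma> a b)"

definition poincare_11 :: "'a set \<Rightarrow> ('a \<Rightarrow> 'a \<Rightarrow> real) \<Rightarrow> 'a measure \<Rightarrow> bool" where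
  "poincare_11 M d \<mu> \<longleftrightarrow>
     (\<exists>C>0. \<exists>L\<ge>1. \<forall>u \<rho> x r.
        (\<forall>y\<in>M. \<forall>s>0. set_integrable \<mu> (Metric_space.mball M d y s) u) \<longrightarrow>
        upper_gradient M d u \<rho> \<longrightarrow> x \<in> M \<longrightarrow> r > 0 \<longrightarrow>
        (let B = Metric_space.mball M d x r;
             LB = Metric_space.mball M d x (L * r);
             uB = (\<integral>y\<in>B. u y \<partial>\<mu>) / measure \<mu> B
         in ennreal ((\<integral>y\<in>B. \<bar>u y - uB\<bar> \<partial>\<mu>) / measure \<mu> B)
              \<le> ennreal (C * r / measure \<mu> LB) * (\<integral>\<^sup>+ y\<in>LB. \<rho> y \<partial>\<mu>)))"

definition mutually_singular :: "'a measure \<Rightarrow> 'a measure \<Rightarrow> bool" where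
  "mutually_singular \<mu> \<nu> \<longleftrightarrow>
     (\<exists>A \<in> sets \<mu>. A \<in> sets \<nu> \<and> emeasure \<mu> (space \<mu> - A) = 0 \<and> emeasure \<nu> A = 0)"

end

theory Submission
  imports Defs
begin

text \<open>
  The space is a dyadic Laakso space: the quotient of \<open>[0,1] \<times> {0,1}\<^sup>\<nat>\<close> in which, at every height
  that is an odd multiple of \<open>2\<^sup>-\<^sup>(\<^sup>n\<^sup>+\<^sup>1\<^sup>)\<close>, branches that differ only in coordinate \<open>n\<close> are glued. The
  distance of two points is the length of the shortest vertical walk between their heights that
  meets a wormhole of every level at which the branches disagree. The measure \<open>\<mu>\<^sub>w\<close> is the image of
  Lebesgue measure times the Bernoulli measure of parameter \<open>w\<close>.

  Doubling: a ball of radius about \<open>2\<^sup>-\<^sup>n\<close> is comparable to an interval of that length times one or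
  two cylinders of depth \<open>n\<close>, because it meets at most one wormhole height of level below \<open>n\<close>.

  Poincare inequality: resample the coordinates \<open>n, n+1, \<dots>\<close> of the branch one at a time. Changing
  coordinate \<open>m\<close> costs a vertical detour of length \<open>2\<^sup>-\<^sup>m\<close> to a wormhole and back, and after
  averaging over all heights and branches this is bounded by \<open>2\<^sup>-\<^sup>m\<close> times the integral of the upper
  gradient. The costs form a geometric series, and the error after finitely many steps tends to
  zero by \<open>L\<^sup>1\<close> approximation with cylinder functions. Since both endpoints of each step are
  distributed according to the same product measure, the constant does not see \<open>w\<close> except through
  doubling.

  Singularity: the asymptotic frequency of ones along the branch is \<open>w\<close> almost surely.
\<close>

subsection \<open>Wormhole heights\<close>

text \<open>One metric has to serve all \<open>w\<close>, so \<open>w\<close> enters only through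
  the weights of cylinders, and the Poincare argument is arranged so that these weights occur as the
  same factor on both sides. Balls are compared with boxes: a ball of radius \<open>r\<close> lies
  in a box of dyadic scale \<open>n\<close>, and that box lies in the ball of radius
  \<open>16 * r\<close>; this is where the dilation factor 16 comes from. The obstacle is a ball
  around a gluing height of a level \<open>m < n\<close>: it touches two cylinders, whose weights
  differ. They are estimated one at a time and linked by comparing \<open>u\<close> not with its
  mean but with its value at the common gluing height, on a branch with random tail; that is the
  same point seen from either cylinder. As \<open>u\<close> is merely integrable, infinitely many
  coordinates cannot be changed at once by continuity, which forces the \<open>L^1\<close> limit.
  The curves tested against the upper gradient are vertical segments only: a change of branch
  happens at points that are already identified.\<close>

definition wormhole :: "nat \<Rightarrow> real set" where
  "wormhole n = {(2 * real k + 1) / 2 ^ (n + 1) | k. k < 2 ^ n}"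

lemma finite_wormhole: "finite (wormhole n)"
  by (simp add: wormhole_def)

lemma wormhole_subset: "wormhole n \<subseteq> {0..1}"
proof
  fix x assume "x \<in> wormhole n"
  then obtain k where k: "x = (2 * real k + 1) / 2 ^ (n + 1)" "k < 2 ^ n"
    by (auto simp: wormhole_def)
  have "2 * real k + 1 \<le> 2 ^ (n + 1)"
  proof -
    have "2 * k + 1 \<le> 2 ^ (n + 1)" using k(2) by simp
    then have "real (2 * k + 1) \<le> real (2 ^ (n + 1))" by (rule of_nat_mono)
    then show ?thesis by simp
  qed
  then show "x \<in> {0..1}" using k(1) by simp
qed

text \<open>A gluing height thus serves exactly one coordinate: clearing the denominators of two
  different levels would equate an even with an odd number.\<close>

lemma wormhole_disjoint:
  assumes "x \<in> wormhole m" "x \<in> wormhole n"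
  shows "m = n"
proof -
  have *: "\<not> m < n" if x: "x \<in> wormhole m" "x \<in> wormhole n" for m n
  proof
    assume "m < n"
    then obtain d where d: "n = m + d + 1" using less_iff_Suc_add by auto
    from x obtain k j where x: "x = (2 * real k + 1) / 2 ^ (m + 1)" "x = (2 * real j + 1) / 2 ^ (n + 1)"
      unfolding wormhole_def by blast
    have "x * 2 ^ (m + 1) = 2 * real k + 1" by (simp add: x(1))
    moreover have "x * 2 ^ (n + 1) = 2 * real j + 1" by (simp add: x(2))
    moreover have "(2::real) ^ (n + 1) = 2 ^ (m + 1) * 2 ^ (d + 1)"
      by (simp add: d power_add)
    ultimately have "(2 * real k + 1) * 2 ^ (d + 1) = 2 * real j + 1"
      by (metis mult.assoc)
    then have "real ((2 * k + 1) * 2 ^ (d + 1)) = real (2 * j + 1)"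
      by (simp add: algebra_simps)
    then have "(2 * k + 1) * 2 ^ (d + 1) = 2 * j + 1"
      using of_nat_eq_iff by blast
    moreover have "even ((2 * k + 1) * 2 ^ (d + 1))" by simp
    moreover have "odd (2 * j + 1)" by simp
    ultimately show False by metis
  qed
  show ?thesis using *[OF assms] *[OF assms(2,1)] by simp
qed

text \<open>Heights of all levels below \<open>n\<close> are integer multiples of
  \<open>2^-n\<close>. This separation confines a small ball to a single change among the first
  \<open>n\<close> coordinates.\<close>

lemma wormhole_separated:
  assumes "x \<in> wormhole m" "y \<in> wormhole m'" "m < n" "m' < n" "\<bar>x - y\<bar> < 1 / 2 ^ n"
  shows "x = y"
proof -
  have *: "\<exists>i::int. x = of_int i / 2 ^ n" if x: "x \<in> wormhole m" "m < n" for x m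
  proof -
    obtain d where d: "n = m + 1 + d" using \<open>m < n\<close> less_iff_Suc_add by auto
    obtain k where k: "x = (2 * real k + 1) / 2 ^ (m + 1)" using x(1) unfolding wormhole_def by blast
    have "x = of_int ((2 * int k + 1) * 2 ^ d) / 2 ^ n" by (simp add: k d power_add)
    then show ?thesis by blast
  qed
  obtain i j where ij: "x = of_int i / 2 ^ n" "y = of_int j / 2 ^ n" using * assms by metis
  have "\<bar>real_of_int (i - j)\<bar> < 1"
    using assms(5) by (simp add: ij flip: diff_divide_distrib) (simp add: field_simps)
  then have "i = j" by linarith
  then show ?thesis by (simp add: ij)
qed

text \<open>Neighbouring heights of level \<open>n\<close> are \<open>2^-n\<close> apart, and the
  outermost ones are half that far from 0 and 1. Fine levels are therefore met by every interval
  that is long enough.\<close>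

lemma wormhole_hits:
  assumes "0 \<le> l" "h \<le> 1" "1 / 2 ^ n \<le> h - l"
  shows "wormhole n \<inter> {l..h} \<noteq> {}"
proof -
  \<comment> \<open>The least \<open>k\<close> with \<open>(2 * k + 1) / 2^(n+1) \<ge> l\<close>;
    the ceiling is nonnegative, so \<open>nat\<close> changes nothing.\<close>
  define k where "k = nat \<lceil>l * 2 ^ n - 1 / 2\<rceil>"
  have "-1 < l * 2 ^ n - 1 / 2" using assms(1) by (smt (verit) field_sum_of_halves mult_nonneg_nonneg zero_le_power)
  then have 0: "\<lceil>l * 2 ^ n - 1 / 2\<rceil> \<ge> 0" by linarith
  have k: "real k = of_int \<lceil>l * 2 ^ n - 1 / 2\<rceil>" using 0 by (simp add: k_def)
  have k1: "real k \<ge> l * 2 ^ n - 1 / 2" and k2: "real k < l * 2 ^ n + 1 / 2"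
    unfolding k by linarith+
  have "(l + 1 / 2 ^ n) * 2 ^ n \<le> 1 * 2 ^ n"
    by (rule mult_right_mono) (use assms in auto)
  then have l: "l * 2 ^ n + 1 \<le> 2 ^ n" by (simp add: distrib_right)
  have "real k < 2 ^ n" using k2 l by linarith
  then have kn: "k < 2 ^ n" by (metis of_nat_less_iff of_nat_numeral of_nat_power)
  define x where "x = (2 * real k + 1) / 2 ^ (n + 1)"
  have "x \<in> wormhole n" using kn by (auto simp: wormhole_def x_def)
  moreover have "l \<le> x" using k1 by (simp add: x_def field_simps)
  moreover have "x \<le> h"
  proof -
    have "2 * real k + 1 \<le> (l + 1 / 2 ^ n) * 2 ^ (n + 1)"
      using k2 by (simp add: distrib_right)
    then have "x \<le> l + 1 / 2 ^ n" by (simp add: x_def pos_divide_le_eq)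
    then show ?thesis using assms by linarith
  qed
  ultimately show ?thesis by auto
qed

subsection \<open>The pseudometric on interval times Cantor set\<close>

type_synonym laakso_point = "real \<times> (nat \<Rightarrow> bool)"

definition strips :: "laakso_point set" where
  "strips = {0..1} \<times> UNIV"

text \<open>A pair \<open>(l, h)\<close> is feasible if a walk between the two heights that covers \<open>{l..h}\<close>
  passes a wormhole of every level at which the two branches disagree; the shortest such walk
  has length \<open>2 * (h - l)\<close> minus the difference of the heights.\<close>

definition feasible :: "laakso_point \<Rightarrow> laakso_point \<Rightarrow> (real \<times> real) set" where
  "feasible p q = {(l, h). 0 \<le> l \<and> l \<le> min (fst p) (fst q) \<and> max (fst p) (fst q) \<le> h \<and> h \<le> 1 \<and>
     (\<forall>n. snd p n \<noteq> snd q n \<longrightarrow> wormhole n \<inter> {l..h} \<noteq> {})}"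

definition walk_length :: "laakso_point \<Rightarrow> laakso_point \<Rightarrow> real \<times> real \<Rightarrow> real" where
  "walk_length p q = (\<lambda>(l, h). 2 * (h - l) - \<bar>fst p - fst q\<bar>)"

definition walk_dist :: "laakso_point \<Rightarrow> laakso_point \<Rightarrow> real" where
  "walk_dist p q = Inf (walk_length p q ` feasible p q)"

text \<open>Closedness makes the infimum in \<open>walk_dist\<close> a minimum. Each level is
  finite, so meeting it is a finite union of closed quadrants in the \<open>(l, h)\<close> plane,
  and infinitely many levels only contribute an intersection.\<close>

lemma closed_feasible: "closed (feasible p q)"
proof -
  have "closed {(l, h). wormhole n \<inter> {l..h} \<noteq> {}}" for n
  proof -
    have "{(l, h). wormhole n \<inter> {l..h} \<noteq> {}} = (\<Union>z\<in>wormhole n. {..z} \<times> {z..})"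
      by auto
    moreover have "closed (\<Union>z\<in>wormhole n. {..z} \<times> {z..})"
      by (intro closed_UN finite_wormhole closed_Times ballI) auto
    ultimately show ?thesis by simp
  qed
  then have "closed (({0..min (fst p) (fst q)} \<times> {max (fst p) (fst q)..1}) \<inter>
      (\<Inter>n\<in>{n. snd p n \<noteq> snd q n}. {(l, h). wormhole n \<inter> {l..h} \<noteq> {}}))"
    by (intro closed_Int closed_Times closed_INT ballI) auto
  moreover have "feasible p q = ({0..min (fst p) (fst q)} \<times> {max (fst p) (fst q)..1}) \<inter>
      (\<Inter>n\<in>{n. snd p n \<noteq> snd q n}. {(l, h). wormhole n \<inter> {l..h} \<noteq> {}})"
    by (auto simp: feasible_def)
  ultimately show ?thesis by simp
qed

lemma feasible_nonempty:
  assumes "p \<in> strips" "q \<in> strips"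
  shows "(0, 1) \<in> feasible p q"
  using assms wormhole_hits[of 0 1] by (auto simp: feasible_def strips_def)

lemma walk_dist_attained:
  assumes "p \<in> strips" "q \<in> strips"
  obtains l h where "(l, h) \<in> feasible p q" "walk_dist p q = 2 * (h - l) - \<bar>fst p - fst q\<bar>"
proof -
  have "bounded (feasible p q)"
    by (rule bounded_subset[of "{0..1} \<times> {0..1}"]) (use assms in \<open>auto simp: feasible_def strips_def bounded_Times\<close>)
  then have "compact (feasible p q)" using closed_feasible compact_eq_bounded_closed by blast
  moreover have "continuous_on (feasible p q) (walk_length p q)"
    unfolding walk_length_def case_prod_beta by (intro continuous_intros)
  ultimately obtain x where x: "x \<in> feasible p q" "\<And>y. y \<in> feasible p q \<Longrightarrow> walk_length p q x \<le> walk_length p q y"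
    using continuous_attains_inf[of "feasible p q" "walk_length p q"] feasible_nonempty[OF assms] by blast
  have "walk_dist p q = walk_length p q x"
    unfolding walk_dist_def by (rule cInf_eq_minimum) (use x in auto)
  then show ?thesis using that[of "fst x" "snd x"] x(1) by (auto simp: walk_length_def case_prod_beta)
qed

lemma walk_dist_le:
  assumes "p \<in> strips" "q \<in> strips" "(l, h) \<in> feasible p q"
  shows "walk_dist p q \<le> 2 * (h - l) - \<bar>fst p - fst q\<bar>"
proof -
  have "walk_dist p q \<le> walk_length p q (l, h)"
    unfolding walk_dist_def
  proof (rule cInf_lower)
    show "bdd_below (walk_length p q ` feasible p q)"
      by (rule bdd_belowI[of _ 0]) (auto simp: walk_length_def feasible_def)
  qed (use assms in auto)
  then show ?thesis by (simp add: walk_length_def)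
qed

lemma walk_dist_ge: "p \<in> strips \<Longrightarrow> q \<in> strips \<Longrightarrow> \<bar>fst p - fst q\<bar> \<le> walk_dist p q"
  by (rule walk_dist_attained[of p q]) (auto simp: feasible_def abs_if)

lemma walk_dist_commute: "walk_dist p q = walk_dist q p"
proof -
  have "feasible p q = feasible q p" by (auto simp: feasible_def min.commute max.commute)
  then show ?thesis by (auto simp: walk_dist_def walk_length_def abs_minus_commute)
qed

lemma walk_dist_vertical:
  assumes "p \<in> strips" "q \<in> strips"
    and "\<And>n. snd p n \<noteq> snd q n \<Longrightarrow> wormhole n \<inter> {min (fst p) (fst q)..max (fst p) (fst q)} \<noteq> {}"
  shows "walk_dist p q = \<bar>fst p - fst q\<bar>"
proof -
  have "(min (fst p) (fst q), max (fst p) (fst q)) \<in> feasible p q"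
    using assms by (auto simp: feasible_def strips_def)
  from walk_dist_le[OF assms(1,2) this] walk_dist_ge[OF assms(1,2)] show ?thesis
    by (auto simp: min_def max_def abs_if split: if_splits)
qed

text \<open>The hull of two optimal ranges is feasible for the outer pair: where \<open>p\<close>
  and \<open>r\<close> disagree, one of them disagrees with \<open>q\<close>. The ranges overlap at
  least where the stretches from \<open>q\<close> to \<open>p\<close> and from \<open>q\<close> to
  \<open>r\<close> do, which pays for the difference of the height terms.\<close>

lemma walk_dist_triangle:
  assumes "p \<in> strips" "q \<in> strips" "r \<in> strips"
  shows "walk_dist p r \<le> walk_dist p q + walk_dist q r"
proof -
  obtain l h where 1: "(l, h) \<in> feasible p q" "walk_dist p q = 2 * (h - l) - \<bar>fst p - fst q\<bar>"
    using walk_dist_attained assms by blast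
  obtain l' h' where 2: "(l', h') \<in> feasible q r" "walk_dist q r = 2 * (h' - l') - \<bar>fst q - fst r\<bar>"
    using walk_dist_attained assms by blast
  have "wormhole n \<inter> {min l l'..max h h'} \<noteq> {}" if "snd p n \<noteq> snd r n" for n
  proof (cases "snd p n = snd q n")
    case True
    then have "wormhole n \<inter> {l'..h'} \<noteq> {}" using that 2 by (auto simp: feasible_def)
    then show ?thesis by force
  next
    case False
    then have "wormhole n \<inter> {l..h} \<noteq> {}" using that 1 by (auto simp: feasible_def)
    then show ?thesis by force
  qed
  then have "(min l l', max h h') \<in> feasible p r"
    using 1 2 by (auto simp: feasible_def)
  from walk_dist_le[OF assms(1,3) this]
  have "walk_dist p r \<le> 2 * (max h h' - min l l') - \<bar>fst p - fst r\<bar>" .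
  also have "\<dots> \<le> walk_dist p q + walk_dist q r"
    using 1 2 by (auto simp: feasible_def max_def min_def abs_if split: if_splits)
  finally show ?thesis .
qed

lemma walk_dist_refl: "p \<in> strips \<Longrightarrow> walk_dist p p = 0"
  using walk_dist_vertical[of p p] by simp

text \<open>A walk shorter than \<open>r\<close> stays within height \<open>r\<close> of its start,
  so any coordinate it changes has a wormhole that close. This is how membership in a ball becomes a
  condition on heights and coordinates.\<close>

lemma walk_dist_less_imp:
  assumes "p \<in> strips" "q \<in> strips" "walk_dist p q < r"
  shows "\<bar>fst q - fst p\<bar> < r"
    and "snd p n \<noteq> snd q n \<Longrightarrow> \<exists>z\<in>wormhole n. \<bar>z - fst p\<bar> < r"
proof -
  show "\<bar>fst q - fst p\<bar> < r" using walk_dist_ge[OF assms(1,2)] assms(3) by linarith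
  obtain l h where 1: "(l, h) \<in> feasible p q" "walk_dist p q = 2 * (h - l) - \<bar>fst p - fst q\<bar>"
    using walk_dist_attained assms by blast
  assume "snd p n \<noteq> snd q n"
  then obtain z where "z \<in> wormhole n" "l \<le> z" "z \<le> h" using 1 by (fastforce simp: feasible_def)
  moreover have "\<bar>z - fst p\<bar> < r" using 1 assms(3) calculation by (auto simp: feasible_def)
  ultimately show "\<exists>z\<in>wormhole n. \<bar>z - fst p\<bar> < r" by blast
qed

text \<open>The last hypothesis concerns only levels below \<open>n\<close>: an interval of length
  \<open>2^-n\<close> meets all finer levels by \<open>wormhole_hits\<close>.\<close>

lemma walk_dist_less_of_agree:
  assumes "p \<in> strips" "q \<in> strips" "l \<in> {0..1}" "h \<in> {0..1}" "1 / 2 ^ n \<le> h - l"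
    and "fst p \<in> {l..h}" "fst q \<in> {l..h}"
    and "\<And>m. m < n \<Longrightarrow> snd p m \<noteq> snd q m \<Longrightarrow> wormhole m \<inter> {l..h} \<noteq> {}"
  shows "walk_dist p q \<le> 2 * (h - l)"
proof -
  have "wormhole m \<inter> {l..h} \<noteq> {}" if "m \<ge> n" for m
  proof (rule wormhole_hits)
    have "1 / 2 ^ m \<le> (1 / 2 ^ n :: real)" using that by (intro divide_left_mono power_increasing) auto
    then show "1 / 2 ^ m \<le> h - l" using assms by linarith
  qed (use assms in auto)
  then have "(l, h) \<in> feasible p q"
    using assms by (auto simp: feasible_def) (metis not_le)+
  from walk_dist_le[OF assms(1,2) this] show ?thesis by linarith
qed

subsection \<open>The quotient metric space\<close>

text \<open>The theorem fixes the carrier type to \<open>real\<close>. This is a matter of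
  cardinality, so an arbitrary injection is chosen and the topology of the reals plays no part in
  the carrier.\<close>

definition encode :: "laakso_point \<Rightarrow> real" where
  "encode = (SOME f. inj f)"

lemma inj_encode: "inj encode"
proof -
  obtain g :: "nat set \<Rightarrow> real" where g: "inj g"
    using nat_sets_eqpoll_reals by (meson bij_betw_def eqpoll_def)
  obtain g' :: "real \<Rightarrow> nat set" where g': "inj g'"
    using nat_sets_eqpoll_reals by (meson bij_betw_def eqpoll_def eqpoll_sym)
  \<comment> \<open>The height is coded as a set of naturals and moved to the even numbers; the
    branch is such a set already and goes to the odd ones. The union is coded back as a
    real.\<close>
  define f :: "laakso_point \<Rightarrow> real"
    where "f p = g ((\<lambda>n. 2 * n) ` g' (fst p) \<union> (\<lambda>n. 2 * n + 1) ` {n. snd p n})" for p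
  have "p = q" if "f p = f q" for p q
  proof -
    let ?S = "\<lambda>p. (\<lambda>n. 2 * n) ` g' (fst p) \<union> (\<lambda>n. 2 * n + 1) ` {n. snd p n}"
    have eq: "?S p = ?S q" using that unfolding f_def by (rule injD[OF g])
    have odd: "2 * n \<noteq> 2 * m + 1" for m n :: nat by presburger
    have "n \<in> g' (fst p) \<longleftrightarrow> 2 * n \<in> ?S p" for n and p :: laakso_point
      using odd by (auto simp: image_iff)
    then have "g' (fst p) = g' (fst q)" using eq by blast
    moreover have "snd p n \<longleftrightarrow> 2 * n + 1 \<in> ?S p" for n and p :: laakso_point
      using odd by (auto simp: image_iff) (metis Suc_eq_plus1)
    then have "snd p n \<longleftrightarrow> snd q n" for n using eq by metis
    then have "snd p = snd q" by (intro ext)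
    ultimately
    show ?thesis using g' by (simp add: inj_eq prod_eq_iff)
  qed
  then have "inj f" by (auto intro: injI)
  then show ?thesis unfolding encode_def by (rule someI[of inj])
qed

text \<open>The predicate under \<open>SOME\<close> depends only on the class of \<open>p\<close>
  modulo distance 0, so equivalent points receive the same representative. The quotient then
  consists of points rather than of classes and can be encoded.\<close>

definition representative :: "laakso_point \<Rightarrow> laakso_point" where
  "representative p = (SOME q. q \<in> strips \<and> walk_dist p q = 0)"

definition glue :: "laakso_point \<Rightarrow> real" where
  "glue p = encode (representative p)"

definition laakso :: "real set" where
  "laakso = glue ` strips"

text \<open>The absolute value only matters off the carrier, where \<open>walk_dist\<close> may be the infimum of
  the empty set.\<close>

definition laakso_dist :: "real \<Rightarrow> real \<Rightarrow> real" where
  "laakso_dist x y = \<bar>walk_dist (inv encode x) (inv encode y)\<bar>"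

lemma representative:
  assumes "p \<in> strips"
  shows "representative p \<in> strips" "walk_dist p (representative p) = 0"
  using someI[of "\<lambda>q. q \<in> strips \<and> walk_dist p q = 0" p] assms
  by (auto simp: representative_def walk_dist_refl)

lemma walk_dist_nonneg: "p \<in> strips \<Longrightarrow> q \<in> strips \<Longrightarrow> 0 \<le> walk_dist p q"
  using walk_dist_ge[of p q] by linarith

lemma laakso_dist_glue:
  assumes "p \<in> strips" "q \<in> strips"
  shows "laakso_dist (glue p) (glue q) = walk_dist p q"
proof -
  note r = representative[OF assms(1)] representative[OF assms(2)]
  have "laakso_dist (glue p) (glue q) = walk_dist (representative p) (representative q)"
    by (simp add: laakso_dist_def glue_def inv_f_f[OF inj_encode] walk_dist_nonneg r)
  moreover have "walk_dist (representative p) (representative q) \<le> walk_dist p q"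
    using walk_dist_triangle[of "representative p" p "representative q"]
      walk_dist_triangle[of p q "representative q"] walk_dist_commute[of p] r assms by auto
  moreover have "walk_dist p q \<le> walk_dist (representative p) (representative q)"
    using walk_dist_triangle[of p "representative p" q]
      walk_dist_triangle[of "representative p" "representative q" q] walk_dist_commute[of q] r assms by auto
  ultimately show ?thesis by simp
qed

lemma glue_eq_iff:
  assumes "p \<in> strips" "q \<in> strips"
  shows "glue p = glue q \<longleftrightarrow> walk_dist p q = 0"
proof
  assume "glue p = glue q"
  then show "walk_dist p q = 0"
    using laakso_dist_glue[of p p] laakso_dist_glue[of p q] assms walk_dist_refl by simp
next
  assume *: "walk_dist p q = 0"
  have "walk_dist p r = 0 \<longleftrightarrow> walk_dist q r = 0" if "r \<in> strips" for r
    using walk_dist_triangle[of p q r] walk_dist_triangle[of q p r] walk_dist_commute[of p q]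
      walk_dist_nonneg[of p r] walk_dist_nonneg[of q r] assms * that by auto
  then have "(\<lambda>r. r \<in> strips \<and> walk_dist p r = 0) = (\<lambda>r. r \<in> strips \<and> walk_dist q r = 0)"
    by (intro ext) blast
  then have "representative p = representative q" by (simp add: representative_def)
  then show "glue p = glue q" by (simp add: glue_def)
qed

lemma laakso_cases:
  assumes "x \<in> laakso" obtains t a where "(t, a) \<in> strips" "x = glue (t, a)"
  using assms by (auto simp: laakso_def)

lemma glue_in_laakso: "p \<in> strips \<Longrightarrow> glue p \<in> laakso"
  by (simp add: laakso_def)

interpretation laakso: Metric_space laakso laakso_dist
proof
  fix x y z
  show "0 \<le> laakso_dist x y" by (simp add: laakso_dist_def)
  show "laakso_dist x y = laakso_dist y x" by (simp add: laakso_dist_def walk_dist_commute)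
  assume xy: "x \<in> laakso" "y \<in> laakso"
  then show "laakso_dist x y = 0 \<longleftrightarrow> x = y"
    by (auto simp: laakso_def laakso_dist_glue glue_eq_iff)
  assume "z \<in> laakso"
  with xy show "laakso_dist x z \<le> laakso_dist x y + laakso_dist y z"
    by (auto simp: laakso_def laakso_dist_glue intro!: walk_dist_triangle)
qed

lemma glue_in_mball:
  assumes "p \<in> strips" "q \<in> strips"
  shows "glue q \<in> laakso.mball (glue p) r \<longleftrightarrow> walk_dist p q < r"
  using assms by (simp add: laakso.in_mball laakso_dist_glue glue_in_laakso)

section \<open>Continuity of the gluing map and compactness\<close>

lemma walk_dist_small:
  assumes "(s, a) \<in> strips" "(t, b) \<in> strips" "\<bar>s - t\<bar> < 1 / 2 ^ n" "\<And>m. m < n \<Longrightarrow> a m = b m"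
  shows "walk_dist (s, a) (t, b) \<le> 4 / 2 ^ n"
proof -
  \<comment> \<open>Clipping the window to \<open>[0,1]\<close> leaves a length of at least
    \<open>2^-n\<close>, as the finer levels require; twice its largest possible length gives the
    4.\<close>
  define l where "l = max 0 (s - 1 / 2 ^ n)"
  define h where "h = min 1 (s + 1 / 2 ^ n)"
  have n: "1 / 2 ^ n \<le> (1::real)" "0 < 1 / (2 ^ n :: real)" by simp_all
  have s: "s \<in> {0..1}" "t \<in> {0..1}" using assms by (auto simp: strips_def)
  have "walk_dist (s, a) (t, b) \<le> 2 * (h - l)"
  proof (rule walk_dist_less_of_agree[where n = n])
    show "1 / 2 ^ n \<le> h - l" using n s unfolding l_def h_def by (simp add: max_def min_def)
    show "l \<in> {0..1}" "h \<in> {0..1}" "fst (s, a) \<in> {l..h}" "fst (t, b) \<in> {l..h}"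
      using n s assms(3) unfolding l_def h_def by (auto simp: max_def min_def)
  qed (use assms in auto)
  also have "\<dots> \<le> 4 / 2 ^ n"
  proof -
    have "l \<ge> s - 1 / 2 ^ n" "h \<le> s + 1 / 2 ^ n" by (simp_all add: l_def h_def)
    then show ?thesis by simp
  qed
  finally show ?thesis .
qed

text \<open>With rational ends and the prefix coded as a finite set there are countably many such
  neighbourhoods. The family serves twice: for continuity of \<open>glue\<close>, and for its
  measurability, where preimages of open sets must be countable unions.\<close>

definition strip_nbhd :: "real \<Rightarrow> real \<Rightarrow> nat \<Rightarrow> nat set \<Rightarrow> laakso_point set" where
  "strip_nbhd c d n S = {(t, a). t \<in> {0..1} \<and> c < t \<and> t < d \<and> (\<forall>m<n. a m \<longleftrightarrow> m \<in> S)}"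

lemma open_contains_strip_nbhd:
  assumes "openin laakso.mtopology U" "p \<in> strips" "glue p \<in> U"
  obtains c d n S where "c \<in> \<rat>" "d \<in> \<rat>" "S \<subseteq> {..<n}"
    "p \<in> strip_nbhd c d n S" "glue ` strip_nbhd c d n S \<subseteq> U"
proof -
  obtain r where r: "r > 0" "laakso.mball (glue p) r \<subseteq> U"
    using assms laakso.openin_mtopology by blast
  obtain n where n: "4 / 2 ^ n < r"
  proof -
    obtain n where "(1 / 2) ^ n < r / 4" using real_arch_pow_inv[of "r / 4" "1 / 2"] r by auto
    then show ?thesis using that[of n] by (simp add: power_divide)
  qed
  obtain s a where p: "p = (s, a)" by (cases p)
  obtain c where c: "c \<in> \<rat>" "s - 1 / 2 ^ n < c" "c < s" using Rats_dense_in_real[of "s - 1 / 2 ^ n" s] by auto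
  obtain d where d: "d \<in> \<rat>" "s < d" "d < s + 1 / 2 ^ n" using Rats_dense_in_real[of s "s + 1 / 2 ^ n"] by auto
  define S where "S = {m. m < n \<and> a m}"
  have "glue (t, b) \<in> U" if q: "(t, b) \<in> strip_nbhd c d n S" for t b
  proof -
    have qs: "(t, b) \<in> strips" using q by (auto simp: strip_nbhd_def strips_def)
    have "walk_dist (s, a) (t, b) \<le> 4 / 2 ^ n"
    proof (rule walk_dist_small)
      show "(s, a) \<in> strips" using assms p by simp
      show "\<bar>s - t\<bar> < 1 / 2 ^ n" using q c d by (auto simp: strip_nbhd_def)
      show "a m = b m" if "m < n" for m using q that by (auto simp: strip_nbhd_def S_def)
    qed (fact qs)
    then have "glue (t, b) \<in> laakso.mball (glue p) r"
      using glue_in_mball[OF assms(2) qs] n by (simp add: p)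
    then show ?thesis using r by blast
  qed
  then show ?thesis
    using c d assms(2) by (intro that[of c d S n]) (auto simp: S_def p strip_nbhd_def strips_def)
qed

abbreviation cantor_topology :: "(nat \<Rightarrow> bool) topology" where
  "cantor_topology \<equiv> product_topology (\<lambda>_. discrete_topology UNIV) UNIV"

lemma openin_strip_nbhd:
  "openin (prod_topology (top_of_set {0..1}) cantor_topology) (strip_nbhd c d n S)"
proof -
  have "strip_nbhd c d n S = ({0..1} \<inter> {c<..<d}) \<times> Pi\<^sub>E UNIV (\<lambda>m. if m < n then {m \<in> S} else UNIV)"
    by (auto simp: strip_nbhd_def PiE_iff split: if_splits)
  moreover have "openin (top_of_set {0..1}) ({0..1} \<inter> {c<..<d})"
    by (rule openin_open_Int) simp
  moreover have "openin cantor_topology (Pi\<^sub>E UNIV (\<lambda>m. if m < n then {m \<in> S} else UNIV))"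
    by (subst openin_PiE_gen) (auto intro: finite_subset[of _ "{..<n}"])
  ultimately show ?thesis by (simp add: openin_prod_Times_iff)
qed

text \<open>The space is the continuous image of \<open>[0,1]\<close> times the Cantor space, which
  is compact by Tychonoff.\<close>

lemma compact_space_laakso: "compact_space laakso.mtopology"
proof -
  let ?X = "prod_topology (top_of_set {0..1::real}) cantor_topology"
  have X: "topspace ?X = strips" by (auto simp: strips_def PiE_def)
  have "compact_space ?X"
  proof -
    have "compact_space cantor_topology"
      by (simp add: compact_space_product_topology compact_space_discrete_topology)
    then show ?thesis
      by (simp add: compact_space_prod_topology compact_space_subtopology)
  qed
  moreover have "continuous_map ?X laakso.mtopology glue"
    unfolding continuous_map_def X
  proof (intro conjI allI impI)
    show "glue \<in> strips \<rightarrow> topspace laakso.mtopology" by (auto simp: glue_in_laakso)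
    fix U assume U: "openin laakso.mtopology U"
    show "openin ?X {x \<in> strips. glue x \<in> U}"
    proof (subst openin_subopen, intro ballI)
      fix p assume "p \<in> {x \<in> strips. glue x \<in> U}"
      then have "p \<in> strips" "glue p \<in> U" by auto
      from open_contains_strip_nbhd[OF U this] obtain c d n S
        where *: "p \<in> strip_nbhd c d n S" "glue ` strip_nbhd c d n S \<subseteq> U" .
      have "strip_nbhd c d n S \<subseteq> strips" by (auto simp: strip_nbhd_def strips_def)
      then show "\<exists>T. openin ?X T \<and> p \<in> T \<and> T \<subseteq> {x \<in> strips. glue x \<in> U}"
        using * openin_strip_nbhd by (intro exI[of _ "strip_nbhd c d n S"]) auto
    qed
  qed
  ultimately have "compactin laakso.mtopology (glue ` topspace ?X)"
    by (metis compact_space_def image_compactin)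
  then show ?thesis
    unfolding X compact_space_def laakso.topspace_mtopology by (simp only: laakso_def)
qed

subsection \<open>Geodesics\<close>

text \<open>Distance-nonincreasing rather than isometric, because only the former is preserved by
  concatenation; isometry is recovered at the end from the total length.\<close>

definition short_path :: "(real \<Rightarrow> real) \<Rightarrow> real \<Rightarrow> real \<Rightarrow> bool" where
  "short_path f x y \<longleftrightarrow> f ` {x..y} \<subseteq> laakso \<and>
     (\<forall>u\<in>{x..y}. \<forall>v\<in>{x..y}. laakso_dist (f u) (f v) \<le> \<bar>u - v\<bar>)"

lemma short_pathD:
  assumes "short_path f x y" "x \<le> u" "u \<le> y" "x \<le> v" "v \<le> y"
  shows "laakso_dist (f u) (f v) \<le> \<bar>u - v\<bar>"
  using assms unfolding short_path_def by (meson atLeastAtMost_iff)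

lemma walk_dist_same_branch:
  "(s, a) \<in> strips \<Longrightarrow> (t, a) \<in> strips \<Longrightarrow> walk_dist (s, a) (t, a) = \<bar>s - t\<bar>"
  using walk_dist_vertical[of "(s, a)" "(t, a)"] by simp

lemma short_path_join:
  assumes f: "short_path f x y" and g: "short_path g y z" and eq: "f y = g y" and "x \<le> y" "y \<le> z"
  shows "short_path (\<lambda>u. if u \<le> y then f u else g u) x z"
proof -
  let ?k = "\<lambda>u. if u \<le> y then f u else g u"
  have M: "?k u \<in> laakso" if "u \<in> {x..z}" for u
    using f g that by (auto simp: short_path_def image_subset_iff)
  have *: "laakso_dist (?k u) (?k v) \<le> \<bar>u - v\<bar>" if uv: "u \<in> {x..z}" "v \<in> {x..z}" "u \<le> v" for u v
  proof -
    consider "v \<le> y" | "u > y" | "u \<le> y" "y < v" by linarith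
    then show ?thesis
    proof cases
      case 3
      have "laakso_dist (f u) (g v) \<le> laakso_dist (f u) (f y) + laakso_dist (g y) (g v)"
        using laakso.triangle[of "f u" "f y" "g v"] M[OF uv(1)] M[OF uv(2)] M[of y] assms(4,5) 3 eq by auto
      moreover have "laakso_dist (f u) (f y) \<le> \<bar>u - y\<bar>" "laakso_dist (g y) (g v) \<le> \<bar>y - v\<bar>"
        by (intro short_pathD[OF f] short_pathD[OF g]; use uv 3 in auto)+
      ultimately show ?thesis using 3 by auto
    qed (use uv short_pathD[OF f, of u v] short_pathD[OF g, of u v] in auto)
  qed
  have "laakso_dist (?k u) (?k v) \<le> \<bar>u - v\<bar>" if "u \<in> {x..z}" "v \<in> {x..z}" for u v
  proof (cases "u \<le> v")
    case False
    then have "laakso_dist (?k v) (?k u) \<le> \<bar>v - u\<bar>" using *[of v u] that by linarith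
    then show ?thesis by (metis abs_minus_commute laakso.commute)
  qed (use * that in blast)
  then show ?thesis unfolding short_path_def using M by blast
qed

text \<open>If some pair were closer than its parameter difference, the triangle inequality would
  bring the endpoints closer than \<open>L\<close>.\<close>

lemma short_path_isometric:
  assumes f: "short_path f 0 L" and L: "laakso_dist (f 0) (f L) = L"
    and st: "s \<in> {0..L}" "t \<in> {0..L}"
  shows "laakso_dist (f s) (f t) = \<bar>s - t\<bar>"
proof -
  have M: "f u \<in> laakso" if "u \<in> {0..L}" for u using f that by (auto simp: short_path_def)
  have *: "laakso_dist (f s) (f t) = \<bar>s - t\<bar>" if st: "s \<in> {0..L}" "t \<in> {0..L}" "s \<le> t" for s t
  proof -
    have "L \<le> laakso_dist (f 0) (f s) + laakso_dist (f s) (f t) + laakso_dist (f t) (f L)"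
      using laakso.triangle[of "f 0" "f s" "f L"] laakso.triangle[of "f s" "f t" "f L"] M st L by auto
    moreover have "laakso_dist (f 0) (f s) \<le> \<bar>0 - s\<bar>" "laakso_dist (f t) (f L) \<le> \<bar>t - L\<bar>"
      "laakso_dist (f s) (f t) \<le> \<bar>s - t\<bar>"
      by (intro short_pathD[OF f]; use st in auto)+
    ultimately show ?thesis using st by auto
  qed
  show ?thesis using *[of s t] *[of t s] st laakso.commute[of "f s" "f t"] by (cases "s \<le> t") auto
qed

text \<open>An optimal range \<open>(l, h)\<close> is walked in three legs: down to \<open>l\<close>
  on branch \<open>a\<close>, up to \<open>h\<close> while changing branch, down to \<open>t\<close>
  on branch \<open>b\<close>. The lengths \<open>s - l\<close>, \<open>h - l\<close> and
  \<open>h - t\<close> add up to \<open>2 * (h - l) - (t - s)\<close>.\<close>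

lemma laakso_geodesic_aux:
  assumes p: "(s, a) \<in> strips" "(t, b) \<in> strips" "s \<le> t"
  obtains f where "short_path f 0 (walk_dist (s, a) (t, b))"
    "f 0 = glue (s, a)" "f (walk_dist (s, a) (t, b)) = glue (t, b)"
proof -
  obtain l h where lh: "(l, h) \<in> feasible (s, a) (t, b)" and D: "walk_dist (s, a) (t, b) = 2 * (h - l) - (t - s)"
    using walk_dist_attained[OF p(1,2)] p(3) by (metis abs_minus_commute abs_of_nonneg diff_ge_0_iff_ge fst_conv)
  have l: "0 \<le> l" "l \<le> s" "t \<le> h" "h \<le> 1" using lh by (auto simp: feasible_def)
  define z where "z n = (SOME x. x \<in> wormhole n \<inter> {l..h})" for n
  have z: "z n \<in> wormhole n \<inter> {l..h}" if "a n \<noteq> b n" for n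
  proof -
    have "wormhole n \<inter> {l..h} \<noteq> {}" using that lh by (simp add: feasible_def)
    then have "\<exists>x. x \<in> wormhole n \<inter> {l..h}" by blast
    then show ?thesis unfolding z_def by (rule someI_ex)
  qed
  \<comment> \<open>Coordinate \<open>n\<close> is switched when the ascent passes the chosen height
    \<open>z n\<close>. Infinitely many switches may occur, but this leg remains isometric: if
    \<open>mid u\<close> and \<open>mid v\<close> differ at \<open>n\<close>, then
    \<open>z n\<close> lies between \<open>u\<close> and \<open>v\<close>.\<close>
  define mid where "mid y = (\<lambda>n. if a n \<noteq> b n \<and> z n \<le> y then b n else a n)" for y
  define f1 where "f1 u = glue (s - u, a)" for u
  define f2 where "f2 u = glue (u + 2 * l - s, mid (u + 2 * l - s))" for u
  define f3 where "f3 u = glue (2 * h - 2 * l + s - u, b)" for u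
  have sp1: "short_path f1 0 (s - l)"
  proof -
    have "(s - u, a) \<in> strips" if "u \<in> {0..s - l}" for u using that l p by (auto simp: strips_def)
    then show ?thesis
      by (auto simp: short_path_def f1_def glue_in_laakso laakso_dist_glue walk_dist_same_branch abs_minus_commute)
  qed
  have sp2: "short_path f2 (s - l) (s - l + (h - l))"
  proof -
    have i: "(u + 2 * l - s, mid (u + 2 * l - s)) \<in> strips" if "u \<in> {s - l..s - l + (h - l)}" for u
      using that l p by (auto simp: strips_def)
    have "walk_dist (u, mid u) (v, mid v) = \<bar>u - v\<bar>" if "(u, mid u) \<in> strips" "(v, mid v) \<in> strips" for u v
    proof -
      have "wormhole n \<inter> {min u v..max u v} \<noteq> {}" if "mid u n \<noteq> mid v n" for n
      proof -
        have "z n \<in> {min u v..max u v}" "a n \<noteq> b n" using that by (auto simp: mid_def split: if_splits)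
        then show ?thesis using z[of n] by blast
      qed
      then show ?thesis using walk_dist_vertical[OF that] by simp
    qed
    then show ?thesis using i
      by (auto simp: short_path_def f2_def glue_in_laakso laakso_dist_glue)
  qed
  have sp3: "short_path f3 (s - l + (h - l)) (2 * (h - l) - (t - s))"
  proof -
    have "(2 * h - 2 * l + s - u, b) \<in> strips" if "u \<in> {s - l + (h - l)..2 * (h - l) - (t - s)}" for u
      using that l p by (auto simp: strips_def)
    then show ?thesis
      by (auto simp: short_path_def f3_def glue_in_laakso laakso_dist_glue walk_dist_same_branch abs_minus_commute)
  qed
  \<comment> \<open>Switches with \<open>z n = l\<close> have already happened in
    \<open>mid l\<close>; they happen at a wormhole, so both branches give the same point.\<close>
  have j1: "f1 (s - l) = f2 (s - l)"
  proof -
    have "walk_dist (l, a) (l, mid l) = \<bar>l - l\<bar>"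
    proof (subst walk_dist_vertical)
      fix n assume "snd (l, a) n \<noteq> snd (l, mid l) n"
      then have "a n \<noteq> b n" "z n \<le> l" by (auto simp: mid_def split: if_splits)
      then have "z n = l" "l \<in> wormhole n" using z[of n] by auto
      then show "wormhole n \<inter> {min (fst (l, a)) (fst (l, mid l))..max (fst (l, a)) (fst (l, mid l))} \<noteq> {}" by auto
    qed (use l p in \<open>auto simp: strips_def\<close>)
    then have "glue (l, a) = glue (l, mid l)"
      using l p by (subst glue_eq_iff) (auto simp: strips_def)
    then show ?thesis by (simp add: f1_def f2_def)
  qed
  have mh: "mid h = b" using z by (auto simp: mid_def)
  have j2: "f2 (s - l + (h - l)) = f3 (s - l + (h - l))"
    by (simp add: f2_def f3_def mh)
  define g where "g = (\<lambda>u. if u \<le> s - l then f1 u else (if u \<le> s - l + (h - l) then f2 u else f3 u))"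
  have "short_path g 0 (walk_dist (s, a) (t, b))"
    unfolding g_def D
  proof (rule short_path_join[OF sp1])
    show "short_path (\<lambda>u. if u \<le> s - l + (h - l) then f2 u else f3 u) (s - l) (2 * (h - l) - (t - s))"
      by (rule short_path_join[OF sp2 sp3 j2]) (use l p in auto)
  qed (use l p j1 in auto)
  moreover have "g 0 = glue (s, a)" using l by (simp add: g_def f1_def)
  moreover have "g (2 * (h - l) - (t - s)) = glue (t, b)"
  \<comment> \<open>If \<open>h = t\<close>, the last leg has length 0 and the final parameter falls
    into the case of an earlier leg of \<open>g\<close>, so the joining equations are
    needed.\<close>
  proof (cases "h = t")
    case False
    then have "\<not> 2 * (h - l) - (t - s) \<le> s - l + (h - l)" using l by auto
    then have "g (2 * (h - l) - (t - s)) = f3 (2 * (h - l) - (t - s))" using l p by (auto simp: g_def)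
    then show ?thesis by (simp add: f3_def)
  next
    case True
    have "f3 (s - l + (h - l)) = glue (t, b)" by (simp add: f3_def True)
    moreover have "g (s - l + (h - l)) = f3 (s - l + (h - l))"
    proof (cases "h = l")
      case True
      then show ?thesis using j1 j2 by (simp add: g_def)
    next
      case False
      then show ?thesis using j2 l p by (auto simp: g_def)
    qed
    ultimately show ?thesis using True by (simp add: algebra_simps)
  qed
  ultimately show ?thesis using that D by simp
qed

lemma geodesic_space_laakso: "geodesic_space laakso laakso_dist"
  unfolding geodesic_space_def
proof (intro ballI)
  fix x y assume "x \<in> laakso" "y \<in> laakso"
  then obtain s a t b where x: "(s, a) \<in> strips" "x = glue (s, a)" and y: "(t, b) \<in> strips" "y = glue (t, b)"
    by (metis laakso_cases)
  let ?D = "laakso_dist x y"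
  have D: "?D = walk_dist (s, a) (t, b)" using x y by (simp add: laakso_dist_glue)
  have D0: "?D \<ge> 0" by (rule laakso.nonneg)
  have "\<exists>f. short_path f 0 ?D \<and> f 0 = x \<and> f ?D = y"
  proof (cases "s \<le> t")
    case True
    then show ?thesis using laakso_geodesic_aux[OF x(1) y(1)] D x y by metis
  next
    case False
    then obtain f where f: "short_path f 0 ?D" "f 0 = y" "f ?D = x"
      using laakso_geodesic_aux[OF y(1) x(1)] D x y walk_dist_commute[of "(s, a)"] by (metis linear)
    have "short_path (\<lambda>u. f (?D - u)) 0 ?D"
      unfolding short_path_def
    proof (intro conjI ballI)
      show "(\<lambda>u. f (?D - u)) ` {0..?D} \<subseteq> laakso" using f(1) by (auto simp: short_path_def)
      fix u v assume "u \<in> {0..?D}" "v \<in> {0..?D}"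
      then have "laakso_dist (f (?D - u)) (f (?D - v)) \<le> \<bar>(?D - u) - (?D - v)\<bar>"
        by (intro short_pathD[OF f(1)]) auto
      then show "laakso_dist (f (?D - u)) (f (?D - v)) \<le> \<bar>u - v\<bar>" by (simp add: abs_minus_commute)
    qed
    then show ?thesis using f by (intro exI[of _ "\<lambda>u. f (?D - u)"]) auto
  qed
  then obtain f where f: "short_path f 0 ?D" "f 0 = x" "f ?D = y" by blast
  have "f u \<in> laakso" if "u \<in> {0..?D}" for u using f(1) that by (auto simp: short_path_def)
  then show "\<exists>\<gamma>. \<gamma> 0 = x \<and> \<gamma> ?D = y \<and>
      (\<forall>s\<in>{0..?D}. \<forall>t\<in>{0..?D}. \<gamma> s \<in> laakso \<and> laakso_dist (\<gamma> s) (\<gamma> t) = \<bar>s - t\<bar>)"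
    using f short_path_isometric[OF f(1)] by (intro exI[of _ f]) auto
qed

subsection \<open>Coin tossing measures\<close>

definition coins :: "real \<Rightarrow> (nat \<Rightarrow> bool) measure" where
  "coins w = Pi\<^sub>M UNIV (\<lambda>_. measure_pmf (bernoulli_pmf w))"

interpretation coin: product_prob_space "\<lambda>_::nat. measure_pmf (bernoulli_pmf w)" UNIV for w
  by unfold_locales

lemma space_coins [simp]: "space (coins w) = UNIV"
  by (simp add: coins_def space_PiM)

lemma prob_space_coins: "prob_space (coins w)"
  unfolding coins_def by (rule coin.P.prob_space_axioms)

interpretation coins: prob_space "coins w" for w
  by (rule prob_space_coins)

interpretation coins2: pair_prob_space "coins w" "coins w" for w ..

lemma measurable_coins_component [measurable]: "(\<lambda>\<alpha>. \<alpha> i) \<in> coins w \<rightarrow>\<^sub>M count_space UNIV"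
proof -
  have "(\<lambda>\<alpha>. \<alpha> i) \<in> coins w \<rightarrow>\<^sub>M measure_pmf (bernoulli_pmf w)"
    unfolding coins_def by (rule measurable_component_singleton) simp
  then show ?thesis by simp
qed

lemma measurable_coinsI:
  assumes "\<And>i. (\<lambda>x. f x i) \<in> N \<rightarrow>\<^sub>M count_space UNIV"
  shows "f \<in> N \<rightarrow>\<^sub>M coins w"
  unfolding coins_def
  by (rule measurable_PiM_single') (use assms in auto)

section \<open>Resampling coordinates and conditioning on a prefix\<close>

definition mix :: "nat set \<Rightarrow> (nat \<Rightarrow> bool) \<Rightarrow> (nat \<Rightarrow> bool) \<Rightarrow> nat \<Rightarrow> bool" where
  "mix S \<alpha> \<beta> = (\<lambda>i. if i \<in> S then \<alpha> i else \<beta> i)"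

lemma measurable_mix [measurable]: "(\<lambda>x. mix S (fst x) (snd x)) \<in> coins w \<Otimes>\<^sub>M coins w \<rightarrow>\<^sub>M coins w"
proof (rule measurable_coinsI)
  fix i show "(\<lambda>x. mix S (fst x) (snd x) i) \<in> coins w \<Otimes>\<^sub>M coins w \<rightarrow>\<^sub>M count_space UNIV"
    by (cases "i \<in> S") (simp_all add: mix_def)
qed

lemma measurable_mix2 [measurable]: "mix S \<alpha> \<in> coins w \<rightarrow>\<^sub>M coins w"
proof (rule measurable_coinsI)
  fix i show "(\<lambda>x. mix S \<alpha> x i) \<in> coins w \<rightarrow>\<^sub>M count_space UNIV"
    by (cases "i \<in> S") (simp_all add: mix_def)
qed

lemma cylinder_in_sets:
  assumes "finite J"
  shows "{\<alpha>. \<forall>i\<in>J. \<alpha> i \<in> E i} \<in> sets (coins w)"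
proof -
  have "{\<alpha> \<in> space (coins w). \<forall>i\<in>J. \<alpha> i \<in> E i} \<in> sets (coins w)"
    by (rule sets.sets_Collect_finite_All[OF _ assms]) measurable
  then show ?thesis by simp
qed

lemma emeasure_coins_cylinder:
  assumes "finite J"
  shows "emeasure (coins w) {\<alpha>. \<forall>i\<in>J. \<alpha> i \<in> E i} = (\<Prod>i\<in>J. emeasure (measure_pmf (bernoulli_pmf w)) (E i))"
  using coin.emeasure_PiM_Collect[of J E w] assms by (simp add: coins_def space_PiM)

lemma prod_emb_coins: "prod_emb UNIV (\<lambda>_. measure_pmf p) J (Pi\<^sub>E J E) = {\<alpha>. \<forall>i\<in>J. \<alpha> i \<in> E i}"
  by (auto simp: prod_emb_def PiE_def Pi_iff)

text \<open>Coordinates are independent, so taking each one from either of two independent samples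
  by a fixed rule does not change the law. This is the invariance behind the Poincare inequality,
  and it holds for every bias.\<close>

lemma distr_mix: "distr (coins w \<Otimes>\<^sub>M coins w) (coins w) (\<lambda>x. mix S (fst x) (snd x)) = coins w"
proof -
  let ?D = "distr (coins w \<Otimes>\<^sub>M coins w) (coins w) (\<lambda>x. mix S (fst x) (snd x))"
  have "?D = Pi\<^sub>M UNIV (\<lambda>_. measure_pmf (bernoulli_pmf w))"
  proof (rule coin.PiM_eq)
    show "sets ?D = sets (Pi\<^sub>M UNIV (\<lambda>_. measure_pmf (bernoulli_pmf w)))" by (simp add: coins_def)
    fix J :: "nat set" and E :: "nat \<Rightarrow> bool set" assume J: "finite J"
    let ?C = "\<lambda>J. {\<alpha>. \<forall>i\<in>J. \<alpha> i \<in> E i}"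
    have C: "?C J \<in> sets (coins w)" if "finite J" for J by (rule cylinder_in_sets[OF that])
    \<comment> \<open>Under mixing, a cylinder becomes a rectangle: its conditions in
      \<open>S\<close> fall on the first sample, the others on the second.\<close>
    have "(\<lambda>x. mix S (fst x) (snd x)) -` ?C J \<inter> space (coins w \<Otimes>\<^sub>M coins w) = ?C (J \<inter> S) \<times> ?C (J - S)"
      by (auto simp: mix_def space_pair_measure)
    then have "emeasure ?D (?C J) = emeasure (coins w \<Otimes>\<^sub>M coins w) (?C (J \<inter> S) \<times> ?C (J - S))"
      by (simp add: emeasure_distr C J)
    also have "\<dots> = emeasure (coins w) (?C (J \<inter> S)) * emeasure (coins w) (?C (J - S))"
      by (rule coins.emeasure_pair_measure_Times) (use J C in auto)
    also have "\<dots> = (\<Prod>i\<in>J \<inter> S. emeasure (measure_pmf (bernoulli_pmf w)) (E i)) *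
        (\<Prod>i\<in>J - S. emeasure (measure_pmf (bernoulli_pmf w)) (E i))"
      using J by (simp add: emeasure_coins_cylinder)
    also have "\<dots> = (\<Prod>i\<in>J. emeasure (measure_pmf (bernoulli_pmf w)) (E i))"
      using J by (metis prod.Int_Diff)
    finally show "emeasure ?D (prod_emb UNIV (\<lambda>_. measure_pmf (bernoulli_pmf w)) J (Pi\<^sub>E J E)) =
        (\<Prod>i\<in>J. emeasure (measure_pmf (bernoulli_pmf w)) (E i))"
      unfolding prod_emb_coins .
  qed
  then show ?thesis by (simp add: coins_def)
qed

lemma nn_integral_mix:
  assumes [measurable]: "g \<in> borel_measurable (coins w)"
  shows "(\<integral>\<^sup>+x. g (mix S (fst x) (snd x)) \<partial>(coins w \<Otimes>\<^sub>M coins w)) = (\<integral>\<^sup>+\<alpha>. g \<alpha> \<partial>coins w)"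
proof -
  have "(\<integral>\<^sup>+\<alpha>. g \<alpha> \<partial>coins w) = (\<integral>\<^sup>+\<alpha>. g \<alpha> \<partial>distr (coins w \<Otimes>\<^sub>M coins w) (coins w) (\<lambda>x. mix S (fst x) (snd x)))"
    by (simp add: distr_mix)
  also have "\<dots> = (\<integral>\<^sup>+x. g (mix S (fst x) (snd x)) \<partial>(coins w \<Otimes>\<^sub>M coins w))"
    by (rule nn_integral_distr) simp_all
  finally show ?thesis by simp
qed

definition cylinder :: "nat \<Rightarrow> (nat \<Rightarrow> bool) \<Rightarrow> (nat \<Rightarrow> bool) set" where
  "cylinder n a = {\<alpha>. \<forall>i<n. \<alpha> i = a i}"

definition coin_weight :: "real \<Rightarrow> nat \<Rightarrow> (nat \<Rightarrow> bool) \<Rightarrow> real" where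
  "coin_weight w n a = (\<Prod>i<n. if a i then w else 1 - w)"

lemma cylinder_sets [measurable]: "cylinder n a \<in> sets (coins w)"
  using cylinder_in_sets[of "{..<n}" "\<lambda>i. {a i}"] by (simp add: cylinder_def Ball_def)

lemma emeasure_cylinder:
  assumes "w \<in> {0..1}"
  shows "emeasure (coins w) (cylinder n a) = ennreal (coin_weight w n a)"
proof -
  have "cylinder n a = {\<alpha>. \<forall>i\<in>{..<n}. \<alpha> i \<in> {a i}}" by (auto simp: cylinder_def)
  then have "emeasure (coins w) (cylinder n a) = (\<Prod>i<n. emeasure (measure_pmf (bernoulli_pmf w)) {a i})"
    using emeasure_coins_cylinder[of "{..<n}" w "\<lambda>i. {a i}"] by simp
  also have "\<dots> = (\<Prod>i<n. ennreal (if a i then w else 1 - w))"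
    by (intro prod.cong) (use assms in \<open>auto simp: emeasure_pmf_single\<close>)
  also have "\<dots> = ennreal (coin_weight w n a)"
    unfolding coin_weight_def by (rule prod_ennreal) (use assms in auto)
  finally show ?thesis .
qed

lemma coin_weight_pos: "w \<in> {0<..<1} \<Longrightarrow> 0 < coin_weight w n a"
  unfolding coin_weight_def by (rule prod_pos) auto

text \<open>With prefix and tail taken from independent samples, the cylinder constrains only the
  first sample and the integrand reads only the second, so the integral factors.\<close>

lemma nn_integral_cylinder:
  assumes [measurable]: "g \<in> borel_measurable (coins w)"
  shows "(\<integral>\<^sup>+\<alpha>\<in>cylinder n a. g \<alpha> \<partial>coins w) =
    emeasure (coins w) (cylinder n a) * (\<integral>\<^sup>+\<beta>. g (mix {..<n} a \<beta>) \<partial>coins w)"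
proof -
  have "(\<integral>\<^sup>+\<alpha>\<in>cylinder n a. g \<alpha> \<partial>coins w) =
      (\<integral>\<^sup>+x. g (mix {..<n} (fst x) (snd x)) * indicator (cylinder n a) (mix {..<n} (fst x) (snd x)) \<partial>(coins w \<Otimes>\<^sub>M coins w))"
    using nn_integral_mix[of "\<lambda>\<alpha>. g \<alpha> * indicator (cylinder n a) \<alpha>" w "{..<n}"] by simp
  also have "\<dots> = (\<integral>\<^sup>+x. indicator (cylinder n a) (fst x) * g (mix {..<n} a (snd x)) \<partial>(coins w \<Otimes>\<^sub>M coins w))"
  proof (rule nn_integral_cong)
    fix x :: "(nat \<Rightarrow> bool) \<times> (nat \<Rightarrow> bool)"
    have "mix {..<n} (fst x) (snd x) \<in> cylinder n a \<longleftrightarrow> fst x \<in> cylinder n a"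
      by (auto simp: mix_def cylinder_def)
    moreover have "mix {..<n} (fst x) (snd x) = mix {..<n} a (snd x)" if "fst x \<in> cylinder n a"
      using that by (auto simp: mix_def cylinder_def)
    ultimately show "g (mix {..<n} (fst x) (snd x)) * indicator (cylinder n a) (mix {..<n} (fst x) (snd x)) =
        indicator (cylinder n a) (fst x) * g (mix {..<n} a (snd x))"
      by (auto simp: indicator_def)
  qed
  also have "\<dots> = (\<integral>\<^sup>+\<alpha>. (\<integral>\<^sup>+\<beta>. indicator (cylinder n a) \<alpha> * g (mix {..<n} a \<beta>) \<partial>coins w) \<partial>coins w)"
    by (subst coins.nn_integral_fst[symmetric]) simp_all
  also have "\<dots> = (\<integral>\<^sup>+\<alpha>. indicator (cylinder n a) \<alpha> * (\<integral>\<^sup>+\<beta>. g (mix {..<n} a \<beta>) \<partial>coins w) \<partial>coins w)"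
    by (simp add: nn_integral_cmult)
  also have "\<dots> = emeasure (coins w) (cylinder n a) * (\<integral>\<^sup>+\<beta>. g (mix {..<n} a \<beta>) \<partial>coins w)"
    by (simp add: nn_integral_multc)
  finally show ?thesis .
qed

declare measurable_coins_component [measurable del]

subsection \<open>The measures on the quotient\<close>

abbreviation unit_lebesgue :: "real measure" where
  "unit_lebesgue \<equiv> restrict_space lborel {0..1}"

definition strip_measure :: "real \<Rightarrow> laakso_point measure" where
  "strip_measure w = unit_lebesgue \<Otimes>\<^sub>M coins w"

definition laakso_borel :: "real measure" where
  "laakso_borel = sigma laakso (metric_borel laakso laakso_dist)"

definition laakso_measure :: "real \<Rightarrow> real measure" where
  "laakso_measure w = distr (strip_measure w) laakso_borel glue"

lemma prob_space_unit_lebesgue: "prob_space unit_lebesgue"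
  by (rule prob_spaceI) (simp add: emeasure_restrict_space space_restrict_space)

interpretation unit_lebesgue: prob_space unit_lebesgue
  by (rule prob_space_unit_lebesgue)

interpretation strip: pair_prob_space unit_lebesgue "coins w" for w ..

lemma prob_space_strip_measure: "prob_space (strip_measure w)"
  unfolding strip_measure_def by (rule strip.prob_space_axioms)

lemma space_strip_measure [simp]: "space (strip_measure w) = strips"
  by (simp add: strip_measure_def space_pair_measure strips_def space_restrict_space)

lemma openin_laakso_subset: "{U. openin laakso.mtopology U} \<subseteq> Pow laakso"
  by (auto simp: laakso.openin_mtopology)

lemma space_laakso_borel [simp]: "space laakso_borel = laakso"
  by (simp add: laakso_borel_def space_measure_of_conv)

lemma sets_laakso_borel: "sets laakso_borel = metric_borel laakso laakso_dist"
proof -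
  have "sigma_algebra laakso (metric_borel laakso laakso_dist)"
    unfolding metric_borel_def by (rule sigma_algebra_sigma_sets[OF openin_laakso_subset])
  then show ?thesis
    unfolding laakso_borel_def by (rule sigma_algebra.sets_measure_of_eq)
qed

lemma open_in_sets_laakso_borel: "openin laakso.mtopology U \<Longrightarrow> U \<in> sets laakso_borel"
  by (auto simp: sets_laakso_borel metric_borel_def)

lemma strip_nbhd_sets: "strip_nbhd c d n S \<in> sets (strip_measure w)"
proof -
  have "strip_nbhd c d n S = ({0..1} \<inter> {c<..<d}) \<times> cylinder n (\<lambda>m. m \<in> S)"
    by (auto simp: strip_nbhd_def cylinder_def)
  moreover have "{0..1} \<inter> {c<..<d} \<in> sets unit_lebesgue"
    by (auto simp: sets_restrict_space)
  ultimately show ?thesis by (simp add: strip_measure_def cylinder_sets)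
qed

lemma measurable_glue [measurable]: "glue \<in> strip_measure w \<rightarrow>\<^sub>M laakso_borel"
proof (rule measurable_sigma_sets)
  show "sets laakso_borel = sigma_sets laakso {U. openin laakso.mtopology U}"
    by (simp add: sets_laakso_borel metric_borel_def)
  show "{U. openin laakso.mtopology U} \<subseteq> Pow laakso" by (rule openin_laakso_subset)
  show "glue \<in> space (strip_measure w) \<rightarrow> laakso" by (auto simp: glue_in_laakso)
  fix U assume "U \<in> {U. openin laakso.mtopology U}"
  then have U: "openin laakso.mtopology U" by simp
  define K where "K = {(c, d, n, S). c \<in> \<rat> \<and> d \<in> \<rat> \<and> S \<in> Pow {..<n} \<and> glue ` strip_nbhd c d n S \<subseteq> U}"
  have "countable K"
  proof (rule countable_subset)
    show "K \<subseteq> \<rat> \<times> \<rat> \<times> (SIGMA n:UNIV. Pow {..<n})" by (auto simp: K_def)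
    show "countable (\<rat> \<times> \<rat> \<times> (SIGMA n:(UNIV::nat set). Pow {..<n}))"
      by (intro countable_SIGMA countable_rat) (auto intro: countable_finite)
  qed
  have "glue -` U \<inter> space (strip_measure w) = (\<Union>(c, d, n, S)\<in>K. strip_nbhd c d n S)"
  proof (intro equalityI subsetI)
    fix p assume "p \<in> glue -` U \<inter> space (strip_measure w)"
    then have "p \<in> strips" "glue p \<in> U" by auto
    from open_contains_strip_nbhd[OF U this] obtain c d n S
      where "c \<in> \<rat>" "d \<in> \<rat>" "S \<subseteq> {..<n}" "p \<in> strip_nbhd c d n S" "glue ` strip_nbhd c d n S \<subseteq> U" .
    then show "p \<in> (\<Union>(c, d, n, S)\<in>K. strip_nbhd c d n S)"
      by (intro UN_I[of "(c, d, n, S)"]) (auto simp: K_def)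
  next
    fix p assume "p \<in> (\<Union>(c, d, n, S)\<in>K. strip_nbhd c d n S)"
    then obtain c d n S where "p \<in> strip_nbhd c d n S" "glue ` strip_nbhd c d n S \<subseteq> U"
      by (auto simp: K_def)
    moreover have "strip_nbhd c d n S \<subseteq> strips" by (auto simp: strip_nbhd_def strips_def)
    ultimately show "p \<in> glue -` U \<inter> space (strip_measure w)" by auto
  qed
  also have "\<dots> \<in> sets (strip_measure w)"
    by (intro sets.countable_UN' \<open>countable K\<close>) (auto simp: strip_nbhd_sets)
  finally show "glue -` U \<inter> space (strip_measure w) \<in> sets (strip_measure w)" .
qed

lemma space_laakso_measure [simp]: "space (laakso_measure w) = laakso"
  by (simp add: laakso_measure_def)

lemma sets_laakso_measure [measurable_cong]: "sets (laakso_measure w) = sets laakso_borel"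
  by (simp add: laakso_measure_def)

lemma prob_space_laakso_measure: "prob_space (laakso_measure w)"
  unfolding laakso_measure_def
  by (rule prob_space.prob_space_distr[OF prob_space_strip_measure measurable_glue])

lemma borel_prob_measure_laakso: "borel_prob_measure laakso laakso_dist (laakso_measure w)"
  by (simp add: borel_prob_measure_def prob_space_laakso_measure sets_laakso_measure sets_laakso_borel)

subsection \<open>Asymptotically negligible perturbations in \<open>L\<^sup>1\<close>\<close>

text \<open>The null sequence may depend on \<open>e\<close>, which suits approximation arguments
  where the approximant is fixed before \<open>m\<close> grows.\<close>

lemma ennreal_tendsto_0I:
  fixes f :: "nat \<Rightarrow> ennreal"
  assumes "\<And>e::real. e > 0 \<Longrightarrow> \<exists>b. b \<longlonglongrightarrow> 0 \<and> (\<forall>m. f m \<le> b m + ennreal e)"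
  shows "f \<longlonglongrightarrow> 0"
proof (rule order_tendstoI)
  fix a :: ennreal assume "0 < a"
  then obtain e where e: "0 < e" "ennreal (2 * e) < a"
  proof -
    obtain c where c: "0 < c" "c < a" using dense[OF \<open>0 < a\<close>] by blast
    then have "c < top" using less_le_trans top_greatest by blast
    then obtain r where r: "c = ennreal r" "r \<ge> 0" by (cases c) auto
    then have "0 < r" "ennreal r < a" using c by auto
    then show ?thesis using that[of "r / 2"] by simp
  qed
  obtain b where b: "b \<longlonglongrightarrow> 0" "\<And>m. f m \<le> b m + ennreal e" using assms e by blast
  have "\<forall>\<^sub>F m in sequentially. b m < ennreal e"
    using order_tendstoD(2)[OF b(1), of "ennreal e"] e by simp
  then show "\<forall>\<^sub>F m in sequentially. f m < a"
  proof eventually_elim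
    case (elim m)
    have "f m \<le> ennreal e + ennreal e" using b(2)[of m] elim by (meson add_right_mono less_imp_le order_trans)
    also have "\<dots> = ennreal (2 * e)" using e by (simp flip: ennreal_plus)
    finally show ?case using e by simp
  qed
qed simp

text \<open>Two ways of sampling \<open>N\<close>. As both have the same law, the error of replacing
  a set or a function by an approximant is bounded uniformly in \<open>m\<close>; this replaces
  continuity, which an integrable function lacks.\<close>

locale asymptotic_perturbation =
  fixes K :: "'k measure" and N :: "'n measure" and T :: "nat \<Rightarrow> 'k \<Rightarrow> 'n" and U :: "'k \<Rightarrow> 'n"
  assumes finite_N: "finite_measure N"
    and measurable_T [measurable]: "\<And>m. T m \<in> K \<rightarrow>\<^sub>M N"
    and measurable_U [measurable]: "U \<in> K \<rightarrow>\<^sub>M N"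
    and distr_T: "\<And>m. distr K N (T m) = N"
    and distr_U: "distr K N U = N"
begin

definition disagreement :: "nat \<Rightarrow> 'n set \<Rightarrow> 'k set" where
  "disagreement m A = {z \<in> space K. (T m z \<in> A) \<noteq> (U z \<in> A)}"

lemma disagreement_sets [measurable]: "A \<in> sets N \<Longrightarrow> disagreement m A \<in> sets K"
proof -
  assume [measurable]: "A \<in> sets N"
  have "disagreement m A = ((T m -` A \<inter> space K) - (U -` A \<inter> space K)) \<union> ((U -` A \<inter> space K) - (T m -` A \<inter> space K))"
    by (auto simp: disagreement_def)
  also have "\<dots> \<in> sets K" by measurable
  finally show ?thesis .
qed

lemma emeasure_vimage_T: "A \<in> sets N \<Longrightarrow> emeasure K (T m -` A \<inter> space K) = emeasure N A"
  by (metis distr_T emeasure_distr measurable_T)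

lemma emeasure_vimage_U: "A \<in> sets N \<Longrightarrow> emeasure K (U -` A \<inter> space K) = emeasure N A"
  by (metis distr_U emeasure_distr measurable_U)

lemma nn_integral_T: "g \<in> borel_measurable N \<Longrightarrow> (\<integral>\<^sup>+z. g (T m z) \<partial>K) = (\<integral>\<^sup>+x. g x \<partial>N)"
  by (metis distr_T measurable_T nn_integral_distr)

lemma nn_integral_U: "g \<in> borel_measurable N \<Longrightarrow> (\<integral>\<^sup>+z. g (U z) \<partial>K) = (\<integral>\<^sup>+x. g x \<partial>N)"
  by (metis distr_U measurable_U nn_integral_distr)

text \<open>Dynkin's argument. For a disjoint union, the tail of the union has small
  \<open>N\<close>-measure, and \<open>T m\<close> and \<open>U\<close> hit it with exactly that
  measure, whatever \<open>m\<close> is; the finitely many remaining sets are covered by the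
  induction hypothesis.\<close>

lemma disagreement_tendsto_0:
  assumes gen: "sets N = sigma_sets (space N) G" "Int_stable G" "G \<subseteq> Pow (space N)"
    and conv: "\<And>A. A \<in> G \<Longrightarrow> (\<lambda>m. emeasure K (disagreement m A)) \<longlonglongrightarrow> 0"
    and A: "A \<in> sets N"
  shows "(\<lambda>m. emeasure K (disagreement m A)) \<longlonglongrightarrow> 0"
proof -
  interpret N: finite_measure N by (rule finite_N)
  have "A \<in> sigma_sets (space N) G" using A gen(1) by simp
  with gen(2,3) show ?thesis
  proof (induction rule: sigma_sets_induct_disjoint)
    case (basic A) then show ?case by (rule conv)
  next
    case empty then show ?case by (simp add: disagreement_def)
  next
    case (compl A)
    have "disagreement m (space N - A) = disagreement m A" for m
      using measurable_space[OF measurable_T] measurable_space[OF measurable_U] by (auto simp: disagreement_def)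
    then show ?case using compl by simp
  next
    case (union A)
    have A[measurable]: "A i \<in> sets N" for i using union(2) gen(1) by auto
    define R where "R n = (\<Union>i\<in>{n..}. A i)" for n
    have R[measurable]: "R n \<in> sets N" for n unfolding R_def by measurable
    have "(\<lambda>n. emeasure N (R n)) \<longlonglongrightarrow> emeasure N (\<Inter>n. R n)"
    proof (rule Lim_emeasure_decseq)
      show "decseq R" by (rule decseq_SucI) (auto simp: R_def intro: Suc_leD)
    qed (use R in auto)
    moreover have "(\<Inter>n. R n) = {}"
    proof (rule ccontr)
      assume "(\<Inter>n. R n) \<noteq> {}"
      then obtain x where x: "\<And>n. x \<in> R n" by auto
      obtain i where i: "x \<in> A i" using x[of 0] by (auto simp: R_def)
      obtain j where j: "j \<ge> Suc i" "x \<in> A j" using x[of "Suc i"] by (auto simp: R_def)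
      have "A i \<inter> A j = {}" using j union(1) by (auto simp: disjoint_family_on_def)
      then show False using i j by blast
    qed
    ultimately have R0: "(\<lambda>n. emeasure N (R n)) \<longlonglongrightarrow> 0" by simp
    show ?case
    proof (rule ennreal_tendsto_0I)
      fix e :: real assume "e > 0"
      then have "\<forall>\<^sub>F n in sequentially. emeasure N (R n) < ennreal (e / 2)"
        by (intro order_tendstoD(2)[OF R0]) simp
      then obtain n where n: "emeasure N (R n) < ennreal (e / 2)"
        by (auto simp: eventually_sequentially)
      have "emeasure K (disagreement m (\<Union>i. A i)) \<le> (\<Sum>i<n. emeasure K (disagreement m (A i))) + ennreal e" for m
      proof -
        have "disagreement m (\<Union>i. A i) \<subseteq>
            (\<Union>i\<in>{..<n}. disagreement m (A i)) \<union> ((T m -` R n \<inter> space K) \<union> (U -` R n \<inter> space K))"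
        proof
          fix z assume z: "z \<in> disagreement m (\<Union>i. A i)"
          have "(x \<in> (\<Union>i. A i)) = (\<exists>i<n. x \<in> A i)" if "x \<notin> R n" for x
            using that by (auto simp: R_def) (metis atLeast_iff linorder_not_less)
          then show "z \<in> (\<Union>i\<in>{..<n}. disagreement m (A i)) \<union> ((T m -` R n \<inter> space K) \<union> (U -` R n \<inter> space K))"
            using z by (fastforce simp: disagreement_def)
        qed
        then have "emeasure K (disagreement m (\<Union>i. A i)) \<le> emeasure K ((\<Union>i\<in>{..<n}. disagreement m (A i)) \<union>
            ((T m -` R n \<inter> space K) \<union> (U -` R n \<inter> space K)))"
          by (rule emeasure_mono) measurable
        also have "\<dots> \<le> emeasure K (\<Union>i\<in>{..<n}. disagreement m (A i)) +
            emeasure K ((T m -` R n \<inter> space K) \<union> (U -` R n \<inter> space K))"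
          by (rule emeasure_subadditive) measurable
        also have "\<dots> \<le> (\<Sum>i<n. emeasure K (disagreement m (A i))) +
            (emeasure K (T m -` R n \<inter> space K) + emeasure K (U -` R n \<inter> space K))"
          by (intro add_mono emeasure_subadditive_finite emeasure_subadditive) auto
        also have "\<dots> = (\<Sum>i<n. emeasure K (disagreement m (A i))) + (emeasure N (R n) + emeasure N (R n))"
          by (simp add: emeasure_vimage_T emeasure_vimage_U)
        also have "\<dots> \<le> (\<Sum>i<n. emeasure K (disagreement m (A i))) + (ennreal (e / 2) + ennreal (e / 2))"
          using n by (intro add_left_mono add_mono) auto
        also have "ennreal (e / 2) + ennreal (e / 2) = ennreal e" using \<open>e > 0\<close> by (simp flip: ennreal_plus)
        finally show ?thesis .
      qed
      moreover have "(\<lambda>m. \<Sum>i<n. emeasure K (disagreement m (A i))) \<longlonglongrightarrow> (\<Sum>i<n. 0)"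
        by (intro tendsto_sum union(3))
      ultimately show "\<exists>b. b \<longlonglongrightarrow> 0 \<and> (\<forall>m. emeasure K (disagreement m (\<Union>i. A i)) \<le> b m + ennreal e)"
        by (intro exI[of _ "\<lambda>m. \<Sum>i<n. emeasure K (disagreement m (A i))"]) simp
    qed
  qed
qed

text \<open>Indicators reduce to \<open>conv\<close>. In the limit step \<open>nn_integral_T\<close>
  and \<open>nn_integral_U\<close> convert both errors into an \<open>L^1\<close> distance in
  \<open>N\<close>, which is independent of \<open>m\<close>.\<close>

lemma L1_tendsto_0:
  fixes F :: "'n \<Rightarrow> real"
  assumes conv: "\<And>A. A \<in> sets N \<Longrightarrow> (\<lambda>m. emeasure K (disagreement m A)) \<longlonglongrightarrow> 0"
    and F: "integrable N F"
  shows "(\<lambda>m. \<integral>\<^sup>+z. ennreal \<bar>F (T m z) - F (U z)\<bar> \<partial>K) \<longlonglongrightarrow> 0"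
  using F
proof (induction rule: integrable_induct)
  case (base A c)
  have "(\<integral>\<^sup>+z. ennreal \<bar>indicator A (T m z) *\<^sub>R c - indicator A (U z) *\<^sub>R c\<bar> \<partial>K) =
      ennreal \<bar>c\<bar> * emeasure K (disagreement m A)" for m
  proof -
    have "(\<integral>\<^sup>+z. ennreal \<bar>indicator A (T m z) *\<^sub>R c - indicator A (U z) *\<^sub>R c\<bar> \<partial>K) =
      (\<integral>\<^sup>+z. ennreal \<bar>c\<bar> * indicator (disagreement m A) z \<partial>K)"
      by (rule nn_integral_cong) (auto simp: disagreement_def indicator_def)
    then show ?thesis using base by (simp add: nn_integral_cmult_indicator)
  qed
  moreover have "(\<lambda>m. ennreal \<bar>c\<bar> * emeasure K (disagreement m A)) \<longlonglongrightarrow> ennreal \<bar>c\<bar> * 0"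
    by (intro ennreal_tendsto_cmult conv base) simp
  ultimately show ?case by simp
next
  case (add f g)
  have [measurable]: "f \<in> borel_measurable N" "g \<in> borel_measurable N" using add by auto
  let ?a = "\<lambda>m. (\<integral>\<^sup>+z. ennreal \<bar>f (T m z) - f (U z)\<bar> \<partial>K) + (\<integral>\<^sup>+z. ennreal \<bar>g (T m z) - g (U z)\<bar> \<partial>K)"
  have "?a \<longlonglongrightarrow> 0 + 0" by (intro tendsto_add add.IH)
  then have "?a \<longlonglongrightarrow> 0" by simp
  then show ?case
  proof (rule tendsto_sandwich[OF _ _ tendsto_const, rotated 2])
    have "(\<integral>\<^sup>+z. ennreal \<bar>f (T m z) + g (T m z) - (f (U z) + g (U z))\<bar> \<partial>K) \<le> ?a m" for m
      by (subst nn_integral_add[symmetric], measurable)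
        (intro nn_integral_mono, simp flip: ennreal_plus)
    then show "\<forall>\<^sub>F m in sequentially. (\<integral>\<^sup>+z. ennreal \<bar>f (T m z) + g (T m z) - (f (U z) + g (U z))\<bar> \<partial>K) \<le> ?a m" by simp
  qed simp
next
  case (lim f s)
  have [measurable]: "f \<in> borel_measurable N" "s i \<in> borel_measurable N" for i using lim by auto
  have "(\<lambda>i. \<integral>\<^sup>+x. ennreal (norm (f x - s i x)) \<partial>N) \<longlonglongrightarrow> 0"
  proof (rule Bochner_Integration.nn_integral_dominated_convergence_norm[where w = "\<lambda>x. 2 * norm (f x)"])
    show "AE x in N. norm (s i x) \<le> 2 * norm (f x)" for i using lim by auto
    show "(\<integral>\<^sup>+x. ennreal (2 * norm (f x)) \<partial>N) < \<infinity>"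
      using integrableD(2)[OF integrable_mult_right[OF integrable_norm[OF lim.hyps(4)], of 2]] by (simp add: less_top)
    show "AE x in N. (\<lambda>i. s i x) \<longlonglongrightarrow> f x" using lim by auto
  qed measurable
  note L = this
  show ?case
  proof (rule ennreal_tendsto_0I)
    fix e :: real assume "e > 0"
    then have "\<forall>\<^sub>F i in sequentially. (\<integral>\<^sup>+x. ennreal (norm (f x - s i x)) \<partial>N) < ennreal (e / 2)"
      by (intro order_tendstoD(2)[OF L]) simp
    then obtain i where i: "(\<integral>\<^sup>+x. ennreal (norm (f x - s i x)) \<partial>N) < ennreal (e / 2)"
      by (auto simp: eventually_sequentially)
    have "(\<integral>\<^sup>+z. ennreal \<bar>f (T m z) - f (U z)\<bar> \<partial>K) \<le> (\<integral>\<^sup>+z. ennreal \<bar>s i (T m z) - s i (U z)\<bar> \<partial>K) + ennreal e" for m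
    proof -
      have "(\<integral>\<^sup>+z. ennreal \<bar>f (T m z) - f (U z)\<bar> \<partial>K) \<le>
          (\<integral>\<^sup>+z. ennreal \<bar>s i (T m z) - s i (U z)\<bar> +
            (ennreal (norm (f (T m z) - s i (T m z))) + ennreal (norm (f (U z) - s i (U z)))) \<partial>K)"
        by (intro nn_integral_mono) (simp flip: ennreal_plus)
      also have "\<dots> = (\<integral>\<^sup>+z. ennreal \<bar>s i (T m z) - s i (U z)\<bar> \<partial>K) +
          ((\<integral>\<^sup>+x. ennreal (norm (f x - s i x)) \<partial>N) + (\<integral>\<^sup>+x. ennreal (norm (f x - s i x)) \<partial>N))"
        using nn_integral_T[of "\<lambda>x. ennreal (norm (f x - s i x))" m] nn_integral_U[of "\<lambda>x. ennreal (norm (f x - s i x))"]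
        by (simp add: nn_integral_add)
      also have "\<dots> \<le> (\<integral>\<^sup>+z. ennreal \<bar>s i (T m z) - s i (U z)\<bar> \<partial>K) + (ennreal (e / 2) + ennreal (e / 2))"
        using i by (intro add_left_mono add_mono) auto
      also have "ennreal (e / 2) + ennreal (e / 2) = ennreal e" using \<open>e > 0\<close> by (simp flip: ennreal_plus)
      finally show ?thesis .
    qed
    then show "\<exists>b. b \<longlonglongrightarrow> 0 \<and> (\<forall>m. (\<integral>\<^sup>+z. ennreal \<bar>f (T m z) - f (U z)\<bar> \<partial>K) \<le> b m + ennreal e)"
      using lim.IH[of i] by blast
  qed
qed

end

section \<open>Resampling the tail of a coin sequence\<close>

lemma distr_fst_coins: "distr (coins w \<Otimes>\<^sub>M coins w) (coins w) fst = coins w"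
  using distr_mix[of w UNIV] by (simp add: mix_def)

interpretation mix: asymptotic_perturbation "coins w \<Otimes>\<^sub>M coins w" "coins w"
  "\<lambda>m x. mix {..<m} (fst x) (snd x)" fst for w
  by unfold_locales (simp_all add: distr_mix distr_fst_coins)

text \<open>On a cylinder over finitely many coordinates the disagreement is empty as soon as
  \<open>m\<close> exceeds them all, and such cylinders generate.\<close>

lemma mix_disagreement_tendsto_0:
  assumes "A \<in> sets (coins w)"
  shows "(\<lambda>m. emeasure (coins w \<Otimes>\<^sub>M coins w) (mix.disagreement w m A)) \<longlonglongrightarrow> 0"
proof (rule mix.disagreement_tendsto_0[OF _ _ _ _ assms])
  let ?G = "prod_algebra UNIV (\<lambda>_::nat. measure_pmf (bernoulli_pmf w))"
  show "sets (coins w) = sigma_sets (space (coins w)) ?G"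
    by (simp add: coins_def sets_PiM space_PiM)
  show "Int_stable ?G" by (rule Int_stable_prod_algebra)
  show "?G \<subseteq> Pow (space (coins w))" by simp
  fix A assume "A \<in> ?G"
  then obtain J E where J: "finite J" and A: "A = prod_emb UNIV (\<lambda>_. measure_pmf (bernoulli_pmf w)) J (Pi\<^sub>E J E)"
    by (rule prod_algebraE)
  obtain k where k: "\<And>i. i \<in> J \<Longrightarrow> i < k" using J finite_nat_set_iff_bounded by auto
  have "mix.disagreement w m A = {}" if "k \<le> m" for m
  proof -
    have "mix {..<m} \<alpha> \<beta> \<in> A \<longleftrightarrow> \<alpha> \<in> A" for \<alpha> \<beta>
      using k that unfolding A prod_emb_coins mix_def by fastforce
    then show ?thesis by (auto simp: mix.disagreement_def)
  qed
  then show "(\<lambda>m. emeasure (coins w \<Otimes>\<^sub>M coins w) (mix.disagreement w m A)) \<longlonglongrightarrow> 0"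
    by (intro tendsto_eventually eventually_sequentiallyI[of k]) simp
qed

text \<open>The height in \<open>S\<close> is carried along unperturbed, so a rectangle
  \<open>a \<times> b\<close> disagrees only where \<open>b\<close> does. Finiteness of
  \<open>S\<close> keeps the product of its mass with a null sequence null.\<close>

lemma mix_L1_tendsto_0:
  fixes F :: "'a \<times> (nat \<Rightarrow> bool) \<Rightarrow> real"
  assumes S: "finite_measure S" and F: "integrable (S \<Otimes>\<^sub>M coins w) F"
  shows "(\<lambda>m. \<integral>\<^sup>+t. (\<integral>\<^sup>+x. ennreal \<bar>F (t, mix {..<m} (fst x) (snd x)) - F (t, fst x)\<bar>
           \<partial>(coins w \<Otimes>\<^sub>M coins w)) \<partial>S) \<longlonglongrightarrow> 0"
proof -
  interpret S: finite_measure S by (rule S)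
  interpret SC: pair_sigma_finite S "coins w" ..
  let ?P = "coins w \<Otimes>\<^sub>M coins w"
  have distr: "distr (S \<Otimes>\<^sub>M ?P) (S \<Otimes>\<^sub>M coins w) (\<lambda>z. (fst z, f (snd z))) = S \<Otimes>\<^sub>M coins w"
    if [measurable]: "f \<in> ?P \<rightarrow>\<^sub>M coins w" and d: "distr ?P (coins w) f = coins w" for f
  proof -
    have "distr (S \<Otimes>\<^sub>M ?P) (S \<Otimes>\<^sub>M coins w) (\<lambda>(x, y). (x, f y)) =
        distr S S (\<lambda>x. x) \<Otimes>\<^sub>M distr ?P (coins w) f"
      by (rule pair_measure_distr[symmetric]) (simp_all add: d coins.sigma_finite_measure_axioms)
    then show ?thesis by (simp add: d case_prod_unfold)
  qed
  interpret B: asymptotic_perturbation "S \<Otimes>\<^sub>M ?P" "S \<Otimes>\<^sub>M coins w"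
    "\<lambda>m z. (fst z, mix {..<m} (fst (snd z)) (snd (snd z)))" "\<lambda>z. (fst z, fst (snd z))"
  proof (rule asymptotic_perturbation.intro)
    show "finite_measure (S \<Otimes>\<^sub>M coins w)"
      by (rule finite_measureI, unfold space_pair_measure, subst coins.emeasure_pair_measure_Times)
        (simp_all add: ennreal_mult_eq_top_iff coins.emeasure_space_1[simplified] sets.top[of "coins w", simplified])
    show "(\<lambda>z. (fst z, mix {..<m} (fst (snd z)) (snd (snd z)))) \<in> S \<Otimes>\<^sub>M ?P \<rightarrow>\<^sub>M S \<Otimes>\<^sub>M coins w" for m
      using measurable_compose[OF measurable_snd measurable_mix] by (intro measurable_Pair) auto
    show "distr (S \<Otimes>\<^sub>M ?P) (S \<Otimes>\<^sub>M coins w) (\<lambda>z. (fst z, mix {..<m} (fst (snd z)) (snd (snd z)))) = S \<Otimes>\<^sub>M coins w" for m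
      using distr[OF measurable_mix distr_mix] by simp
    show "distr (S \<Otimes>\<^sub>M ?P) (S \<Otimes>\<^sub>M coins w) (\<lambda>z. (fst z, fst (snd z))) = S \<Otimes>\<^sub>M coins w"
      using distr[OF measurable_fst distr_fst_coins] by simp
  qed measurable
  have "(\<lambda>m. emeasure (S \<Otimes>\<^sub>M ?P) (B.disagreement m A)) \<longlonglongrightarrow> 0" if "A \<in> sets (S \<Otimes>\<^sub>M coins w)" for A
  proof (rule B.disagreement_tendsto_0[OF _ _ _ _ that])
    let ?G = "{a \<times> b |a b. a \<in> sets S \<and> b \<in> sets (coins w)}"
    show "sets (S \<Otimes>\<^sub>M coins w) = sigma_sets (space (S \<Otimes>\<^sub>M coins w)) ?G"
      by (simp only: sets_pair_measure space_pair_measure)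
    show "Int_stable ?G" by (rule Int_stable_pair_measure_generator)
    show "?G \<subseteq> Pow (space (S \<Otimes>\<^sub>M coins w))" using sets.sets_into_space by (fastforce simp: space_pair_measure)
    fix A assume "A \<in> ?G"
    then obtain a b where A: "A = a \<times> b" and [measurable]: "a \<in> sets S" "b \<in> sets (coins w)" by auto
    have le: "emeasure (S \<Otimes>\<^sub>M ?P) (B.disagreement m A) \<le> emeasure S (space S) * emeasure ?P (mix.disagreement w m b)" for m
    proof -
      have "B.disagreement m A \<subseteq> space S \<times> mix.disagreement w m b"
        by (auto simp: B.disagreement_def mix.disagreement_def A space_pair_measure)
      then have "emeasure (S \<Otimes>\<^sub>M ?P) (B.disagreement m A) \<le> emeasure (S \<Otimes>\<^sub>M ?P) (space S \<times> mix.disagreement w m b)"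
        by (rule emeasure_mono) measurable
      also have "\<dots> = emeasure S (space S) * emeasure ?P (mix.disagreement w m b)"
        by (rule coins2.emeasure_pair_measure_Times) measurable
      finally show ?thesis .
    qed
    have "(\<lambda>m. emeasure S (space S) * emeasure ?P (mix.disagreement w m b)) \<longlonglongrightarrow> emeasure S (space S) * 0"
      by (intro ennreal_tendsto_cmult mix_disagreement_tendsto_0) (simp_all add: less_top[symmetric])
    then have "(\<lambda>m. emeasure S (space S) * emeasure ?P (mix.disagreement w m b)) \<longlonglongrightarrow> 0" by simp
    then show "(\<lambda>m. emeasure (S \<Otimes>\<^sub>M ?P) (B.disagreement m A)) \<longlonglongrightarrow> 0"
      by (rule tendsto_sandwich[OF _ _ tendsto_const, rotated 2]) (simp_all add: le)
  qed
  from B.L1_tendsto_0[OF this F]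
  have "(\<lambda>m. \<integral>\<^sup>+z. ennreal \<bar>F (fst z, mix {..<m} (fst (snd z)) (snd (snd z))) - F (fst z, fst (snd z))\<bar> \<partial>(S \<Otimes>\<^sub>M ?P)) \<longlonglongrightarrow> 0" by simp
  moreover have [measurable]: "F \<in> borel_measurable (S \<Otimes>\<^sub>M coins w)" using F by auto
  have "(\<integral>\<^sup>+z. ennreal \<bar>F (fst z, mix {..<m} (fst (snd z)) (snd (snd z))) - F (fst z, fst (snd z))\<bar> \<partial>(S \<Otimes>\<^sub>M ?P)) =
      (\<integral>\<^sup>+t. (\<integral>\<^sup>+x. ennreal \<bar>F (t, mix {..<m} (fst x) (snd x)) - F (t, fst x)\<bar> \<partial>?P) \<partial>S)" for m
    by (subst coins2.nn_integral_fst[symmetric]) simp_all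
  ultimately show ?thesis by simp
qed

subsection \<open>Line integrals along vertical curves\<close>

text \<open>The clamped function is the length function of a unit-speed curve on
  \<open>[l,h]\<close>, constant outside. The lemma turns \<open>line_integral\<close> into an
  ordinary Lebesgue integral.\<close>

lemma interval_measure_clamp:
  fixes l h :: real
  assumes "l \<le> h"
  shows "interval_measure (\<lambda>t. max l (min t h) - l) = density lborel (indicator {l..h})"
proof (rule measure_eqI_generator_eq[where E = "range (\<lambda>(a, b). {a<..b::real})" and \<Omega> = UNIV and A = "\<lambda>n::nat. {- real n<..real n}"])
  let ?F = "\<lambda>t. max l (min t h) - l"
  show "Int_stable (range (\<lambda>(a, b). {a<..b::real}))"
    by (auto simp: Int_stable_def)
  have sets: "sets borel = sigma_sets UNIV (range (\<lambda>(a, b). {a<..b::real}))"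
    by (subst borel_sigma_sets_Ioc) (simp add: sets_measure_of)
  show "sets (interval_measure ?F) = sigma_sets UNIV (range (\<lambda>(a, b). {a<..b::real}))"
    "sets (density lborel (indicator {l..h})) = sigma_sets UNIV (range (\<lambda>(a, b). {a<..b::real}))"
    using sets by simp_all
  have mono: "?F x \<le> ?F y" if "x \<le> y" for x y using that by (auto simp: max_def min_def)
  have cont: "continuous (at_right a) ?F" for a
    by (intro continuous_intros)
  have eq: "emeasure (interval_measure ?F) {a<..b} = emeasure (density lborel (indicator {l..h})) {a<..b}"
    if "a \<le> b" for a b
  proof -
    have "emeasure (density lborel (indicator {l..h})) {a<..b} = emeasure lborel ({l..h} \<inter> {a<..b})"
      by (simp add: emeasure_density flip: indicator_inter_arith)
    also have "\<dots> = ennreal (?F b - ?F a)"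
    proof (cases "a < l")
      case True
      then have "{l..h} \<inter> {a<..b} = {l..min h b}" by auto
      then show ?thesis using True assms that by (auto simp: max_def min_def)
    next
      case False
      then have "{l..h} \<inter> {a<..b} = {a<..min h b}" by auto
      then show ?thesis using False assms that by (auto simp: max_def min_def)
    qed
    finally show ?thesis using emeasure_interval_measure_Ioc[OF that mono cont] by simp
  qed
  show "emeasure (interval_measure ?F) X = emeasure (density lborel (indicator {l..h})) X"
    if asm: "X \<in> range (\<lambda>(a, b). {a<..b::real})" for X
  proof -
    obtain a b where X: "X = {a<..b}" using asm by auto
    show ?thesis unfolding X by (cases "a \<le> b") (auto simp: eq)
  qed
  show "(\<Union>n. {- real n<..real n}) = UNIV"
  proof -
    have "\<exists>n. x \<in> {- real n<..real n}" for x
    proof -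
      obtain n where "\<bar>x\<bar> < real n" using reals_Archimedean2 by blast
      then show ?thesis by (intro exI[of _ n]) auto
    qed
    then show ?thesis by auto
  qed
  show "emeasure (interval_measure (\<lambda>t. max l (min t h) - l)) {- real n<..real n} \<noteq> \<infinity>" for n
    using emeasure_interval_measure_Ioc[OF _ mono cont, of "- real n" "real n"] by simp
qed auto

lemma curve_length_isometric:
  assumes "l \<le> h" "\<And>s t. s \<in> {l..h} \<Longrightarrow> t \<in> {l..h} \<Longrightarrow> d (\<gamma> s) (\<gamma> t) = \<bar>s - t\<bar>"
  shows "curve_length d \<gamma> l h = ereal (h - l)"
proof -
  have *: "(\<Sum>i<n. d (\<gamma> (t i)) (\<gamma> (t (Suc i)))) = h - l"
    if t: "t 0 = l" "t n = h" "\<forall>i<n. t i \<le> t (Suc i)" for n and t :: "nat \<Rightarrow> real"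
  proof -
    have mono: "t i \<le> t j" if "i \<le> j" "j \<le> n" for i j
      using that t(3) by (induction rule: dec_induct) (auto intro: order_trans)
    have "t i \<in> {l..h}" if "i \<le> n" for i using mono[of 0 i] mono[of i n] t that by auto
    then have "(\<Sum>i<n. d (\<gamma> (t i)) (\<gamma> (t (Suc i)))) = (\<Sum>i<n. t (Suc i) - t i)"
      using t(3) by (intro sum.cong) (auto simp: assms(2))
    also have "\<dots> = h - l" by (simp add: sum_lessThan_telescope t)
    finally show ?thesis .
  qed
  let ?A = "{(n, t). t 0 = l \<and> t n = h \<and> (\<forall>i<n. t i \<le> t (Suc i))}"
  have "curve_length d \<gamma> l h = (SUP (n, t)\<in>?A. ereal (h - l))"
    unfolding curve_length_def by (rule SUP_cong) (auto simp: *)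
  also have "\<dots> = ereal (h - l)"
  proof -
    have "(1, \<lambda>i. if i = 0 then l else h) \<in> ?A" using assms(1) by auto
    then have "?A \<noteq> {}" by blast
    then show ?thesis by (simp add: case_prod_beta)
  qed
  finally show ?thesis .
qed

lemma line_integral_isometric:
  assumes "l \<le> h" and d: "\<And>s t. s \<in> {l..h} \<Longrightarrow> t \<in> {l..h} \<Longrightarrow> d (\<gamma> s) (\<gamma> t) = \<bar>s - t\<bar>"
    and m: "(\<lambda>t. \<rho> (\<gamma> t) * indicator {l..h} t) \<in> borel_measurable borel"
  shows "line_integral d \<rho> \<gamma> l h = (\<integral>\<^sup>+t\<in>{l..h}. \<rho> (\<gamma> t) \<partial>lborel)"
proof -
  have "length_function d \<gamma> l h = (\<lambda>t. max l (min t h) - l)"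
  proof
    fix t
    have "curve_length d \<gamma> l (max l (min t h)) = ereal (max l (min t h) - l)"
      by (rule curve_length_isometric) (use assms in auto)
    then show "length_function d \<gamma> l h t = max l (min t h) - l" by (simp add: length_function_def)
  qed
  then have "line_integral d \<rho> \<gamma> l h = (\<integral>\<^sup>+t. \<rho> (\<gamma> t) * indicator {l..h} t \<partial>density lborel (indicator {l..h}))"
    by (simp add: line_integral_def interval_measure_clamp[OF assms(1)])
  also have "\<dots> = (\<integral>\<^sup>+t. indicator {l..h} t * (\<rho> (\<gamma> t) * indicator {l..h} t) \<partial>lborel)"
    by (rule nn_integral_density) (use m in auto)
  also have "\<dots> = (\<integral>\<^sup>+t\<in>{l..h}. \<rho> (\<gamma> t) \<partial>lborel)"
    by (rule nn_integral_cong) (auto simp: indicator_def)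
  finally show ?thesis .
qed

lemma rectifiable_isometric:
  assumes "Metric_space M d" "l \<le> h" "\<gamma> ` {l..h} \<subseteq> M"
    and d: "\<And>s t. s \<in> {l..h} \<Longrightarrow> t \<in> {l..h} \<Longrightarrow> d (\<gamma> s) (\<gamma> t) = \<bar>s - t\<bar>"
  shows "rectifiable_curve M d \<gamma> l h"
proof -
  interpret Metric_space M d by fact
  have "continuous_map (top_of_set {l..h}) mtopology \<gamma>"
    unfolding continuous_map_to_metric
  proof (intro ballI allI impI)
    fix x and e :: real assume x: "x \<in> topspace (top_of_set {l..h})" and "e > 0"
    show "\<exists>U. openin (top_of_set {l..h}) U \<and> x \<in> U \<and> (\<forall>y\<in>U. \<gamma> y \<in> mball (\<gamma> x) e)"
    proof (intro exI conjI)
      show "openin (top_of_set {l..h}) ({l..h} \<inter> ball x e)" by (rule openin_open_Int) simp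
      show "x \<in> {l..h} \<inter> ball x e" using x \<open>e > 0\<close> by simp
      show "\<forall>y\<in>{l..h} \<inter> ball x e. \<gamma> y \<in> mball (\<gamma> x) e"
        using x assms(3) d[of x] by (auto simp: in_mball dist_real_def)
    qed
  qed
  then show ?thesis using curve_length_isometric[of l h d \<gamma>] assms(2) d
    by (simp add: rectifiable_curve_def curve_def assms(2))
qed

subsection \<open>The Poincare inequality on an interval times a Cantor set\<close>

text \<open>Here \<open>F\<close> and \<open>G\<close> stand for \<open>u\<close> and its upper
  gradient on the box over \<open>{l..h}\<close> whose first \<open>n\<close> coordinates are
  frozen. Freezing is done by overwriting the prefix, so \<open>coins w\<close> stays the full
  product measure and \<open>F\<close> ignores the overwritten coordinates.\<close>

locale laakso_box =
  fixes w l h :: real and n :: nat and F :: "laakso_point \<Rightarrow> real" and G :: "laakso_point \<Rightarrow> ennreal"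
    and S :: "real measure"
  defines "S \<equiv> restrict_space lborel {l..h}"
  assumes lh: "0 \<le> l" "h \<le> 1" "1 / 2 ^ n \<le> h - l" "h - l \<le> 2 / 2 ^ n"
    and integrable_F: "integrable (S \<Otimes>\<^sub>M coins w) F"
    and measurable_G [measurable]: "G \<in> borel_measurable (S \<Otimes>\<^sub>M coins w)"
    and vertical: "\<And>s t \<alpha>. l \<le> s \<Longrightarrow> s \<le> t \<Longrightarrow> t \<le> h \<Longrightarrow>
        ennreal \<bar>F (s, \<alpha>) - F (t, \<alpha>)\<bar> \<le> (\<integral>\<^sup>+x\<in>{s..t}. G (x, \<alpha>) \<partial>lborel)"
    and jump: "\<And>m z \<alpha> \<beta>. n \<le> m \<Longrightarrow> z \<in> wormhole m \<Longrightarrow> z \<in> {l..h} \<Longrightarrow>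
        (\<And>i. i \<noteq> m \<Longrightarrow> \<alpha> i = \<beta> i) \<Longrightarrow> F (z, \<alpha>) = F (z, \<beta>)"
    and prefix_irrelevant: "\<And>t \<alpha> \<beta>. (\<And>i. n \<le> i \<Longrightarrow> \<alpha> i = \<beta> i) \<Longrightarrow> F (t, \<alpha>) = F (t, \<beta>)"
begin

lemma measurable_F [measurable]: "F \<in> borel_measurable (S \<Otimes>\<^sub>M coins w)"
  using integrable_F by auto

lemma space_S [simp]: "space S = {l..h}"
  by (simp add: S_def space_restrict_space)

lemma l_less_h: "l < h"
proof -
  have "0 < (1::real) / 2 ^ n" by simp
  then show ?thesis using lh by linarith
qed

lemma emeasure_S: "emeasure S {l..h} = ennreal (h - l)"
  using l_less_h by (simp add: S_def emeasure_restrict_space)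

sublocale S: finite_measure S
  by (rule finite_measureI) (simp add: emeasure_S)

sublocale SC: pair_sigma_finite S "coins w" ..
sublocale SP: pair_sigma_finite S "coins w \<Otimes>\<^sub>M coins w" ..
sublocale SS: pair_sigma_finite S S ..

abbreviation P where "P \<equiv> coins w \<Otimes>\<^sub>M coins w"

lemma nn_integral_S: "(\<integral>\<^sup>+t. f t \<partial>S) = (\<integral>\<^sup>+t\<in>{l..h}. f t \<partial>lborel)"
  unfolding S_def by (subst nn_integral_restrict_space) auto

lemma vertical_le:
  assumes "s \<in> {l..h}" "t \<in> {l..h}" "\<And>x. min s t \<le> x \<Longrightarrow> x \<le> max s t \<Longrightarrow> x \<in> A"
  shows "ennreal \<bar>F (s, \<alpha>) - F (t, \<alpha>)\<bar> \<le> (\<integral>\<^sup>+x. indicator A x * G (x, \<alpha>) \<partial>S)"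
proof -
  have "ennreal \<bar>F (s, \<alpha>) - F (t, \<alpha>)\<bar> = ennreal \<bar>F (min s t, \<alpha>) - F (max s t, \<alpha>)\<bar>"
    by (cases "s \<le> t") (simp_all add: abs_minus_commute min_def max_def)
  also have "\<dots> \<le> (\<integral>\<^sup>+x\<in>{min s t..max s t}. G (x, \<alpha>) \<partial>lborel)"
    by (rule vertical) (use assms in auto)
  also have "\<dots> \<le> (\<integral>\<^sup>+x\<in>{l..h}. indicator A x * G (x, \<alpha>) \<partial>lborel)"
  proof (rule nn_integral_mono)
    fix x
    show "G (x, \<alpha>) * indicator {min s t..max s t} x \<le> indicator A x * G (x, \<alpha>) * indicator {l..h} x"
      using assms by (cases "x \<in> {min s t..max s t}") (auto simp: indicator_def)
  qed
  finally show ?thesis by (simp add: nn_integral_S)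
qed

lemma near_wormhole:
  assumes "n \<le> m" "t \<in> {l..h}"
  obtains z where "z \<in> wormhole m" "z \<in> {l..h}" "\<bar>t - z\<bar> \<le> 1 / 2 ^ m"
proof -
  have mn: "1 / 2 ^ m \<le> (1 / 2 ^ n :: real)" using assms(1) by (intro divide_left_mono power_increasing) auto
  have m0: "0 < (1 / 2 ^ m :: real)" by simp
  \<comment> \<open>The search window is pushed down where \<open>t\<close> is too close to
    \<open>h\<close>; \<open>2^-m \<le> 2^-n \<le> h - l\<close> keeps it inside
    \<open>{l..h}\<close>.\<close>
  define c where "c = min t (h - 1 / 2 ^ m)"
  have c: "l \<le> c" "c \<le> t" "t \<le> c + 1 / 2 ^ m" "c + 1 / 2 ^ m \<le> h"
    using assms(2) lh(3) mn m0 by (auto simp: c_def min_def)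
  have "wormhole m \<inter> {c..c + 1 / 2 ^ m} \<noteq> {}"
    by (rule wormhole_hits) (use c lh in auto)
  then obtain z where "z \<in> wormhole m" "c \<le> z" "z \<le> c + 1 / 2 ^ m" by auto
  then show ?thesis using c by (intro that[of z]) auto
qed

text \<open>From height \<open>t\<close>, move along \<alpha> to a wormhole of level
  \<open>m\<close> at distance at most \<open>2^-m\<close>, change the coordinate there, and return
  along \<beta>. Each height \<open>x\<close> is charged only by those \<open>t\<close> in a window
  of length \<open>2 / 2^m\<close>, so exchanging the integrals yields this factor.\<close>

lemma flip_le:
  assumes "n \<le> m" and eq: "\<And>i. i \<noteq> m \<Longrightarrow> \<alpha> i = \<beta> i"
  shows "(\<integral>\<^sup>+t. ennreal \<bar>F (t, \<alpha>) - F (t, \<beta>)\<bar> \<partial>S) \<le> ennreal (2 / 2 ^ m) * (\<integral>\<^sup>+t. G (t, \<alpha>) + G (t, \<beta>) \<partial>S)"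
proof -
  let ?H = "\<lambda>x. G (x, \<alpha>) + G (x, \<beta>)"
  have [measurable]: "?H \<in> borel_measurable S" by simp
  let ?A = "\<lambda>t. {x. \<bar>t - x\<bar> \<le> 1 / 2 ^ m}"
  have meas: "(\<lambda>(t, x). indicator (?A t) x * ?H x) \<in> borel_measurable (S \<Otimes>\<^sub>M S)"
  proof -
    have "(\<lambda>t. t) \<in> borel_measurable S" unfolding S_def by (rule measurable_restrict_space1) simp
    note [measurable] = this
    have "(\<lambda>z. indicator {z. \<bar>fst z - snd z\<bar> \<le> 1 / 2 ^ m} z * ?H (snd z)) \<in> borel_measurable (S \<Otimes>\<^sub>M S)"
      by measurable
    then show ?thesis by (simp add: case_prod_beta' indicator_def)
  qed
  have "(\<integral>\<^sup>+t. ennreal \<bar>F (t, \<alpha>) - F (t, \<beta>)\<bar> \<partial>S) \<le> (\<integral>\<^sup>+t. (\<integral>\<^sup>+x. indicator (?A t) x * ?H x \<partial>S) \<partial>S)"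
  proof (rule nn_integral_mono)
    fix t assume "t \<in> space S"
    then have t: "t \<in> {l..h}" by simp
    obtain z where z: "z \<in> wormhole m" "z \<in> {l..h}" "\<bar>t - z\<bar> \<le> 1 / 2 ^ m"
      using near_wormhole[OF assms(1) t] .
    have "F (z, \<alpha>) = F (z, \<beta>)" using jump[OF assms(1) z(1,2) eq] .
    then have "ennreal \<bar>F (t, \<alpha>) - F (t, \<beta>)\<bar> \<le> ennreal (\<bar>F (t, \<alpha>) - F (z, \<alpha>)\<bar> + \<bar>F (t, \<beta>) - F (z, \<beta>)\<bar>)"
      by (intro ennreal_leI) linarith
    also have "\<dots> = ennreal \<bar>F (t, \<alpha>) - F (z, \<alpha>)\<bar> + ennreal \<bar>F (t, \<beta>) - F (z, \<beta>)\<bar>" by simp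
    also have "\<dots> \<le> (\<integral>\<^sup>+x. indicator (?A t) x * G (x, \<alpha>) \<partial>S) + (\<integral>\<^sup>+x. indicator (?A t) x * G (x, \<beta>) \<partial>S)"
      by (intro add_mono vertical_le) (use t z in \<open>auto simp: min_def max_def abs_if split: if_splits\<close>)
    also have "\<dots> = (\<integral>\<^sup>+x. indicator (?A t) x * ?H x \<partial>S)"
    proof -
      have "?A t \<inter> space S \<in> sets S"
      proof -
        have "?A t = {t - 1 / 2 ^ m..t + 1 / 2 ^ m}" by auto
        then show ?thesis by (auto simp: S_def sets_restrict_space space_restrict_space)
      qed
      then have [measurable]: "(\<lambda>x. indicator (?A t) x :: ennreal) \<in> borel_measurable S"
        by (simp add: borel_measurable_indicator_iff)
      show ?thesis by (subst nn_integral_add[symmetric]) (simp_all add: distrib_left)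
    qed
    finally show "ennreal \<bar>F (t, \<alpha>) - F (t, \<beta>)\<bar> \<le> (\<integral>\<^sup>+x. indicator (?A t) x * ?H x \<partial>S)" .
  qed
  also have "\<dots> = (\<integral>\<^sup>+x. (\<integral>\<^sup>+t. indicator (?A t) x * ?H x \<partial>S) \<partial>S)"
    using SS.Fubini'[of "\<lambda>t x. indicator (?A t) x * ?H x"] meas by simp
  also have "\<dots> \<le> (\<integral>\<^sup>+x. ennreal (2 / 2 ^ m) * ?H x \<partial>S)"
  proof (rule nn_integral_mono)
    fix x
    have "(\<integral>\<^sup>+t. indicator (?A t) x * ?H x \<partial>S) \<le> (\<integral>\<^sup>+t. ?H x * indicator {x - 1 / 2 ^ m..x + 1 / 2 ^ m} t \<partial>lborel)"
      unfolding nn_integral_S by (rule nn_integral_mono) (auto simp: indicator_def)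
    also have "\<dots> = ?H x * ennreal (2 / 2 ^ m)"
      by (subst nn_integral_cmult_indicator) (auto simp flip: add_divide_distrib)
    finally show "(\<integral>\<^sup>+t. indicator (?A t) x * ?H x \<partial>S) \<le> ennreal (2 / 2 ^ m) * ?H x" by (simp add: mult.commute)
  qed
  also have "\<dots> = ennreal (2 / 2 ^ m) * (\<integral>\<^sup>+x. ?H x \<partial>S)" by (rule nn_integral_cmult) measurable
  finally show ?thesis .
qed

section \<open>Telescoping over the resampled coordinates\<close>

definition energy :: ennreal where
  "energy = (\<integral>\<^sup>+t. (\<integral>\<^sup>+\<alpha>. G (t, \<alpha>) \<partial>coins w) \<partial>S)"

text \<open>Mean change of \<open>F\<close> when all coordinates from \<open>m\<close> on are
  redrawn. At \<open>m = n\<close> the prefix does not matter, so two independent branches are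
  compared at equal height.\<close>

definition oscillation :: "nat \<Rightarrow> ennreal" where
  "oscillation m = (\<integral>\<^sup>+t. (\<integral>\<^sup>+x. ennreal \<bar>F (t, mix {..<m} (fst x) (snd x)) - F (t, fst x)\<bar> \<partial>P) \<partial>S)"

lemma energy_mix: "(\<integral>\<^sup>+x. (\<integral>\<^sup>+t. G (t, mix A (fst x) (snd x)) \<partial>S) \<partial>P) = energy"
proof -
  have "(\<integral>\<^sup>+x. (\<integral>\<^sup>+t. G (t, mix A (fst x) (snd x)) \<partial>S) \<partial>P) = (\<integral>\<^sup>+t. (\<integral>\<^sup>+x. G (t, mix A (fst x) (snd x)) \<partial>P) \<partial>S)"
    by (rule SP.Fubini') simp
  also have "\<dots> = energy"
    unfolding energy_def
  proof (rule nn_integral_cong)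
    fix t assume [measurable]: "t \<in> space S"
    show "(\<integral>\<^sup>+x. G (t, mix A (fst x) (snd x)) \<partial>P) = (\<integral>\<^sup>+\<alpha>. G (t, \<alpha>) \<partial>coins w)"
      by (rule nn_integral_mix) measurable
  qed
  finally show ?thesis .
qed

text \<open>The mixtures for \<open>m\<close> and \<open>Suc m\<close> differ at most in coordinate
  \<open>m\<close>, so \<open>flip_le\<close> applies. Both have the law \<open>coins w\<close>;
  hence each contributes the same \<open>energy\<close>, and twice \<open>2 / 2^m\<close> makes
  \<open>4 / 2^m\<close>.\<close>

lemma oscillation_step:
  assumes "n \<le> m"
  shows "oscillation m \<le> oscillation (Suc m) + ennreal (4 / 2 ^ m) * energy"
proof -
  let ?x = "\<lambda>m x. mix {..<m} (fst x) (snd x)"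
  let ?e = "\<lambda>t x. ennreal \<bar>F (t, ?x m x) - F (t, ?x (Suc m) x)\<bar>"
  let ?o = "\<lambda>t x. ennreal \<bar>F (t, ?x (Suc m) x) - F (t, fst x)\<bar>"
  have "oscillation m \<le> (\<integral>\<^sup>+t. (\<integral>\<^sup>+x. ?o t x + ?e t x \<partial>P) \<partial>S)"
    unfolding oscillation_def
    by (intro nn_integral_mono) (simp flip: ennreal_plus)
  also have "\<dots> = (\<integral>\<^sup>+t. (\<integral>\<^sup>+x. ?o t x \<partial>P) + (\<integral>\<^sup>+x. ?e t x \<partial>P) \<partial>S)"
    by (intro nn_integral_cong nn_integral_add) simp_all
  also have "\<dots> = oscillation (Suc m) + (\<integral>\<^sup>+t. (\<integral>\<^sup>+x. ?e t x \<partial>P) \<partial>S)"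
    unfolding oscillation_def by (rule nn_integral_add) simp_all
  also have "(\<integral>\<^sup>+t. (\<integral>\<^sup>+x. ?e t x \<partial>P) \<partial>S) = (\<integral>\<^sup>+x. (\<integral>\<^sup>+t. ?e t x \<partial>S) \<partial>P)"
    by (rule SP.Fubini'[symmetric]) simp
  also have "\<dots> \<le> (\<integral>\<^sup>+x. ennreal (2 / 2 ^ m) * (\<integral>\<^sup>+t. G (t, ?x m x) + G (t, ?x (Suc m) x) \<partial>S) \<partial>P)"
    by (intro nn_integral_mono flip_le assms) (auto simp: mix_def)
  also have "\<dots> = ennreal (2 / 2 ^ m) * (energy + energy)"
  proof -
    have "(\<integral>\<^sup>+x. (\<integral>\<^sup>+t. G (t, ?x m x) + G (t, ?x (Suc m) x) \<partial>S) \<partial>P) =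
        (\<integral>\<^sup>+x. (\<integral>\<^sup>+t. G (t, ?x m x) \<partial>S) + (\<integral>\<^sup>+t. G (t, ?x (Suc m) x) \<partial>S) \<partial>P)"
      by (intro nn_integral_cong nn_integral_add) simp_all
    also have "\<dots> = energy + energy"
      by (subst nn_integral_add) (simp_all add: energy_mix)
    finally show ?thesis by (subst nn_integral_cmult) simp_all
  qed
  also have "\<dots> = ennreal (4 / 2 ^ m) * energy"
    by (simp add: distrib_left flip: distrib_right ennreal_plus)
  finally show ?thesis by (simp add: add_left_mono)
qed

lemma oscillation_le: "oscillation n \<le> ennreal (8 / 2 ^ n) * energy"
proof -
  \<comment> \<open>\<open>8 / 2^n - 8 / 2^(n+k)\<close> is the sum of the costs
    \<open>4 / 2^m\<close> over \<open>n \<le> m < n + k\<close>.\<close>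
  have *: "oscillation n \<le> oscillation (n + k) + ennreal (8 / 2 ^ n - 8 / 2 ^ (n + k)) * energy" for k
  proof (induction k)
    case (Suc k)
    have "8 / 2 ^ (n + k) \<le> (8 / 2 ^ n :: real)" by (intro divide_left_mono power_increasing) auto
    then have "ennreal (8 / 2 ^ n - 8 / 2 ^ (n + Suc k)) = ennreal (4 / 2 ^ (n + k)) + ennreal (8 / 2 ^ n - 8 / 2 ^ (n + k))"
      by (subst ennreal_plus[symmetric]) (auto simp: algebra_simps)
    then show ?case
      using order_trans[OF Suc add_right_mono[OF oscillation_step[of "n + k"]]]
      by (simp add: distrib_right add.assoc)
  qed simp
  have "oscillation n \<le> oscillation (n + k) + ennreal (8 / 2 ^ n) * energy" for k
  proof (rule order_trans[OF *[of k]])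
    show "oscillation (n + k) + ennreal (8 / 2 ^ n - 8 / 2 ^ (n + k)) * energy \<le>
        oscillation (n + k) + ennreal (8 / 2 ^ n) * energy"
      by (intro add_left_mono mult_right_mono ennreal_leI) simp_all
  qed
  moreover have "(\<lambda>k. oscillation (n + k) + ennreal (8 / 2 ^ n) * energy) \<longlonglongrightarrow> 0 + ennreal (8 / 2 ^ n) * energy"
  proof (intro tendsto_add tendsto_const)
    have "oscillation \<longlonglongrightarrow> 0"
      unfolding oscillation_def by (rule mix_L1_tendsto_0[OF S.finite_measure_axioms integrable_F])
    then show "(\<lambda>k. oscillation (n + k)) \<longlonglongrightarrow> 0"
      using LIMSEQ_ignore_initial_segment[of oscillation 0 n] by (simp add: add.commute)
  qed
  ultimately show ?thesis by (intro LIMSEQ_le_const[where a = "oscillation n"]) auto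
qed

text \<open>The reference is the value at one height \<open>z\<close> on a random branch, not the
  mean, so that two boxes glued at \<open>z\<close> can share it. The change of branch costs 8 by
  \<open>oscillation_le\<close>; the vertical move from \<open>t\<close> to \<open>z\<close>,
  integrated over heights in an interval of length at most \<open>2 / 2^n\<close>, adds 2.\<close>

lemma deviation_le:
  assumes z: "z \<in> {l..h}"
  shows "(\<integral>\<^sup>+\<beta>. (\<integral>\<^sup>+t. (\<integral>\<^sup>+\<alpha>. ennreal \<bar>F (t, \<alpha>) - F (z, \<beta>)\<bar> \<partial>coins w) \<partial>S) \<partial>coins w) \<le> ennreal (10 / 2 ^ n) * energy"
proof -
  have [measurable]: "z \<in> space S" using z by simp
  have mx: "F (t, mix {..<n} \<alpha> \<beta>) = F (t, \<beta>)" for t \<alpha> \<beta> by (rule prefix_irrelevant) (simp add: mix_def)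
  have "(\<integral>\<^sup>+\<beta>. (\<integral>\<^sup>+t. (\<integral>\<^sup>+\<alpha>. ennreal \<bar>F (t, \<alpha>) - F (z, \<beta>)\<bar> \<partial>coins w) \<partial>S) \<partial>coins w) \<le>
      (\<integral>\<^sup>+\<beta>. (\<integral>\<^sup>+t. (\<integral>\<^sup>+\<alpha>. ennreal \<bar>F (t, \<beta>) - F (t, \<alpha>)\<bar> + (\<integral>\<^sup>+x. G (x, \<beta>) \<partial>S) \<partial>coins w) \<partial>S) \<partial>coins w)"
  proof (intro nn_integral_mono)
    fix \<beta> t \<alpha> assume "t \<in> space S"
    then have t: "t \<in> {l..h}" by simp
    have "ennreal \<bar>F (t, \<alpha>) - F (z, \<beta>)\<bar> \<le> ennreal \<bar>F (t, \<beta>) - F (t, \<alpha>)\<bar> + ennreal \<bar>F (t, \<beta>) - F (z, \<beta>)\<bar>"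
      by (simp flip: ennreal_plus)
    also have "\<dots> \<le> ennreal \<bar>F (t, \<beta>) - F (t, \<alpha>)\<bar> + (\<integral>\<^sup>+x. indicator UNIV x * G (x, \<beta>) \<partial>S)"
      by (intro add_left_mono vertical_le t z) simp
    finally show "ennreal \<bar>F (t, \<alpha>) - F (z, \<beta>)\<bar> \<le> ennreal \<bar>F (t, \<beta>) - F (t, \<alpha>)\<bar> + (\<integral>\<^sup>+x. G (x, \<beta>) \<partial>S)" by simp
  qed
  also have "\<dots> = (\<integral>\<^sup>+\<beta>. (\<integral>\<^sup>+t. (\<integral>\<^sup>+\<alpha>. ennreal \<bar>F (t, \<beta>) - F (t, \<alpha>)\<bar> \<partial>coins w) + (\<integral>\<^sup>+x. G (x, \<beta>) \<partial>S) \<partial>S) \<partial>coins w)"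
    by (intro nn_integral_cong) (subst nn_integral_add, simp_all add: coins.emeasure_space_1[simplified])
  also have "\<dots> = (\<integral>\<^sup>+\<beta>. (\<integral>\<^sup>+t. (\<integral>\<^sup>+\<alpha>. ennreal \<bar>F (t, \<beta>) - F (t, \<alpha>)\<bar> \<partial>coins w) \<partial>S) + ennreal (h - l) * (\<integral>\<^sup>+x. G (x, \<beta>) \<partial>S) \<partial>coins w)"
    by (intro nn_integral_cong) (subst nn_integral_add, simp_all add: emeasure_S mult.commute)
  also have "\<dots> = (\<integral>\<^sup>+\<beta>. (\<integral>\<^sup>+t. (\<integral>\<^sup>+\<alpha>. ennreal \<bar>F (t, \<beta>) - F (t, \<alpha>)\<bar> \<partial>coins w) \<partial>S) \<partial>coins w) +
      ennreal (h - l) * (\<integral>\<^sup>+\<beta>. (\<integral>\<^sup>+x. G (x, \<beta>) \<partial>S) \<partial>coins w)"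
    by (subst nn_integral_add) (simp_all add: nn_integral_cmult)
  also have "(\<integral>\<^sup>+\<beta>. (\<integral>\<^sup>+x. G (x, \<beta>) \<partial>S) \<partial>coins w) = energy"
    unfolding energy_def by (rule SC.Fubini') simp
  also have "(\<integral>\<^sup>+\<beta>. (\<integral>\<^sup>+t. (\<integral>\<^sup>+\<alpha>. ennreal \<bar>F (t, \<beta>) - F (t, \<alpha>)\<bar> \<partial>coins w) \<partial>S) \<partial>coins w) =
      (\<integral>\<^sup>+t. (\<integral>\<^sup>+\<beta>. (\<integral>\<^sup>+\<alpha>. ennreal \<bar>F (t, \<beta>) - F (t, \<alpha>)\<bar> \<partial>coins w) \<partial>coins w) \<partial>S)"
    by (rule SC.Fubini') simp
  also have "\<dots> = oscillation n"
    unfolding oscillation_def mx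
  proof (intro nn_integral_cong)
    fix t assume [measurable]: "t \<in> space S"
    show "(\<integral>\<^sup>+\<beta>. (\<integral>\<^sup>+\<alpha>. ennreal \<bar>F (t, \<beta>) - F (t, \<alpha>)\<bar> \<partial>coins w) \<partial>coins w) = (\<integral>\<^sup>+x. ennreal \<bar>F (t, snd x) - F (t, fst x)\<bar> \<partial>P)"
      by (subst coins.nn_integral_fst[symmetric]) (simp_all add: abs_minus_commute)
  qed
  also have "oscillation n + ennreal (h - l) * energy \<le> ennreal (8 / 2 ^ n) * energy + ennreal (2 / 2 ^ n) * energy"
    by (intro add_mono oscillation_le mult_right_mono ennreal_leI lh) simp
  also have "\<dots> = ennreal (10 / 2 ^ n) * energy"
    by (simp flip: distrib_right ennreal_plus add_divide_distrib)
  finally show ?thesis .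
qed

end

subsection \<open>Balls and boxes\<close>

definition box_lo :: "nat \<Rightarrow> real \<Rightarrow> real" where "box_lo n s = max 0 (s - 1 / 2 ^ n)"
definition box_hi :: "nat \<Rightarrow> real \<Rightarrow> real" where "box_hi n s = min 1 (s + 1 / 2 ^ n)"

definition strip_box :: "nat \<Rightarrow> real \<Rightarrow> (nat \<Rightarrow> bool) \<Rightarrow> (nat \<Rightarrow> bool) \<Rightarrow> laakso_point set" where
  "strip_box n s a b = {box_lo n s..box_hi n s} \<times> (cylinder n a \<union> cylinder n b)"

text \<open>\<open>b = a\<close> stands for a ball that reaches one cylinder only, so that one and
  two cylinders are treated alike. Otherwise the box contains a height at which the two cylinders
  are glued.\<close>

definition box_neighbour :: "nat \<Rightarrow> real \<Rightarrow> (nat \<Rightarrow> bool) \<Rightarrow> (nat \<Rightarrow> bool) \<Rightarrow> bool" where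
  "box_neighbour n s a b \<longleftrightarrow>
     b = a \<or> (\<exists>m<n. b = a(m := \<not> a m) \<and> wormhole m \<inter> {box_lo n s..box_hi n s} \<noteq> {})"

text \<open>The upper bound forces wormholes of level below \<open>n\<close> within \<open>r\<close>
  of one height to coincide, by \<open>wormhole_separated\<close>; the lower bound makes the box fit
  into the ball of radius \<open>16 * r\<close>. All radii above 1/4 belong to \<open>n = 0\<close>,
  where the box is the whole space.\<close>

definition scale :: "nat \<Rightarrow> real \<Rightarrow> bool" where
  "scale n r \<longleftrightarrow> 1 / 2 ^ (n + 2) < r \<and> (n = 0 \<or> r \<le> 1 / 2 ^ (n + 1))"

lemma scale_exists: "r > 0 \<Longrightarrow> \<exists>n. scale n r"
proof -
  assume "r > 0"
  define n where "n = (LEAST n. 1 / 2 ^ (n + 2) < r)"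
  obtain k where "(1 / 2) ^ k < r" using real_arch_pow_inv[of r "1 / 2"] \<open>r > 0\<close> by auto
  then have "1 / 2 ^ (k + 2) < r"
  proof -
    have "(1::real) / 2 ^ (k + 2) \<le> 1 / 2 ^ k" by (intro divide_left_mono power_increasing) auto
    then show ?thesis using \<open>(1 / 2) ^ k < r\<close> by (simp add: power_divide)
  qed
  then have 1: "1 / 2 ^ (n + 2) < r" unfolding n_def by (rule LeastI)
  have "n = 0 \<or> r \<le> 1 / 2 ^ (n + 1)"
  proof (cases n)
    case (Suc m)
    then have "\<not> 1 / 2 ^ (m + 2) < r" using not_less_Least[of m "\<lambda>n. 1 / 2 ^ (n + 2) < r"] n_def by simp
    then show ?thesis using Suc by simp
  qed simp
  then show ?thesis using 1 by (auto simp: scale_def)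
qed

lemma box_bounds:
  assumes "s \<in> {0..1}"
  shows "0 \<le> box_lo n s" "box_lo n s \<le> s" "s \<le> box_hi n s" "box_hi n s \<le> 1"
    "1 / 2 ^ n \<le> box_hi n s - box_lo n s" "box_hi n s - box_lo n s \<le> 2 / 2 ^ n"
proof -
  have n: "1 / 2 ^ n \<le> (1::real)" "0 < 1 / (2 ^ n :: real)" by simp_all
  show "0 \<le> box_lo n s" "box_lo n s \<le> s" "s \<le> box_hi n s" "box_hi n s \<le> 1"
    "1 / 2 ^ n \<le> box_hi n s - box_lo n s"
    using assms n unfolding box_lo_def box_hi_def by (auto simp: max_def min_def)
  have "box_lo n s \<ge> s - 1 / 2 ^ n" "box_hi n s \<le> s + 1 / 2 ^ n" by (simp_all add: box_lo_def box_hi_def)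
  then show "box_hi n s - box_lo n s \<le> 2 / 2 ^ n" by simp
qed

lemma strip_box_subset_strips: "s \<in> {0..1} \<Longrightarrow> strip_box n s a b \<subseteq> strips"
  using box_bounds[of s n] by (auto simp: strip_box_def strips_def)

lemma strip_box_subset_ball:
  assumes p: "(s, a) \<in> strips" and r: "scale n r" and b: "box_neighbour n s a b" and q: "q \<in> strip_box n s a b"
  shows "walk_dist (s, a) q < 16 * r"
proof -
  have s: "s \<in> {0..1}" using p by (simp add: strips_def)
  note bd = box_bounds[OF s, of n]
  have "walk_dist (s, a) q \<le> 2 * (box_hi n s - box_lo n s)"
  proof (rule walk_dist_less_of_agree[where n = n])
    show "q \<in> strips" using q strip_box_subset_strips[OF s] by blast
    show "wormhole m \<inter> {box_lo n s..box_hi n s} \<noteq> {}" if "m < n" "snd (s, a) m \<noteq> snd q m" for m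
    proof -
      have "snd q \<notin> cylinder n a" using that by (auto simp: cylinder_def)
      then have "snd q \<in> cylinder n b" using q by (auto simp: strip_box_def)
      then have "b m \<noteq> a m" using that by (auto simp: cylinder_def)
      then show ?thesis using b by (auto simp: box_neighbour_def split: if_splits)
    qed
  qed (use p q bd s in \<open>auto simp: strip_box_def\<close>)
  \<comment> \<open>A window of length at most \<open>2 / 2^n\<close> gives \<open>4 / 2^n\<close>,
    and \<open>1 / 2^n < 4 * r\<close> by the choice of scale: hence 16.\<close>
  also have "\<dots> \<le> 4 / 2 ^ n" using bd(6) by simp
  also have "\<dots> < 16 * r" using r by (simp add: scale_def field_simps)
  finally show ?thesis .
qed

lemma ball_subset_strip_box:
  assumes p: "(s, a) \<in> strips" and r: "scale n r"
  obtains b where "box_neighbour n s a b" "{q \<in> strips. walk_dist (s, a) q < r} \<subseteq> strip_box n s a b"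
proof -
  have s: "s \<in> {0..1}" using p by (simp add: strips_def)
  have n1: "1 / 2 ^ (n + 1) = (1 / 2 ^ n) / (2::real)" "0 < 1 / (2 ^ n :: real)" by simp_all
  show ?thesis
  \<comment> \<open>At \<open>n = 0\<close> the radius is not bounded above, but the window is all
    of \<open>[0,1]\<close> and the empty prefix constrains nothing.\<close>
  proof (cases "n = 0")
    case True
    have "q \<in> strip_box n s a a" if "q \<in> strips" for q
      using that s by (auto simp: True strip_box_def box_lo_def box_hi_def cylinder_def strips_def)
    then show ?thesis by (intro that[of a]) (auto simp: box_neighbour_def)
  next
    case False
    then have r2: "2 * r \<le> 1 / 2 ^ n" using r by (simp add: scale_def field_simps)
    have height: "x \<in> {box_lo n s..box_hi n s}" if "x \<in> {0..1}" "\<bar>x - s\<bar> < r" for x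
      using that r2 n1 unfolding box_lo_def box_hi_def by auto
    show ?thesis
    proof (cases "\<exists>m<n. \<exists>z\<in>wormhole m. \<bar>z - s\<bar> < r")
      case True
      then obtain m z where m: "m < n" "z \<in> wormhole m" "\<bar>z - s\<bar> < r" by blast
      define b where "b = a(m := \<not> a m)"
      have "z \<in> {box_lo n s..box_hi n s}" using m wormhole_subset[of m] by (intro height) auto
      then have nb: "box_neighbour n s a b" using m unfolding box_neighbour_def b_def by blast
      have "q \<in> strip_box n s a b" if q: "q \<in> strips" "walk_dist (s, a) q < r" for q
      proof -
        have "fst q \<in> {box_lo n s..box_hi n s}"
          using walk_dist_less_imp(1)[OF p q] q(1) by (intro height) (auto simp: strips_def)
        \<comment> \<open>Both \<open>y\<close> and \<open>z\<close> are within \<open>r\<close> of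
          \<open>s\<close>, and \<open>2 * r \<le> 2^-n\<close>; two coarse heights that close are
          equal, and so are their levels.\<close>
        moreover have only: "k = m" if k: "k < n" "a k \<noteq> snd q k" for k
        proof -
          obtain y where y: "y \<in> wormhole k" "\<bar>y - s\<bar> < r"
            using walk_dist_less_imp(2)[OF p q, of k] k(2) by auto
          have "\<bar>y - z\<bar> < 1 / 2 ^ n" using y m r2 by linarith
          then have "y = z" using wormhole_separated[OF y(1) m(2) k(1) m(1)] by simp
          then show ?thesis using wormhole_disjoint y m by blast
        qed
        have "snd q \<in> cylinder n a \<union> cylinder n b"
        proof (cases "snd q m = a m")
          case True
          then have "snd q k = a k" if "k < n" for k using only[OF that] by metis
          then show ?thesis by (simp add: cylinder_def)
        next
          case False
          then have "snd q k = b k" if "k < n" for k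
            using only[OF that] unfolding b_def fun_upd_apply by metis
          then show ?thesis by (simp add: cylinder_def)
        qed
        ultimately show ?thesis by (auto simp: strip_box_def mem_Times_iff)
      qed
      then show ?thesis by (intro that[OF nb]) auto
    next
      case False
      have "q \<in> strip_box n s a a" if q: "q \<in> strips" "walk_dist (s, a) q < r" for q
      proof -
        have "fst q \<in> {box_lo n s..box_hi n s}"
          using walk_dist_less_imp(1)[OF p q] q(1) by (intro height) (auto simp: strips_def)
        moreover have "snd q \<in> cylinder n a"
          using walk_dist_less_imp(2)[OF p q] False by (fastforce simp: cylinder_def)
        ultimately show ?thesis by (auto simp: strip_box_def mem_Times_iff)
      qed
      then show ?thesis by (intro that[of a]) (auto simp: box_neighbour_def)
    qed
  qed
qed

subsection \<open>Doubling\<close>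

lemma strip_emeasure_Times:
  assumes "0 \<le> l" "l \<le> h" "h \<le> 1" "A \<in> sets (coins w)"
  shows "{l..h} \<times> A \<in> sets (strip_measure w)"
    "emeasure (strip_measure w) ({l..h} \<times> A) = ennreal (h - l) * emeasure (coins w) A"
proof -
  have I: "{l..h} \<in> sets unit_lebesgue" using assms by (auto simp: sets_restrict_space_iff)
  then show "{l..h} \<times> A \<in> sets (strip_measure w)" using assms by (simp add: strip_measure_def)
  have "emeasure unit_lebesgue {l..h} = ennreal (h - l)"
    using assms by (subst emeasure_restrict_space) auto
  then show "emeasure (strip_measure w) ({l..h} \<times> A) = ennreal (h - l) * emeasure (coins w) A"
    unfolding strip_measure_def using I assms by (subst coins.emeasure_pair_measure_Times) auto
qed

lemma strip_box_sets: "s \<in> {0..1} \<Longrightarrow> strip_box n s a b \<in> sets (strip_measure w)"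
  unfolding strip_box_def using box_bounds[of s n] by (intro strip_emeasure_Times) auto

lemma coin_weight_Suc: "coin_weight w (Suc n) a = coin_weight w n a * (if a n then w else 1 - w)"
  by (simp add: coin_weight_def)

lemma coin_weight_le:
  assumes "w \<in> {0<..<1}" "n \<le> n'"
  shows "coin_weight w n' a \<le> coin_weight w n a"
  using assms(2)
proof (induction rule: dec_induct)
  case (step m)
  have "coin_weight w (Suc m) a \<le> coin_weight w m a * 1"
    unfolding coin_weight_Suc
    using assms(1) coin_weight_pos[of w m a] by (intro mult_left_mono) auto
  then show ?case using step by simp
qed simp

lemma coin_weight_add: "w \<in> {0<..<1} \<Longrightarrow> coin_weight w n a * min w (1 - w) ^ k \<le> coin_weight w (n + k) a"
proof (induction k)
  case (Suc k)
  have "coin_weight w n a * min w (1 - w) ^ Suc k = (coin_weight w n a * min w (1 - w) ^ k) * min w (1 - w)" by simp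
  also have "\<dots> \<le> coin_weight w (n + k) a * (if a (n + k) then w else 1 - w)"
    using Suc coin_weight_pos[of w "n + k" a] by (intro mult_mono) auto
  finally show ?case by (simp add: coin_weight_Suc)
qed simp

text \<open>Neighbouring cylinders have comparable weights, because only one factor changes and all
  factors lie between \<open>min w (1 - w)\<close> and 1. This is one source of the dependence of
  the doubling constant on \<open>w\<close>.\<close>

lemma coin_weight_flip:
  assumes "w \<in> {0<..<1}"
  shows "coin_weight w n (a(m := c)) * min w (1 - w) \<le> coin_weight w n a"
proof (cases "m < n")
  case True
  let ?c = "\<lambda>x. if x then w else 1 - w"
  have eq: "coin_weight w n b = ?c (b m) * (\<Prod>i\<in>{..<n} - {m}. ?c (b i))" for b
    unfolding coin_weight_def using True by (subst prod.remove[of _ m]) auto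
  have "(\<Prod>i\<in>{..<n} - {m}. ?c ((a(m := c)) i)) = (\<Prod>i\<in>{..<n} - {m}. ?c (a i))"
    by (rule prod.cong) auto
  moreover have "0 \<le> (\<Prod>i\<in>{..<n} - {m}. ?c (a i))" using assms by (intro prod_nonneg) auto
  moreover have "?c c * min w (1 - w) \<le> ?c (a m)"
  proof -
    have "?c c * min w (1 - w) \<le> 1 * min w (1 - w)" using assms by (intro mult_right_mono) auto
    also have "\<dots> \<le> ?c (a m)" by auto
    finally show ?thesis .
  qed
  ultimately have "(?c c * min w (1 - w)) * (\<Prod>i\<in>{..<n} - {m}. ?c ((a(m := c)) i)) \<le>
      ?c (a m) * (\<Prod>i\<in>{..<n} - {m}. ?c (a i))"
    by (metis mult_right_mono)
  then show ?thesis
    unfolding eq[of "a(m := c)"] eq[of a] fun_upd_same by (simp only: mult_ac)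
next
  case False
  then have "coin_weight w n (a(m := c)) = coin_weight w n a"
    unfolding coin_weight_def by (intro prod.cong) auto
  then show ?thesis using coin_weight_pos[OF assms, of n a] assms by (simp add: mult_left_le)
qed

lemma emeasure_laakso_ball:
  assumes "p \<in> strips"
  shows "emeasure (laakso_measure w) (laakso.mball (glue p) r) =
    emeasure (strip_measure w) {q \<in> strips. walk_dist p q < r}"
    and "{q \<in> strips. walk_dist p q < r} \<in> sets (strip_measure w)"
proof -
  have B: "laakso.mball (glue p) r \<in> sets laakso_borel"
    by (intro open_in_sets_laakso_borel laakso.openin_mball)
  have eq: "glue -` laakso.mball (glue p) r \<inter> space (strip_measure w) = {q \<in> strips. walk_dist p q < r}"
    using assms by (auto simp: laakso_dist_glue glue_in_laakso)
  show "{q \<in> strips. walk_dist p q < r} \<in> sets (strip_measure w)"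
    using measurable_sets[OF measurable_glue B, of w] unfolding eq .
  show "emeasure (laakso_measure w) (laakso.mball (glue p) r) =
      emeasure (strip_measure w) {q \<in> strips. walk_dist p q < r}"
    unfolding laakso_measure_def by (simp only: emeasure_distr[OF measurable_glue B] eq)
qed

context
  fixes w :: real and s :: real and a :: "nat \<Rightarrow> bool" and n :: nat and r :: real
  assumes w: "w \<in> {0<..<1}" and p: "(s, a) \<in> strips" and sc: "scale n r"
begin

lemma emeasure_ball_le:
  "emeasure (laakso_measure w) (laakso.mball (glue (s, a)) r) \<le>
    ennreal ((2 + 2 / min w (1 - w)) * (coin_weight w n a / 2 ^ n))"
proof -
  have s: "s \<in> {0..1}" using p by (simp add: strips_def)
  note bd = box_bounds[OF s, of n]
  obtain b where b: "box_neighbour n s a b" "{q \<in> strips. walk_dist (s, a) q < r} \<subseteq> strip_box n s a b"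
    by (rule ball_subset_strip_box[OF p sc])
  have m: "0 < min w (1 - w)" using w by auto
  have wb: "coin_weight w n b \<le> coin_weight w n a / min w (1 - w)"
  proof -
    \<comment> \<open>The second instance covers \<open>b = a\<close>, written as the trivial update
      \<open>a(0 := a 0)\<close>.\<close>
    have "coin_weight w n b * min w (1 - w) \<le> coin_weight w n a"
      using b(1) coin_weight_flip[OF w, of n a] coin_weight_flip[OF w, of n a 0 "a 0"]
      by (auto simp: box_neighbour_def)
    then show ?thesis using m by (simp add: pos_le_divide_eq)
  qed
  have "emeasure (laakso_measure w) (laakso.mball (glue (s, a)) r) \<le> emeasure (strip_measure w) (strip_box n s a b)"
    unfolding emeasure_laakso_ball(1)[OF p] by (rule emeasure_mono) (use b strip_box_sets s in auto)
  also have "\<dots> = ennreal (box_hi n s - box_lo n s) * emeasure (coins w) (cylinder n a \<union> cylinder n b)"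
    unfolding strip_box_def using bd by (intro strip_emeasure_Times) auto
  also have "\<dots> \<le> ennreal (2 / 2 ^ n) * (ennreal (coin_weight w n a) + ennreal (coin_weight w n a / min w (1 - w)))"
  proof (intro mult_mono ennreal_leI bd)
    have "emeasure (coins w) (cylinder n a \<union> cylinder n b) \<le> emeasure (coins w) (cylinder n a) + emeasure (coins w) (cylinder n b)"
      by (rule emeasure_subadditive) auto
    also have "\<dots> \<le> ennreal (coin_weight w n a) + ennreal (coin_weight w n a / min w (1 - w))"
      using w wb by (subst (1 2) emeasure_cylinder) (auto intro!: add_left_mono ennreal_leI)
    finally show "emeasure (coins w) (cylinder n a \<union> cylinder n b) \<le> \<dots>" .
  qed auto
  also have "\<dots> = ennreal ((2 + 2 / min w (1 - w)) * (coin_weight w n a / 2 ^ n))"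
  proof -
    have "0 \<le> coin_weight w n a" using coin_weight_pos[OF w, of n a] by simp
    then show ?thesis using m
      by (simp flip: ennreal_plus ennreal_mult) (simp add: algebra_simps add_divide_distrib)
  qed
  finally show ?thesis .
qed

lemma emeasure_ball_ge:
  "ennreal (coin_weight w n a / 2 ^ n) \<le> emeasure (laakso_measure w) (laakso.mball (glue (s, a)) (16 * r))"
proof -
  have s: "s \<in> {0..1}" using p by (simp add: strips_def)
  note bd = box_bounds[OF s, of n]
  have "ennreal (coin_weight w n a / 2 ^ n) = ennreal (1 / 2 ^ n) * ennreal (coin_weight w n a)"
    using coin_weight_pos[OF w, of n a] by (simp flip: ennreal_mult)
  also have "\<dots> \<le> ennreal (box_hi n s - box_lo n s) * emeasure (coins w) (cylinder n a)"
    using w bd by (subst emeasure_cylinder) (auto intro!: mult_right_mono ennreal_leI)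
  also have "\<dots> = emeasure (strip_measure w) (strip_box n s a a)"
    unfolding strip_box_def Un_absorb using bd by (intro strip_emeasure_Times(2)[symmetric]) auto
  also have "\<dots> \<le> emeasure (strip_measure w) {q \<in> strips. walk_dist (s, a) q < 16 * r}"
  proof (rule emeasure_mono)
    have "box_neighbour n s a a" by (simp add: box_neighbour_def)
    then show "strip_box n s a a \<subseteq> {q \<in> strips. walk_dist (s, a) q < 16 * r}"
      using strip_box_subset_ball[OF p sc] strip_box_subset_strips[OF s] by blast
  qed (rule emeasure_laakso_ball[OF p])
  finally show ?thesis by (simp add: emeasure_laakso_ball(1)[OF p])
qed

end

text \<open>The ball of radius \<open>2 * r\<close> is bounded above at its scale \<open>n\<close>,
  the ball of radius \<open>r\<close> below at the scale \<open>n'\<close> of \<open>r / 16\<close>.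
  These radii differ by the factor 32, so \<open>n'\<close> exceeds \<open>n\<close> by at most 5,
  which costs \<open>2^5\<close> in length and five factors \<kappa> in weight.\<close>

lemma doubling_laakso:
  assumes w: "w \<in> {0<..<1}"
  shows "doubling_measure laakso laakso_dist (laakso_measure w)"
proof -
  define \<kappa> where "\<kappa> = min w (1 - w)"
  have k: "0 < \<kappa>" "\<kappa> \<le> 1" using w by (auto simp: \<kappa>_def)
  define C where "C = (2 + 2 / \<kappa>) * (32 / \<kappa> ^ 5)"
  have C1: "C \<ge> 1"
  proof -
    have "\<kappa> ^ 5 \<le> 1" using k by (intro power_le_one) auto
    then have "1 \<le> 32 / \<kappa> ^ 5" using k by (simp add: pos_le_divide_eq)
    moreover have "1 \<le> 2 + 2 / \<kappa>" using k by (simp add: add_increasing2)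
    ultimately have "1 * 1 \<le> (2 + 2 / \<kappa>) * (32 / \<kappa> ^ 5)" by (intro mult_mono) auto
    then show ?thesis by (simp add: C_def)
  qed
  interpret prob_space "laakso_measure w" by (rule prob_space_laakso_measure)
  have "0 < emeasure (laakso_measure w) (laakso.mball x (2 * r)) \<and>
      emeasure (laakso_measure w) (laakso.mball x (2 * r)) \<le> ennreal C * emeasure (laakso_measure w) (laakso.mball x r) \<and>
      emeasure (laakso_measure w) (laakso.mball x r) < \<infinity>" if x: "x \<in> laakso" and r: "r > 0" for x r
  proof (intro conjI)
    obtain s a where p: "(s, a) \<in> strips" "x = glue (s, a)" using x by (rule laakso_cases)
    obtain n where n: "scale n (2 * r)" using scale_exists[of "2 * r"] r by auto
    obtain n' where n': "scale n' (r / 16)" using scale_exists[of "r / 16"] r by auto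
    have ge: "ennreal (coin_weight w n' a / 2 ^ n') \<le> emeasure (laakso_measure w) (laakso.mball x r)"
      using emeasure_ball_ge[OF w p(1) n'] p by simp
    have "n' \<le> n + 5"
    proof (cases "n' = 0")
      case False
      have "1 / 2 ^ (n + 2) < 2 * r" "r / 16 \<le> 1 / 2 ^ (n' + 1)" using n n' False by (auto simp: scale_def)
      then have "1 / 2 ^ (n + 2) < 32 / (2 ^ (n' + 1) :: real)" by linarith
      then have "(2::real) ^ (n' + 1) < 2 ^ (n + 7)" by (simp add: field_simps power_add)
      then have "n' + 1 < n + 7" by (rule power_less_imp_less_exp[rotated]) simp
      then show ?thesis by simp
    qed simp
    have "coin_weight w n a * \<kappa> ^ 5 \<le> coin_weight w n' a"
      using coin_weight_add[OF w, of n a 5] coin_weight_le[OF w \<open>n' \<le> n + 5\<close>, of a] by (simp add: \<kappa>_def)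
    moreover have "1 / 2 ^ (n + 5) \<le> (1 / 2 ^ n' :: real)"
      using \<open>n' \<le> n + 5\<close> by (intro divide_left_mono power_increasing) auto
    ultimately have "(coin_weight w n a * \<kappa> ^ 5) * (1 / 2 ^ (n + 5)) \<le> coin_weight w n' a * (1 / 2 ^ n')"
      using coin_weight_pos[OF w, of n' a] by (intro mult_mono) auto
    then have le: "coin_weight w n a / 2 ^ n \<le> (32 / \<kappa> ^ 5) * (coin_weight w n' a / 2 ^ n')"
      using k by (simp add: field_simps power_add)
    have "emeasure (laakso_measure w) (laakso.mball x (2 * r)) \<le> ennreal ((2 + 2 / \<kappa>) * (coin_weight w n a / 2 ^ n))"
      using emeasure_ball_le[OF w p(1) n] p by (simp add: \<kappa>_def)
    also have "\<dots> \<le> ennreal ((2 + 2 / \<kappa>) * ((32 / \<kappa> ^ 5) * (coin_weight w n' a / 2 ^ n')))"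
      using k by (intro ennreal_leI mult_left_mono le) (simp add: add_nonneg_nonneg)
    also have "\<dots> = ennreal C * ennreal (coin_weight w n' a / 2 ^ n')"
    proof -
      have "ennreal C * ennreal (coin_weight w n' a / 2 ^ n') = ennreal (C * (coin_weight w n' a / 2 ^ n'))"
        using C1 coin_weight_pos[OF w, of n' a] by (subst ennreal_mult) auto
      then show ?thesis by (simp only: C_def mult.assoc)
    qed
    also have "\<dots> \<le> ennreal C * emeasure (laakso_measure w) (laakso.mball x r)"
      by (intro mult_left_mono ge) simp
    finally show "emeasure (laakso_measure w) (laakso.mball x (2 * r)) \<le> ennreal C * emeasure (laakso_measure w) (laakso.mball x r)" .
    have "0 < ennreal (coin_weight w n' a / 2 ^ n')" using coin_weight_pos[OF w, of n' a] by simp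
    also have "\<dots> \<le> emeasure (laakso_measure w) (laakso.mball x r)" by (rule ge)
    also have "\<dots> \<le> emeasure (laakso_measure w) (laakso.mball x (2 * r))"
      using r by (intro emeasure_mono laakso.mball_subset_concentric)
        (auto simp: sets_laakso_measure intro!: open_in_sets_laakso_borel)
    finally show "0 < emeasure (laakso_measure w) (laakso.mball x (2 * r))" .
    show "emeasure (laakso_measure w) (laakso.mball x r) < \<infinity>" by (simp add: less_top[symmetric])
  qed
  then show ?thesis unfolding doubling_measure_def using C1 by blast
qed

subsection \<open>The Poincare inequality\<close>

text \<open>Up to the factor 2 the mean may be replaced by any constant \<open>c\<close>, since
  \<open>c\<close> differs from the mean by at most the average of \<open>\<bar>u - c\<bar>\<close>.
  This frees the choice of the reference value.\<close>

lemma mean_deviation_le: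
  fixes u :: "'a \<Rightarrow> real"
  assumes M: "finite_measure M" and B: "B \<in> sets M" "0 < measure M B" and u: "set_integrable M B u"
  shows "ennreal (\<integral>y\<in>B. \<bar>u y - (\<integral>y\<in>B. u y \<partial>M) / measure M B\<bar> \<partial>M) \<le> 2 * (\<integral>\<^sup>+y\<in>B. ennreal \<bar>u y - c\<bar> \<partial>M)"
proof -
  interpret finite_measure M by (rule M)
  let ?m = "(\<integral>y\<in>B. u y \<partial>M) / measure M B"
  have const: "set_integrable M B (\<lambda>_. k)" for k :: real
    using B by (simp add: set_integrable_def emeasure_eq_measure)
  have int: "set_integrable M B (\<lambda>y. \<bar>u y - k\<bar>)" for k
    using set_integrable_abs[OF set_integral_diff(1)[OF u const]] by simp
  have intc: "(\<integral>y\<in>B. k \<partial>M) = k * measure M B" for k :: real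
    using B by (simp add: set_lebesgue_integral_def)
  have "(\<integral>y\<in>B. \<bar>u y - ?m\<bar> \<partial>M) \<le> (\<integral>y\<in>B. \<bar>u y - c\<bar> + \<bar>c - ?m\<bar> \<partial>M)"
    by (rule set_integral_mono[OF int set_integral_add(1)[OF int const]]) linarith
  also have "\<dots> = (\<integral>y\<in>B. \<bar>u y - c\<bar> \<partial>M) + \<bar>c - ?m\<bar> * measure M B"
    by (subst set_integral_add(2)[OF int const]) (simp add: intc)
  also have "\<bar>c - ?m\<bar> * measure M B = \<bar>\<integral>y\<in>B. u y - c \<partial>M\<bar>"
  proof -
    have "(\<integral>y\<in>B. u y - c \<partial>M) = - ((c - ?m) * measure M B)"
      using B(2) by (subst set_integral_diff(2)[OF u const]) (simp add: intc field_simps)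
    then show ?thesis by (simp add: abs_mult)
  qed
  also have "\<dots> \<le> (\<integral>y\<in>B. \<bar>u y - c\<bar> \<partial>M)"
    unfolding set_lebesgue_integral_def
    by (rule order_trans[OF integral_abs_bound]) (simp add: abs_mult)
  finally have "ennreal (\<integral>y\<in>B. \<bar>u y - ?m\<bar> \<partial>M) \<le> ennreal (2 * (\<integral>y\<in>B. \<bar>u y - c\<bar> \<partial>M))"
    by (intro ennreal_leI) simp
  also have "\<dots> = 2 * ennreal (\<integral>y\<in>B. \<bar>u y - c\<bar> \<partial>M)"
    by (simp add: ennreal_mult')
  also have "ennreal (\<integral>y\<in>B. \<bar>u y - c\<bar> \<partial>M) = (\<integral>\<^sup>+y\<in>B. ennreal \<bar>u y - c\<bar> \<partial>M)"
  proof -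
    have "(\<integral>\<^sup>+y. ennreal (indicator B y *\<^sub>R \<bar>u y - c\<bar>) \<partial>M) = ennreal (\<integral>y\<in>B. \<bar>u y - c\<bar> \<partial>M)"
      unfolding set_lebesgue_integral_def
      by (rule nn_integral_eq_integral) (use int[of c] in \<open>auto simp: set_integrable_def\<close>)
    moreover have "(\<integral>\<^sup>+y. ennreal (indicator B y *\<^sub>R \<bar>u y - c\<bar>) \<partial>M) = (\<integral>\<^sup>+y\<in>B. ennreal \<bar>u y - c\<bar> \<partial>M)"
      by (rule nn_integral_cong) (auto simp: indicator_def)
    ultimately show ?thesis by simp
  qed
  finally show ?thesis .
qed

section \<open>Transfer between the quotient and boxes\<close>

lemma measurable_strip_mix:
  assumes "0 \<le> l" "h \<le> 1"
  shows "(\<lambda>q. (fst q, mix A a (snd q))) \<in> restrict_space lborel {l..h} \<Otimes>\<^sub>M coins w \<rightarrow>\<^sub>M strip_measure w"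
  unfolding strip_measure_def
proof (rule measurable_Pair)
  have "(\<lambda>t. t) \<in> restrict_space lborel {l..h} \<rightarrow>\<^sub>M unit_lebesgue"
    using assms by (intro measurable_restrict_space2 measurable_restrict_space1) (auto simp: space_restrict_space)
  then show "(\<lambda>q. fst q) \<in> restrict_space lborel {l..h} \<Otimes>\<^sub>M coins w \<rightarrow>\<^sub>M unit_lebesgue"
    by (rule measurable_compose[OF measurable_fst])
qed measurable

text \<open>Brings an integral over a box into the form used in \<open>laakso_box\<close>, at the
  price of the weight of the cylinder, which will occur on both sides of the estimate.\<close>

lemma nn_integral_strip:
  assumes "0 \<le> l" "h \<le> 1" and [measurable]: "H \<in> borel_measurable (strip_measure w)"
  shows "(\<integral>\<^sup>+q\<in>{l..h} \<times> cylinder n a. H q \<partial>strip_measure w) =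
    emeasure (coins w) (cylinder n a) *
      (\<integral>\<^sup>+t. (\<integral>\<^sup>+\<alpha>. H (t, mix {..<n} a \<alpha>) \<partial>coins w) \<partial>restrict_space lborel {l..h})"
proof -
  have H: "H \<in> borel_measurable (unit_lebesgue \<Otimes>\<^sub>M coins w)"
    using assms(3) by (simp add: strip_measure_def)
  have sec: "(\<lambda>\<alpha>. H (t, \<alpha>)) \<in> borel_measurable (coins w)" if "t \<in> {0..1}" for t
    using measurable_compose[OF measurable_Pair1'[of t unit_lebesgue "coins w"] H] that
    by (simp add: space_restrict_space)
  have mH: "(\<lambda>q. H (fst q, mix {..<n} a (snd q))) \<in> borel_measurable (restrict_space lborel {l..h} \<Otimes>\<^sub>M coins w)"
    using measurable_compose[OF measurable_strip_mix[OF assms(1,2)] assms(3)] .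
  have rect: "{l..h} \<times> cylinder n a \<in> sets (unit_lebesgue \<Otimes>\<^sub>M coins w)"
    using assms(1,2) by (auto intro!: pair_measureI simp: sets_restrict_space_iff)
  have "(\<integral>\<^sup>+q\<in>{l..h} \<times> cylinder n a. H q \<partial>strip_measure w) =
      (\<integral>\<^sup>+t. (\<integral>\<^sup>+\<alpha>. H (t, \<alpha>) * indicator ({l..h} \<times> cylinder n a) (t, \<alpha>) \<partial>coins w) \<partial>unit_lebesgue)"
    unfolding strip_measure_def using H rect by (subst coins.nn_integral_fst[symmetric]) auto
  also have "\<dots> = (\<integral>\<^sup>+t. (\<integral>\<^sup>+\<alpha>\<in>cylinder n a. H (t, \<alpha>) \<partial>coins w) * indicator {l..h} t \<partial>unit_lebesgue)"
    by (intro nn_integral_cong) (auto simp: indicator_def)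
  also have "\<dots> = (\<integral>\<^sup>+t. (\<integral>\<^sup>+\<alpha>\<in>cylinder n a. H (t, \<alpha>) \<partial>coins w) * indicator {l..h} t * indicator {0..1} t \<partial>lborel)"
    by (subst nn_integral_restrict_space) auto
  also have "\<dots> = (\<integral>\<^sup>+t. (\<integral>\<^sup>+\<alpha>\<in>cylinder n a. H (t, \<alpha>) \<partial>coins w) * indicator {l..h} t \<partial>lborel)"
    using assms(1,2) by (intro nn_integral_cong) (auto simp: indicator_def)
  also have "\<dots> = (\<integral>\<^sup>+t. (\<integral>\<^sup>+\<alpha>\<in>cylinder n a. H (t, \<alpha>) \<partial>coins w) \<partial>restrict_space lborel {l..h})"
    by (subst nn_integral_restrict_space) auto
  also have "\<dots> = (\<integral>\<^sup>+t. emeasure (coins w) (cylinder n a) * (\<integral>\<^sup>+\<alpha>. H (t, mix {..<n} a \<alpha>) \<partial>coins w) \<partial>restrict_space lborel {l..h})"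
    using assms(1,2) by (intro nn_integral_cong nn_integral_cylinder sec) (auto simp: space_restrict_space)
  also have "\<dots> = emeasure (coins w) (cylinder n a) *
      (\<integral>\<^sup>+t. (\<integral>\<^sup>+\<alpha>. H (t, mix {..<n} a \<alpha>) \<partial>coins w) \<partial>restrict_space lborel {l..h})"
    using coins.borel_measurable_nn_integral_fst[OF mH] by (intro nn_integral_cmult) simp
  finally show ?thesis .
qed

text \<open>Vertical segments are isometrically embedded, hence rectifiable of unit speed, so the
  line integral is an integral over heights.\<close>

lemma upper_gradient_vertical:
  assumes ug: "upper_gradient laakso laakso_dist u \<rho>" and "0 \<le> s" "s \<le> t" "t \<le> 1"
  shows "ennreal \<bar>u (glue (s, \<alpha>)) - u (glue (t, \<alpha>))\<bar> \<le> (\<integral>\<^sup>+x\<in>{s..t}. \<rho> (glue (x, \<alpha>)) \<partial>lborel)"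
proof -
  have \<rho>: "\<rho> \<in> borel_measurable laakso_borel" using ug by (simp add: upper_gradient_def laakso_borel_def)
  have st: "(x, \<alpha>) \<in> strips" if "x \<in> {s..t}" for x using that assms by (auto simp: strips_def)
  have d: "laakso_dist (glue (x, \<alpha>)) (glue (y, \<alpha>)) = \<bar>x - y\<bar>" if "x \<in> {s..t}" "y \<in> {s..t}" for x y
    using st that by (simp add: laakso_dist_glue walk_dist_same_branch)
  have "rectifiable_curve laakso laakso_dist (\<lambda>x. glue (x, \<alpha>)) s t"
    by (rule rectifiable_isometric[OF laakso.Metric_space_axioms assms(3)]) (use st d in \<open>auto simp: glue_in_laakso\<close>)
  then have "ennreal \<bar>u (glue (s, \<alpha>)) - u (glue (t, \<alpha>))\<bar> \<le> line_integral laakso_dist \<rho> (\<lambda>x. glue (x, \<alpha>)) s t"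
    using ug unfolding upper_gradient_def by blast
  also have "\<dots> = (\<integral>\<^sup>+x\<in>{s..t}. \<rho> (glue (x, \<alpha>)) \<partial>lborel)"
  proof (rule line_integral_isometric[OF assms(3)])
    show "laakso_dist (glue (x, \<alpha>)) (glue (y, \<alpha>)) = \<bar>x - y\<bar>" if "x \<in> {s..t}" "y \<in> {s..t}" for x y
      using d that .
    \<comment> \<open>Measurability of the sections depends only on the sigma-algebra, which is
      common to all \<open>coins w\<close>; the parameter is set to 0.\<close>
    have "(\<lambda>q. \<rho> (glue q)) \<in> borel_measurable (unit_lebesgue \<Otimes>\<^sub>M coins 0)"
      using measurable_compose[OF measurable_glue \<rho>, of 0] by (simp add: strip_measure_def)
    from measurable_compose[OF measurable_Pair2'[of \<alpha> "coins 0" unit_lebesgue] this]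
    have "(\<lambda>x. \<rho> (glue (x, \<alpha>))) \<in> borel_measurable unit_lebesgue" by simp
    \<comment> \<open>\<open>glue\<close> is controlled on \<open>strips\<close> only, so
      measurability on the line needs the cut-off to \<open>{0..1}\<close>, into which
      \<open>{s..t}\<close> fits.\<close>
    then have "(\<lambda>x. \<rho> (glue (x, \<alpha>)) * indicator {0..1} x) \<in> borel_measurable lborel"
      by (subst (asm) borel_measurable_restrict_space_iff_ennreal) auto
    then have [measurable]: "(\<lambda>x. \<rho> (glue (x, \<alpha>)) * indicator {0..1} x) \<in> borel_measurable borel" by simp
    have "(\<lambda>x. \<rho> (glue (x, \<alpha>)) * indicator {0..1} x * indicator {s..t} x) \<in> borel_measurable borel" by measurable
    also have "(\<lambda>x. \<rho> (glue (x, \<alpha>)) * indicator {0..1} x * indicator {s..t} x) =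
        (\<lambda>x. \<rho> (glue (x, \<alpha>)) * indicator {s..t} x)"
      using assms(2,4) by (auto simp: indicator_def)
    finally show "(\<lambda>x. \<rho> (glue (x, \<alpha>)) * indicator {s..t} x) \<in> borel_measurable borel" .
  qed
  finally show ?thesis .
qed

lemma glue_jump:
  assumes "z \<in> wormhole m" "\<And>i. i \<noteq> m \<Longrightarrow> \<alpha> i = \<beta> i"
  shows "glue (z, \<alpha>) = glue (z, \<beta>)"
proof -
  have z: "z \<in> {0..1}" using assms(1) wormhole_subset by blast
  then have st: "(z, \<alpha>) \<in> strips" "(z, \<beta>) \<in> strips" by (auto simp: strips_def)
  have "walk_dist (z, \<alpha>) (z, \<beta>) = \<bar>fst (z, \<alpha>) - fst (z, \<beta>)\<bar>"
  proof (rule walk_dist_vertical[OF st])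
    fix n assume "snd (z, \<alpha>) n \<noteq> snd (z, \<beta>) n"
    then have "n = m" using assms(2) by auto
    then show "wormhole n \<inter> {min (fst (z, \<alpha>)) (fst (z, \<beta>))..max (fst (z, \<alpha>)) (fst (z, \<beta>))} \<noteq> {}"
      using assms(1) by auto
  qed
  then show ?thesis using glue_eq_iff[OF st] by simp
qed

context
  fixes w :: real and u :: "real \<Rightarrow> real" and \<rho> :: "real \<Rightarrow> ennreal"
  assumes w: "w \<in> {0<..<1}" and u: "integrable (laakso_measure w) u"
    and ug: "upper_gradient laakso laakso_dist u \<rho>"
begin

lemma integrable_u_glue: "integrable (strip_measure w) (\<lambda>q. u (glue q))"
proof -
  have "u \<in> borel_measurable (laakso_measure w)" using u by auto
  then have "u \<in> borel_measurable laakso_borel" by (simp cong: measurable_cong_sets add: sets_laakso_measure)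
  then show ?thesis
    using u unfolding laakso_measure_def by (subst (asm) integrable_distr_eq) auto
qed

lemma measurable_rho_glue: "(\<lambda>q. \<rho> (glue q)) \<in> borel_measurable (strip_measure w)"
  using ug by (intro measurable_compose[OF measurable_glue]) (simp add: upper_gradient_def laakso_borel_def)

lemma laakso_box_glue:
  assumes s: "s \<in> {0..1}"
  shows "laakso_box w (box_lo n s) (box_hi n s) n
    (\<lambda>q. u (glue (fst q, mix {..<n} a (snd q)))) (\<lambda>q. \<rho> (glue (fst q, mix {..<n} a (snd q))))"
proof (rule laakso_box.intro)
  note bd = box_bounds[OF s, of n]
  let ?l = "box_lo n s" and ?h = "box_hi n s"
  let ?S = "restrict_space lborel {?l..?h}"
  let ?F = "\<lambda>q. u (glue (fst q, mix {..<n} a (snd q)))"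
  note mm = measurable_strip_mix[OF bd(1,4), of "{..<n}" a w]
  show "0 \<le> ?l" "?h \<le> 1" "1 / 2 ^ n \<le> ?h - ?l" "?h - ?l \<le> 2 / 2 ^ n" using bd by auto
  have mu: "(\<lambda>q. u (glue q)) \<in> borel_measurable (strip_measure w)" using integrable_u_glue by auto
  show "integrable (?S \<Otimes>\<^sub>M coins w) ?F"
    unfolding integrable_iff_bounded
  proof
    show mF: "?F \<in> borel_measurable (?S \<Otimes>\<^sub>M coins w)" using measurable_compose[OF mm mu] .
    let ?I = "\<integral>\<^sup>+q. ennreal (norm (?F q)) \<partial>(?S \<Otimes>\<^sub>M coins w)"
    \<comment> \<open>\<open>?I\<close> is the integral of \<open>\<bar>u\<bar>\<close> over the box
      divided by the weight of the cylinder, which is positive because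
      \<open>0 < w < 1\<close>.\<close>
    have "emeasure (coins w) (cylinder n a) * ?I =
        (\<integral>\<^sup>+q\<in>{?l..?h} \<times> cylinder n a. ennreal (norm (u (glue q))) \<partial>strip_measure w)"
      using mF mu by (subst nn_integral_strip[OF bd(1,4)]) (auto simp: coins.nn_integral_fst[symmetric])
    also have "\<dots> \<le> (\<integral>\<^sup>+q. ennreal (norm (u (glue q))) \<partial>strip_measure w)"
      by (rule nn_integral_mono) (auto simp: indicator_def)
    also have "\<dots> < \<infinity>" using integrable_u_glue by (simp add: integrable_iff_bounded)
    finally have "emeasure (coins w) (cylinder n a) * ?I < \<infinity>" .
    moreover have "emeasure (coins w) (cylinder n a) \<noteq> 0"
      using w coin_weight_pos[OF w, of n a] by (subst emeasure_cylinder) auto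
    ultimately show "?I < \<infinity>" by (auto simp: less_top[symmetric] ennreal_mult_eq_top_iff)
  qed
  show "(\<lambda>q. \<rho> (glue (fst q, mix {..<n} a (snd q)))) \<in> borel_measurable (?S \<Otimes>\<^sub>M coins w)"
    using measurable_compose[OF mm measurable_rho_glue] .
  show "ennreal \<bar>?F (s, \<alpha>) - ?F (t, \<alpha>)\<bar> \<le> (\<integral>\<^sup>+x\<in>{s..t}. \<rho> (glue (fst (x, \<alpha>), mix {..<n} a (snd (x, \<alpha>)))) \<partial>lborel)"
    if "?l \<le> s" "s \<le> t" "t \<le> ?h" for s t \<alpha>
    using upper_gradient_vertical[OF ug, of s t "mix {..<n} a \<alpha>"] that bd by simp
  show "?F (z, \<alpha>) = ?F (z, \<beta>)" if "n \<le> m" "z \<in> wormhole m" "z \<in> {?l..?h}" "\<And>i. i \<noteq> m \<Longrightarrow> \<alpha> i = \<beta> i" for m z \<alpha> \<beta>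
    using glue_jump[OF that(2), of "mix {..<n} a \<alpha>" "mix {..<n} a \<beta>"] that(4) by (simp add: mix_def)
  show "?F (t, \<alpha>) = ?F (t, \<beta>)" if "\<And>i. n \<le> i \<Longrightarrow> \<alpha> i = \<beta> i" for t \<alpha> \<beta>
  proof -
    have "mix {..<n} a \<alpha> = mix {..<n} a \<beta>" using that by (auto simp: mix_def)
    then show ?thesis by simp
  qed
qed

text \<open>This is \<open>deviation_le\<close> multiplied by the weight of the cylinder. As the
  weight occurs on both sides, neither \<open>w\<close> nor the prefix enters the constant.\<close>

lemma cylinder_deviation_le:
  assumes s: "s \<in> {0..1}" and z: "z \<in> {box_lo n s..box_hi n s}"
  shows "(\<integral>\<^sup>+\<beta>. (\<integral>\<^sup>+q\<in>{box_lo n s..box_hi n s} \<times> cylinder n a.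
      ennreal \<bar>u (glue q) - u (glue (z, mix {..<n} a \<beta>))\<bar> \<partial>strip_measure w) \<partial>coins w) \<le>
    ennreal (10 / 2 ^ n) * (\<integral>\<^sup>+q\<in>{box_lo n s..box_hi n s} \<times> cylinder n a. \<rho> (glue q) \<partial>strip_measure w)"
proof -
  note bd = box_bounds[OF s, of n]
  let ?l = "box_lo n s" and ?h = "box_hi n s"
  let ?S = "restrict_space lborel {?l..?h}"
  let ?W = "emeasure (coins w) (cylinder n a)"
  interpret laakso_box w ?l ?h n "\<lambda>q. u (glue (fst q, mix {..<n} a (snd q)))"
    "\<lambda>q. \<rho> (glue (fst q, mix {..<n} a (snd q)))" ?S
    by (rule laakso_box_glue[OF s])
  have mu[measurable]: "(\<lambda>q. u (glue q)) \<in> borel_measurable (strip_measure w)" using integrable_u_glue by auto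
  have [measurable]: "z \<in> space ?S" using z by (simp add: space_restrict_space)
  have "(\<integral>\<^sup>+\<beta>. (\<integral>\<^sup>+q\<in>{?l..?h} \<times> cylinder n a. ennreal \<bar>u (glue q) - u (glue (z, mix {..<n} a \<beta>))\<bar> \<partial>strip_measure w) \<partial>coins w) =
      (\<integral>\<^sup>+\<beta>. ?W * (\<integral>\<^sup>+t. (\<integral>\<^sup>+\<alpha>. ennreal \<bar>u (glue (t, mix {..<n} a \<alpha>)) - u (glue (z, mix {..<n} a \<beta>))\<bar> \<partial>coins w) \<partial>?S) \<partial>coins w)"
    by (intro nn_integral_cong nn_integral_strip bd) simp
  also have "\<dots> = ?W * (\<integral>\<^sup>+\<beta>. (\<integral>\<^sup>+t. (\<integral>\<^sup>+\<alpha>. ennreal \<bar>u (glue (t, mix {..<n} a \<alpha>)) - u (glue (z, mix {..<n} a \<beta>))\<bar> \<partial>coins w) \<partial>?S) \<partial>coins w)"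
  proof (rule nn_integral_cmult)
    have [measurable]: "(\<lambda>q. u (glue (fst q, mix {..<n} a (snd q)))) \<in> borel_measurable (?S \<Otimes>\<^sub>M coins w)"
      by (rule measurable_F)
    have [measurable]: "(\<lambda>\<beta>. u (glue (z, mix {..<n} a \<beta>))) \<in> borel_measurable (coins w)"
      using measurable_compose[OF measurable_Pair1'[of z ?S "coins w"] measurable_F] z by (simp add: space_restrict_space)
    have [measurable]: "(\<lambda>x. u (glue (snd (fst x), mix {..<n} a (snd x)))) \<in> borel_measurable ((coins w \<Otimes>\<^sub>M ?S) \<Otimes>\<^sub>M coins w)"
      using measurable_compose[of "\<lambda>x. (snd (fst x), snd x)" "(coins w \<Otimes>\<^sub>M ?S) \<Otimes>\<^sub>M coins w" "?S \<Otimes>\<^sub>M coins w", OF _ measurable_F]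
      by simp
    show "(\<lambda>\<beta>. \<integral>\<^sup>+t. (\<integral>\<^sup>+\<alpha>. ennreal \<bar>u (glue (t, mix {..<n} a \<alpha>)) - u (glue (z, mix {..<n} a \<beta>))\<bar> \<partial>coins w) \<partial>?S) \<in> borel_measurable (coins w)"
      by (intro S.borel_measurable_nn_integral coins.borel_measurable_nn_integral) (simp add: case_prod_beta')
  qed
  also have "\<dots> \<le> ?W * (ennreal (10 / 2 ^ n) * energy)"
    using deviation_le[OF z] by (intro mult_left_mono) simp_all
  also have "\<dots> = ennreal (10 / 2 ^ n) * (?W * energy)" by (simp add: mult.left_commute)
  also have "?W * energy = (\<integral>\<^sup>+q\<in>{?l..?h} \<times> cylinder n a. \<rho> (glue q) \<partial>strip_measure w)"
    unfolding energy_def by (subst nn_integral_strip[OF bd(1,4) measurable_rho_glue]) simp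
  finally show ?thesis .
qed

end

text \<open>At this height both cylinders pass through the same points for every common tail, so a
  reference value taken there serves both. If there is only one cylinder, the height
  \<open>s\<close> will do.\<close>

lemma box_neighbour_junction:
  assumes s: "s \<in> {0..1}" and b: "box_neighbour n s a b"
  obtains z where "z \<in> {box_lo n s..box_hi n s}"
    "\<forall>\<beta>. glue (z, mix {..<n} a \<beta>) = glue (z, mix {..<n} b \<beta>)"
proof (cases "b = a")
  case True
  show ?thesis by (rule that[of s]) (use box_bounds[OF s, of n] True in auto)
next
  case False
  then obtain m z where m: "m < n" "b = a(m := \<not> a m)" "z \<in> wormhole m" "z \<in> {box_lo n s..box_hi n s}"
    using b unfolding box_neighbour_def by blast
  show ?thesis
  proof (rule that[OF m(4)], rule allI)
    fix \<beta>
    show "glue (z, mix {..<n} a \<beta>) = glue (z, mix {..<n} b \<beta>)"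
      by (rule glue_jump[OF m(3)]) (simp add: mix_def m(2))
  qed
qed

text \<open>For every tail \<beta> the value at the junction is an admissible constant in
  \<open>mean_deviation_le\<close>. The left side does not depend on \<beta>, so averaging over
  \<beta> costs nothing and brings in \<open>cylinder_deviation_le\<close> for each of the two
  cylinders.\<close>

lemma ball_deviation_le:
  assumes w: "w \<in> {0<..<1}" and u: "integrable (laakso_measure w) u"
    and ug: "upper_gradient laakso laakso_dist u \<rho>" and x: "x \<in> laakso" and r: "r > 0"
    and pos: "0 < measure (laakso_measure w) (laakso.mball x r)"
  shows "ennreal (\<integral>y\<in>laakso.mball x r. \<bar>u y - (\<integral>y\<in>laakso.mball x r. u y \<partial>laakso_measure w) /
      measure (laakso_measure w) (laakso.mball x r)\<bar> \<partial>laakso_measure w)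
    \<le> ennreal (160 * r) * (\<integral>\<^sup>+y\<in>laakso.mball x (16 * r). \<rho> y \<partial>laakso_measure w)" (is "ennreal ?X \<le> _")
proof -
  interpret \<mu>: prob_space "laakso_measure w" by (rule prob_space_laakso_measure)
  interpret N: prob_space "strip_measure w" by (rule prob_space_strip_measure)
  obtain s a where p: "(s, a) \<in> strips" "x = glue (s, a)" using x by (rule laakso_cases)
  have s: "s \<in> {0..1}" using p by (simp add: strips_def)
  obtain n where n: "scale n r" using scale_exists r by blast
  obtain b where b: "box_neighbour n s a b" "{q \<in> strips. walk_dist (s, a) q < r} \<subseteq> strip_box n s a b"
    by (rule ball_subset_strip_box[OF p(1) n])
  obtain z where z: "z \<in> {box_lo n s..box_hi n s}"
    and junction: "\<forall>\<beta>. glue (z, mix {..<n} a \<beta>) = glue (z, mix {..<n} b \<beta>)"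
    by (rule box_neighbour_junction[OF s b(1)])
  note bd = box_bounds[OF s, of n]
  let ?R = "\<lambda>c. {box_lo n s..box_hi n s} \<times> cylinder n c"
  let ?c = "\<lambda>\<beta>. u (glue (z, mix {..<n} a \<beta>))"
  let ?A = "\<lambda>c \<beta>. \<integral>\<^sup>+q\<in>?R c. ennreal \<bar>u (glue q) - ?c \<beta>\<bar> \<partial>strip_measure w"
  let ?E = "\<integral>\<^sup>+y\<in>laakso.mball x (16 * r). \<rho> y \<partial>laakso_measure w"
  have ball_sets[measurable]: "laakso.mball x r' \<in> sets laakso_borel" for r'
    by (intro open_in_sets_laakso_borel laakso.openin_mball)
  have mu [measurable]: "u \<in> borel_measurable laakso_borel"
    using borel_measurable_integrable[OF u] by (simp cong: measurable_cong_sets add: sets_laakso_measure)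
  have m\<rho> [measurable]: "\<rho> \<in> borel_measurable laakso_borel" using ug by (simp add: upper_gradient_def laakso_borel_def)
  have R [measurable]: "?R c \<in> sets (strip_measure w)" for c
    using bd by (intro strip_emeasure_Times) auto
  have mc: "?c \<in> borel_measurable (coins w)"
  proof -
    have m: "(\<lambda>q. u (glue q)) \<in> borel_measurable (unit_lebesgue \<Otimes>\<^sub>M coins w)"
      using measurable_compose[OF measurable_glue mu, of w] by (simp add: strip_measure_def)
    have "z \<in> space unit_lebesgue" using z bd by (simp add: space_restrict_space)
    from measurable_compose[OF measurable_mix2 measurable_compose[OF measurable_Pair1'[OF this] m]] show ?thesis .
  qed
  have mA: "?A c \<in> borel_measurable (coins w)" for c
  proof (rule N.borel_measurable_nn_integral)
    have [measurable]: "(\<lambda>x. ?c (fst x)) \<in> borel_measurable (coins w \<Otimes>\<^sub>M strip_measure w)"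
      using measurable_compose[OF measurable_fst mc] .
    have [measurable]: "(\<lambda>x. u (glue (snd x))) \<in> borel_measurable (coins w \<Otimes>\<^sub>M strip_measure w)"
      using measurable_compose[OF measurable_snd measurable_compose[OF measurable_glue mu]] .
    show "(\<lambda>(\<beta>, q). ennreal \<bar>u (glue q) - ?c \<beta>\<bar> * indicator (?R c) q) \<in> borel_measurable (coins w \<Otimes>\<^sub>M strip_measure w)"
      unfolding case_prod_beta' by measurable
  qed
  have dev: "ennreal ?X \<le> 2 * (?A a \<beta> + ?A b \<beta>)" for \<beta>
  proof -
    have "ennreal ?X \<le> 2 * (\<integral>\<^sup>+y\<in>laakso.mball x r. ennreal \<bar>u y - ?c \<beta>\<bar> \<partial>laakso_measure w)"
    proof (rule mean_deviation_le[OF \<mu>.finite_measure_axioms _ pos])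
      show B: "laakso.mball x r \<in> sets (laakso_measure w)" by (simp add: sets_laakso_measure ball_sets)
      show "set_integrable (laakso_measure w) (laakso.mball x r) u"
        unfolding set_integrable_def by (rule integrable_mult_indicator[OF B u])
    qed
    also have "(\<integral>\<^sup>+y\<in>laakso.mball x r. ennreal \<bar>u y - ?c \<beta>\<bar> \<partial>laakso_measure w) =
        (\<integral>\<^sup>+q. ennreal \<bar>u (glue q) - ?c \<beta>\<bar> * indicator (laakso.mball x r) (glue q) \<partial>strip_measure w)"
      unfolding laakso_measure_def by (rule nn_integral_distr) measurable
    also have "\<dots> \<le> (\<integral>\<^sup>+q. ennreal \<bar>u (glue q) - ?c \<beta>\<bar> * indicator (?R a) q +
        ennreal \<bar>u (glue q) - ?c \<beta>\<bar> * indicator (?R b) q \<partial>strip_measure w)"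
    proof (rule nn_integral_mono)
      fix q assume "q \<in> space (strip_measure w)"
      then have q: "q \<in> strips" by simp
      have "q \<in> ?R a \<or> q \<in> ?R b" if "glue q \<in> laakso.mball x r"
      proof -
        have "walk_dist (s, a) q < r" using glue_in_mball[OF p(1) q] that p(2) by simp
        then have "q \<in> strip_box n s a b" using b(2) q by blast
        then show ?thesis by (auto simp: strip_box_def)
      qed
      then show "ennreal \<bar>u (glue q) - ?c \<beta>\<bar> * indicator (laakso.mball x r) (glue q) \<le>
          ennreal \<bar>u (glue q) - ?c \<beta>\<bar> * indicator (?R a) q + ennreal \<bar>u (glue q) - ?c \<beta>\<bar> * indicator (?R b) q"
        by (cases "glue q \<in> laakso.mball x r") (fastforce simp: indicator_def)+
    qed
    also have "\<dots> = ?A a \<beta> + ?A b \<beta>" by (rule nn_integral_add) measurable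
    finally show ?thesis by (simp add: mult_left_mono)
  qed
  have E: "(\<integral>\<^sup>+q\<in>?R c. \<rho> (glue q) \<partial>strip_measure w) \<le> ?E" if c: "c = a \<or> c = b" for c
  proof -
    have "?E = (\<integral>\<^sup>+q. \<rho> (glue q) * indicator (laakso.mball x (16 * r)) (glue q) \<partial>strip_measure w)"
      unfolding laakso_measure_def by (rule nn_integral_distr) measurable
    moreover have "(\<integral>\<^sup>+q\<in>?R c. \<rho> (glue q) \<partial>strip_measure w) \<le> \<dots>"
    proof (rule nn_integral_mono)
      fix q assume "q \<in> space (strip_measure w)"
      then have q: "q \<in> strips" by simp
      have "glue q \<in> laakso.mball x (16 * r)" if "q \<in> ?R c"
      proof -
        have "q \<in> strip_box n s a b" using that c by (auto simp: strip_box_def)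
        then show ?thesis using strip_box_subset_ball[OF p(1) n b(1)] glue_in_mball[OF p(1) q] p(2) by simp
      qed
      then show "\<rho> (glue q) * indicator (?R c) q \<le> \<rho> (glue q) * indicator (laakso.mball x (16 * r)) (glue q)"
        by (cases "q \<in> ?R c") auto
    qed
    ultimately show ?thesis by simp
  qed
  have "ennreal ?X = (\<integral>\<^sup>+\<beta>. ennreal ?X \<partial>coins w)"
    by (simp add: coins.emeasure_space_1[simplified])
  also have "\<dots> \<le> (\<integral>\<^sup>+\<beta>. 2 * (?A a \<beta> + ?A b \<beta>) \<partial>coins w)"
    by (intro nn_integral_mono dev)
  also have "\<dots> = 2 * ((\<integral>\<^sup>+\<beta>. ?A a \<beta> \<partial>coins w) + (\<integral>\<^sup>+\<beta>. ?A b \<beta> \<partial>coins w))"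
    using mA[of a] mA[of b] by (subst nn_integral_cmult) (auto simp: nn_integral_add)
  also have "\<dots> \<le> 2 * (ennreal (10 / 2 ^ n) * ?E + ennreal (10 / 2 ^ n) * ?E)"
  proof (intro mult_left_mono add_mono)
    show "(\<integral>\<^sup>+\<beta>. ?A a \<beta> \<partial>coins w) \<le> ennreal (10 / 2 ^ n) * ?E"
      by (rule order_trans[OF cylinder_deviation_le[OF w u ug s z]]) (intro mult_left_mono E, auto)
    show "(\<integral>\<^sup>+\<beta>. ?A b \<beta> \<partial>coins w) \<le> ennreal (10 / 2 ^ n) * ?E"
      \<comment> \<open>The reference is rewritten as a value on the cylinder of \<open>b\<close>,
        to which the estimate then applies.\<close>
      unfolding junction[rule_format]
      by (rule order_trans[OF cylinder_deviation_le[OF w u ug s z]]) (intro mult_left_mono E, auto)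
  qed simp
  \<comment> \<open>Two cylinders at \<open>10 / 2^n\<close> each, doubled by
    \<open>mean_deviation_le\<close>; then \<open>1 / 2^n < 4 * r\<close> gives 160.\<close>
  also have "\<dots> = ennreal (40 / 2 ^ n) * ?E"
  proof -
    have "2 * (ennreal (10 / 2 ^ n) + ennreal (10 / 2 ^ n)) = ennreal (40 / 2 ^ n)"
      by (simp add: ennreal_numeral[symmetric] del: ennreal_numeral flip: ennreal_plus ennreal_mult)
    then show ?thesis by (metis (no_types) distrib_right mult.assoc)
  qed
  also have "\<dots> \<le> ennreal (160 * r) * ?E"
    using n by (intro mult_right_mono ennreal_leI) (auto simp: scale_def field_simps)
  finally show ?thesis .
qed

text \<open>\<open>ball_deviation_le\<close> is divided by the measure of the small ball; passing to
  the average over the ball of radius \<open>16 * r\<close> takes four doublings, hence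
  \<open>D^4\<close>.\<close>

lemma poincare_laakso:
  assumes w: "w \<in> {0<..<1}"
  shows "poincare_11 laakso laakso_dist (laakso_measure w)"
proof -
  let ?\<mu> = "laakso_measure w"
  interpret \<mu>: prob_space ?\<mu> by (rule prob_space_laakso_measure)
  obtain D where D: "D \<ge> 1" and dbl: "\<And>x r. x \<in> laakso \<Longrightarrow> r > 0 \<Longrightarrow>
      0 < emeasure ?\<mu> (laakso.mball x (2 * r)) \<and>
      emeasure ?\<mu> (laakso.mball x (2 * r)) \<le> ennreal D * emeasure ?\<mu> (laakso.mball x r)"
    using doubling_laakso[OF w] unfolding doubling_measure_def by blast
  have pos: "0 < measure ?\<mu> (laakso.mball x r)" if "x \<in> laakso" "r > 0" for x r
    using dbl[of x "r / 2"] that by (simp add: \<mu>.emeasure_eq_measure)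
  have dbl1: "measure ?\<mu> (laakso.mball x (2 * r)) \<le> D * measure ?\<mu> (laakso.mball x r)" if "x \<in> laakso" "r > 0" for x r
    using dbl[of x r] that D by (simp add: \<mu>.emeasure_eq_measure flip: ennreal_mult')
  have dbl4: "measure ?\<mu> (laakso.mball x (16 * r)) \<le> D ^ 4 * measure ?\<mu> (laakso.mball x r)" if "x \<in> laakso" "r > 0" for x r
  proof -
    have "measure ?\<mu> (laakso.mball x (16 * r)) \<le> D * measure ?\<mu> (laakso.mball x (8 * r))"
      using dbl1[of x "8 * r"] that by simp
    also have "\<dots> \<le> D * (D * measure ?\<mu> (laakso.mball x (4 * r)))"
      using dbl1[of x "4 * r"] that D by (intro mult_left_mono) auto
    also have "\<dots> \<le> D * (D * (D * measure ?\<mu> (laakso.mball x (2 * r))))"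
      using dbl1[of x "2 * r"] that D by (intro mult_left_mono) auto
    also have "\<dots> \<le> D * (D * (D * (D * measure ?\<mu> (laakso.mball x r))))"
      using dbl1[of x r] that D by (intro mult_left_mono) auto
    finally show ?thesis by (simp add: power4_eq_xxxx mult.assoc)
  qed
  have main: "ennreal ((\<integral>y\<in>laakso.mball x r. \<bar>u y - (\<integral>y\<in>laakso.mball x r. u y \<partial>?\<mu>) / measure ?\<mu> (laakso.mball x r)\<bar> \<partial>?\<mu>) /
        measure ?\<mu> (laakso.mball x r))
      \<le> ennreal (160 * D ^ 4 * r / measure ?\<mu> (laakso.mball x (16 * r))) * (\<integral>\<^sup>+y\<in>laakso.mball x (16 * r). \<rho> y \<partial>?\<mu>)"
    if int: "\<forall>y\<in>laakso. \<forall>s>0. set_integrable ?\<mu> (laakso.mball y s) u"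
      and ug: "upper_gradient laakso laakso_dist u \<rho>" and x: "x \<in> laakso" and r: "r > 0" for u \<rho> x r
  proof -
    have "integrable ?\<mu> u"
    proof -
      \<comment> \<open>Any two points have distance at most 2, as the range \<open>(0, 1)\<close>
        is always feasible, so integrability on balls is global.\<close>
      have "y \<in> laakso.mball x 3" if y: "y \<in> laakso" for y
      proof -
        obtain s a where p: "(s, a) \<in> strips" "x = glue (s, a)" using x by (rule laakso_cases)
        obtain t b where q: "(t, b) \<in> strips" "y = glue (t, b)" using y by (rule laakso_cases)
        have "walk_dist (s, a) (t, b) \<le> 2"
          using walk_dist_le[OF p(1) q(1) feasible_nonempty[OF p(1) q(1)]] by simp
        then show ?thesis using glue_in_mball[OF p(1) q(1), of 3] p q by simp
      qed
      then have "integrable ?\<mu> u \<longleftrightarrow> set_integrable ?\<mu> (laakso.mball x 3) u"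
        unfolding set_integrable_def by (intro Bochner_Integration.integrable_cong) auto
      then show ?thesis using int x by simp
    qed
    let ?X = "\<integral>y\<in>laakso.mball x r. \<bar>u y - (\<integral>y\<in>laakso.mball x r. u y \<partial>?\<mu>) / measure ?\<mu> (laakso.mball x r)\<bar> \<partial>?\<mu>"
    let ?m = "measure ?\<mu> (laakso.mball x r)" and ?M = "measure ?\<mu> (laakso.mball x (16 * r))"
    have m: "0 < ?m" "0 < ?M" using pos[OF x] r by auto
    have "?X \<ge> 0" unfolding set_lebesgue_integral_def by (rule Bochner_Integration.integral_nonneg) auto
    then have "ennreal (?X / ?m) = ennreal (1 / ?m) * ennreal ?X"
      using m by (simp flip: ennreal_mult)
    also have "\<dots> \<le> ennreal (1 / ?m) * (ennreal (160 * r) * (\<integral>\<^sup>+y\<in>laakso.mball x (16 * r). \<rho> y \<partial>?\<mu>))"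
      by (intro mult_left_mono ball_deviation_le[OF w \<open>integrable ?\<mu> u\<close> ug x r m(1)]) simp
    also have "\<dots> = ennreal (160 * r * (1 / ?m)) * (\<integral>\<^sup>+y\<in>laakso.mball x (16 * r). \<rho> y \<partial>?\<mu>)"
      using r m by (subst ennreal_mult) (auto simp: mult_ac)
    also have "\<dots> \<le> ennreal (160 * D ^ 4 * r / ?M) * (\<integral>\<^sup>+y\<in>laakso.mball x (16 * r). \<rho> y \<partial>?\<mu>)"
    proof (intro mult_right_mono ennreal_leI)
      have "1 / ?m \<le> D ^ 4 / ?M" using dbl4[OF x r] m by (simp add: field_simps)
      then have "160 * r * (1 / ?m) \<le> 160 * r * (D ^ 4 / ?M)" using r by (intro mult_left_mono) auto
      then show "160 * r * (1 / ?m) \<le> 160 * D ^ 4 * r / ?M" by (simp add: mult_ac)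
    qed simp
    finally show ?thesis .
  qed
  have "160 * D ^ 4 > 0" using D by simp
  then show ?thesis unfolding poincare_11_def Let_def
    using main by (intro exI[of _ "160 * D ^ 4"] conjI exI[of _ "16::real"] allI impI) auto
qed

subsection \<open>Mutual singularity\<close>

lemma indep_vars_coins: "coins.indep_vars w (\<lambda>_. count_space UNIV) (\<lambda>i \<alpha>. \<alpha> i) {..<k}"
proof (cases "k = 0")
  case True
  then show ?thesis by (simp add: coins.indep_vars_def coins.indep_sets_def)
next
  case False
  let ?B = "measure_pmf (bernoulli_pmf w)"
  have "coins.indep_vars w (\<lambda>_. ?B) (\<lambda>i \<alpha>. \<alpha> i) {..<k}"
  proof (subst coins.indep_vars_iff_distr_eq_PiM')
    have "distr (coins w) (Pi\<^sub>M {..<k} (\<lambda>_. ?B)) (\<lambda>x. restrict x {..<k}) = Pi\<^sub>M {..<k} (\<lambda>_. ?B)"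
      unfolding coins_def by (rule coin.distr_PiM_restrict_finite) auto
    moreover have "distr (coins w) ?B (\<lambda>\<alpha>. \<alpha> i) = ?B" for i
      unfolding coins_def by (rule coin.PiM_component) simp
    ultimately show "distr (coins w) (Pi\<^sub>M {..<k} (\<lambda>_. ?B)) (\<lambda>x. \<lambda>i\<in>{..<k}. x i) =
        (\<Pi>\<^sub>M i\<in>{..<k}. distr (coins w) ?B (\<lambda>\<alpha>. \<alpha> i))" by simp
  qed (use False measurable_coins_component in auto)
  then show ?thesis
    unfolding coins.indep_vars_def by simp
qed

lemma expectation_coin:
  assumes "w \<in> {0..1}"
  shows "coins.expectation w (\<lambda>\<alpha>. of_bool (\<alpha> i)) = w"
proof -
  have d: "distr (coins w) (measure_pmf (bernoulli_pmf w)) (\<lambda>\<alpha>. \<alpha> i) = measure_pmf (bernoulli_pmf w)"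
    unfolding coins_def by (rule coin.PiM_component) simp
  have "coins.expectation w (\<lambda>\<alpha>. of_bool (\<alpha> i) :: real) = (\<integral>b. of_bool b \<partial>distr (coins w) (measure_pmf (bernoulli_pmf w)) (\<lambda>\<alpha>. \<alpha> i))"
    by (rule integral_distr[where f = "of_bool :: bool \<Rightarrow> real" and g = "\<lambda>\<alpha>. \<alpha> i", symmetric])
      (use measurable_coins_component in auto)
  also have "\<dots> = w" unfolding d using assms by simp
  finally show ?thesis .
qed

text \<open>Hoeffding's bound is written as a \<open>k\<close>-th power so that the bounds form a
  geometric series, summable for Borel-Cantelli. The case \<open>k = 0\<close>, where Hoeffding's
  exponent divides by 0, is treated apart.\<close>

lemma coins_Hoeffding:
  assumes "w \<in> {0..1}"
  shows "\<theta> \<ge> w \<Longrightarrow> coins.prob w {\<alpha>. \<theta> * real k \<le> (\<Sum>i<k. of_bool (\<alpha> i))} \<le> exp (- 2 * (\<theta> - w)\<^sup>2) ^ k"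
    and "\<theta> \<le> w \<Longrightarrow> coins.prob w {\<alpha>. (\<Sum>i<k. of_bool (\<alpha> i)) \<le> \<theta> * real k} \<le> exp (- 2 * (\<theta> - w)\<^sup>2) ^ k"
proof -
  let ?X = "\<lambda>i \<alpha>. of_bool (\<alpha> i) :: real"
  interpret H: Hoeffding_ineq "coins w" "{..<k}" ?X "\<lambda>_. 0" "\<lambda>_. 1" "\<Sum>i<k. coins.expectation w (?X i)"
  proof unfold_locales
    show "coins.indep_vars w (\<lambda>_. borel) ?X {..<k}"
      by (rule coins.indep_vars_compose2[OF indep_vars_coins]) simp
  qed auto
  have e: "(\<Sum>i<k. coins.expectation w (?X i)) = real k * w" by (simp add: expectation_coin[OF assms])
  have pw: "exp (- 2 * (\<theta> - w)\<^sup>2) ^ k = exp (- 2 * (real k * (\<theta> - w))\<^sup>2 / real k)"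
  proof (cases "k = 0")
    case False
    have "exp (- 2 * (\<theta> - w)\<^sup>2) ^ k = exp (real k * (- 2 * (\<theta> - w)\<^sup>2))" by (rule exp_of_nat_mult[symmetric])
    also have "real k * (- 2 * (\<theta> - w)\<^sup>2) = - 2 * (real k * (\<theta> - w))\<^sup>2 / real k"
      using False by (simp add: power_mult_distrib power2_eq_square)
    finally show ?thesis .
  qed simp
  show "coins.prob w {\<alpha>. \<theta> * real k \<le> (\<Sum>i<k. ?X i \<alpha>)} \<le> exp (- 2 * (\<theta> - w)\<^sup>2) ^ k" if "\<theta> \<ge> w"
  proof (cases "k = 0")
    case False
    then show ?thesis
      using H.Hoeffding_ineq_ge[of "real k * (\<theta> - w)"] that unfolding e pw by (simp add: algebra_simps)
  qed simp
  show "coins.prob w {\<alpha>. (\<Sum>i<k. ?X i \<alpha>) \<le> \<theta> * real k} \<le> exp (- 2 * (\<theta> - w)\<^sup>2) ^ k" if "\<theta> \<le> w"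
  proof (cases "k = 0")
    case False
    have sq: "(real k * (\<theta> - w))\<^sup>2 = (real k * (w - \<theta>))\<^sup>2" by (simp add: power2_commute power_mult_distrib)
    show ?thesis
      using H.Hoeffding_ineq_le[of "real k * (w - \<theta>)"] that False unfolding e pw sq by (simp add: algebra_simps)
  qed simp
qed

text \<open>Coordinate \<open>i\<close> is ambiguous on the quotient at wormholes of level
  \<open>i\<close>. Removing these heights leaves an open, hence Borel, set that records the
  coordinate almost everywhere.\<close>

definition branch_set :: "nat \<Rightarrow> real set" where
  "branch_set i = glue ` {(t, a). (t, a) \<in> strips \<and> t \<notin> wormhole i \<and> a i}"

text \<open>Changing coordinate \<open>i\<close> requires reaching a wormhole of level
  \<open>i\<close>, and a finite level keeps a positive distance from a height outside it.\<close>

lemma branch_locally_constant: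
  assumes p: "(t, a) \<in> strips" "t \<notin> wormhole i"
  obtains \<delta> where "\<delta> > 0"
    "\<forall>q\<in>strips. walk_dist (t, a) q < \<delta> \<longrightarrow> fst q \<notin> wormhole i \<and> snd q i = a i"
proof -
  obtain \<delta> where d: "\<delta> > 0" "\<And>x. x \<in> wormhole i \<Longrightarrow> x \<noteq> t \<Longrightarrow> \<delta> \<le> dist t x"
    using finite_set_avoid[OF finite_wormhole] by metis
  have far: "x \<notin> wormhole i" if "\<bar>x - t\<bar> < \<delta>" for x
    using d(2)[of x] p(2) that by (auto simp: dist_real_def abs_minus_commute)
  have "fst q \<notin> wormhole i \<and> snd q i = a i" if "q \<in> strips" "walk_dist (t, a) q < \<delta>" for q
    using walk_dist_less_imp[OF p(1) that] far by fastforce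
  then show ?thesis using d(1) that by blast
qed

lemma glue_in_branch_set:
  assumes "(t, a) \<in> strips"
  shows "glue (t, a) \<in> branch_set i \<longleftrightarrow> t \<notin> wormhole i \<and> a i"
proof
  assume "glue (t, a) \<in> branch_set i"
  then obtain t' a' where q: "(t', a') \<in> strips" "t' \<notin> wormhole i" "a' i" "glue (t, a) = glue (t', a')"
    by (auto simp: branch_set_def)
  obtain \<delta> where "\<delta> > 0" and \<delta>: "\<forall>q\<in>strips. walk_dist (t', a') q < \<delta> \<longrightarrow> fst q \<notin> wormhole i \<and> snd q i = a' i"
    by (rule branch_locally_constant[OF q(1,2)])
  moreover have "walk_dist (t', a') (t, a) = 0" using glue_eq_iff[OF q(1) assms] q(4) by simp
  ultimately show "t \<notin> wormhole i \<and> a i" using assms q(3) by (metis fst_conv snd_conv)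
next
  assume "t \<notin> wormhole i \<and> a i"
  then show "glue (t, a) \<in> branch_set i" using assms by (auto simp: branch_set_def)
qed

lemma openin_branch_set: "openin laakso.mtopology (branch_set i)"
  unfolding laakso.openin_mtopology
proof (intro conjI allI impI)
  show "branch_set i \<subseteq> laakso" by (auto simp: branch_set_def laakso_def)
  fix x assume "x \<in> branch_set i"
  then obtain t a where p: "(t, a) \<in> strips" "t \<notin> wormhole i" "a i" "x = glue (t, a)"
    by (auto simp: branch_set_def)
  obtain \<delta> where "\<delta> > 0" and \<delta>: "\<forall>q\<in>strips. walk_dist (t, a) q < \<delta> \<longrightarrow> fst q \<notin> wormhole i \<and> snd q i = a i"
    by (rule branch_locally_constant[OF p(1,2)])
  have "y \<in> branch_set i" if y: "y \<in> laakso.mball x \<delta>" for y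
  proof -
    have "y \<in> laakso" using y by simp
    then obtain t' a' where q: "(t', a') \<in> strips" "y = glue (t', a')" by (rule laakso_cases)
    then have "walk_dist (t, a) (t', a') < \<delta>" using glue_in_mball[OF p(1) q(1)] y p(4) by simp
    then have "t' \<notin> wormhole i \<and> a' i" using \<delta> q(1) p(3) by (metis fst_conv snd_conv)
    then show ?thesis using glue_in_branch_set[OF q(1)] q(2) by simp
  qed
  then show "\<exists>r>0. laakso.mball x r \<subseteq> branch_set i" using \<open>\<delta> > 0\<close> by blast
qed

lemma AE_not_wormhole: "AE q in strip_measure w. \<forall>i. fst q \<notin> wormhole i"
proof -
  have c: "countable (\<Union>i. wormhole i)" by (rule countable_UN) (simp_all add: countable_finite finite_wormhole)
  have "AE t in lborel. t \<notin> (\<Union>i. wormhole i)"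
    by (rule AE_not_in) (use c in \<open>simp add: countable_imp_null_set_lborel\<close>)
  then have "AE t in unit_lebesgue. t \<notin> (\<Union>i. wormhole i)"
    by (subst AE_restrict_space_iff) auto
  then have "AE t in unit_lebesgue. AE \<alpha> in coins w. fst (t, \<alpha>) \<notin> (\<Union>i. wormhole i)"
    by simp
  moreover have "{q \<in> space (unit_lebesgue \<Otimes>\<^sub>M coins w). fst q \<notin> (\<Union>i. wormhole i)} \<in> sets (unit_lebesgue \<Otimes>\<^sub>M coins w)"
  proof -
    have "(\<Union>i. wormhole i) \<in> sets lborel" by (rule sets.countable[OF _ c]) simp
    then have "{0..1} - (\<Union>i. wormhole i) \<in> sets lborel" by (intro sets.Diff) simp_all
    then have "{0..1} - (\<Union>i. wormhole i) \<in> sets unit_lebesgue"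
      by (subst sets_restrict_space_iff) simp_all
    then have "({0..1} - (\<Union>i. wormhole i)) \<times> UNIV \<in> sets (unit_lebesgue \<Otimes>\<^sub>M coins w)"
      using sets.top[of "coins w"] by (intro pair_measureI) auto
    moreover have "{q \<in> space (unit_lebesgue \<Otimes>\<^sub>M coins w). fst q \<notin> (\<Union>i. wormhole i)} = ({0..1} - (\<Union>i. wormhole i)) \<times> UNIV"
      by (auto simp: space_pair_measure space_restrict_space)
    ultimately show ?thesis by simp
  qed
  ultimately have "AE q in unit_lebesgue \<Otimes>\<^sub>M coins w. fst q \<notin> (\<Union>i. wormhole i)"
    by (intro strip.AE_pair_measure) auto
  then have "AE q in strip_measure w. fst q \<notin> (\<Union>i. wormhole i)" unfolding strip_measure_def .
  then show ?thesis by eventually_elim auto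
qed

definition frequency_set :: "real \<Rightarrow> nat \<Rightarrow> real set" where
  "frequency_set \<theta> k = {x \<in> laakso. \<theta> * real k \<le> (\<Sum>i<k. indicator (branch_set i) x)}"

lemma frequency_set_sets [measurable]: "frequency_set \<theta> k \<in> sets laakso_borel"
proof -
  have [measurable]: "branch_set i \<in> sets laakso_borel" for i
    by (rule open_in_sets_laakso_borel[OF openin_branch_set])
  have "{x \<in> space laakso_borel. \<theta> * real k \<le> (\<Sum>i<k. indicator (branch_set i) x)} \<in> sets laakso_borel"
    by measurable
  then show ?thesis by (simp add: frequency_set_def)
qed

lemma prob_coins_event:
  assumes "{\<alpha>. Q \<alpha>} \<in> sets (coins w)"
  shows "measure (strip_measure w) ({0..1} \<times> {\<alpha>. Q \<alpha>}) = coins.prob w {\<alpha>. Q \<alpha>}"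
    and "{0..1} \<times> {\<alpha>. Q \<alpha>} \<in> sets (strip_measure w)"
  using strip_emeasure_Times[of 0 1 "{\<alpha>. Q \<alpha>}" w] assms by (simp_all add: measure_def)

lemma sum_of_bool_measurable: "(\<lambda>\<alpha>. \<Sum>i<k. of_bool (\<alpha> i) :: real) \<in> borel_measurable (coins w)"
  by (intro borel_measurable_sum measurable_compose[OF measurable_coins_component]) simp

text \<open>Indicators of \<open>branch_set\<close> never exceed the true coordinates, so the
  inclusion of events needed here holds at every point.\<close>

lemma measure_frequency_set_le:
  assumes "w \<in> {0..1}" "w \<le> \<theta>"
  shows "measure (laakso_measure w) (frequency_set \<theta> k) \<le> exp (- 2 * (\<theta> - w)\<^sup>2) ^ k"
proof -
  interpret N: prob_space "strip_measure w" by (rule prob_space_strip_measure)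
  let ?Q = "{\<alpha>. \<theta> * real k \<le> (\<Sum>i<k. of_bool (\<alpha> i))}"
  have Q: "?Q \<in> sets (coins w)"
    using measurable_sets[OF sum_of_bool_measurable, of "{\<theta> * real k..}" k w] by (simp add: vimage_def)
  have "measure (laakso_measure w) (frequency_set \<theta> k) = measure (strip_measure w) (glue -` frequency_set \<theta> k \<inter> strips)"
    unfolding laakso_measure_def by (simp add: measure_distr)
  also have "\<dots> \<le> measure (strip_measure w) ({0..1} \<times> ?Q)"
  proof (rule N.finite_measure_mono[OF _ prob_coins_event(2)[OF Q]], safe)
    fix t a assume "glue (t, a) \<in> frequency_set \<theta> k" and p: "(t, a) \<in> strips"
    then have "\<theta> * real k \<le> (\<Sum>i<k. indicator (branch_set i) (glue (t, a)))" by (simp add: frequency_set_def)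
    also have "\<dots> \<le> (\<Sum>i<k. of_bool (a i))"
      using glue_in_branch_set[OF p] by (intro sum_mono) (auto simp: indicator_def)
    finally show "\<theta> * real k \<le> (\<Sum>i<k. of_bool (a i))" .
    show "t \<in> {0..1}" using p by (simp add: strips_def)
  qed
  also have "\<dots> \<le> exp (- 2 * (\<theta> - w)\<^sup>2) ^ k"
    using prob_coins_event(1)[OF Q] coins_Hoeffding(1)[OF assms] by simp
  finally show ?thesis .
qed

text \<open>Here the count of ones must not be underestimated, which can fail at wormhole heights;
  there are countably many of these, so the comparison holds almost everywhere.\<close>

lemma measure_frequency_set_compl_le:
  assumes "w \<in> {0..1}" "\<theta> \<le> w"
  shows "measure (laakso_measure w) (laakso - frequency_set \<theta> k) \<le> exp (- 2 * (\<theta> - w)\<^sup>2) ^ k"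
proof -
  interpret N: prob_space "strip_measure w" by (rule prob_space_strip_measure)
  let ?Q = "{\<alpha>. (\<Sum>i<k. of_bool (\<alpha> i)) \<le> \<theta> * real k}"
  have Q: "?Q \<in> sets (coins w)"
    using measurable_sets[OF sum_of_bool_measurable, of "{..\<theta> * real k}" k w] by (simp add: vimage_def)
  have L: "laakso - frequency_set \<theta> k \<in> sets laakso_borel"
    using sets.compl_sets[OF frequency_set_sets, of \<theta> k] by simp
  have "measure (laakso_measure w) (laakso - frequency_set \<theta> k) =
      measure (strip_measure w) (glue -` (laakso - frequency_set \<theta> k) \<inter> strips)"
    unfolding laakso_measure_def using L by (simp add: measure_distr)
  also have "\<dots> \<le> measure (strip_measure w) ({0..1} \<times> ?Q)"
  proof (rule N.finite_measure_mono_AE[OF _ prob_coins_event(2)[OF Q]])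
    show "AE q in strip_measure w. q \<in> glue -` (laakso - frequency_set \<theta> k) \<inter> strips \<longrightarrow> q \<in> {0..1} \<times> ?Q"
      using AE_not_wormhole
    proof eventually_elim
      case (elim q)
      show ?case
      proof
        assume q: "q \<in> glue -` (laakso - frequency_set \<theta> k) \<inter> strips"
        obtain t a where ta: "q = (t, a)" by (cases q)
        have p: "(t, a) \<in> strips" using q ta by simp
        have "(\<Sum>i<k. of_bool (a i)) = (\<Sum>i<k. indicator (branch_set i) (glue (t, a)) :: real)"
          using glue_in_branch_set[OF p] elim ta by (intro sum.cong) (auto simp: indicator_def)
        also have "\<dots> \<le> \<theta> * real k" using q ta by (auto simp: frequency_set_def)
        finally show "q \<in> {0..1} \<times> ?Q" using p by (simp add: ta strips_def)
      qed
    qed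
  qed
  also have "\<dots> \<le> exp (- 2 * (\<theta> - w)\<^sup>2) ^ k"
    using prob_coins_event(1)[OF Q] coins_Hoeffding(2)[OF assms] by simp
  finally show ?thesis .
qed

lemma mutually_singular_sym: "sets \<mu> = sets \<nu> \<Longrightarrow> mutually_singular \<mu> \<nu> \<Longrightarrow> mutually_singular \<nu> \<mu>"
proof -
  assume eq: "sets \<mu> = sets \<nu>" and "mutually_singular \<mu> \<nu>"
  then obtain A where A: "A \<in> sets \<mu>" "emeasure \<mu> (space \<mu> - A) = 0" "emeasure \<nu> A = 0"
    by (auto simp: mutually_singular_def)
  have sp: "space \<mu> = space \<nu>" by (rule sets_eq_imp_space_eq[OF eq])
  have "space \<nu> - (space \<nu> - A) = A" using sets.sets_into_space[OF A(1)] sp by auto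
  then show "mutually_singular \<nu> \<mu>"
    unfolding mutually_singular_def using A eq sp by (intro bexI[of _ "space \<nu> - A"]) auto
qed

text \<open>A threshold halfway between the two biases separates them: the exponential bounds and
  Borel-Cantelli, used once for each measure, take the place of the strong law of large
  numbers.\<close>

lemma mutually_singular_laakso_less:
  assumes "w \<in> {0<..<1}" "w' \<in> {0<..<1}" "w < w'"
  shows "mutually_singular (laakso_measure w) (laakso_measure w')"
proof -
  define \<theta> where "\<theta> = (w + w') / 2"
  have \<theta>: "w < \<theta>" "\<theta> < w'" using assms by (auto simp: \<theta>_def)
  have gs: "summable (\<lambda>k. exp (- 2 * (\<theta> - v)\<^sup>2) ^ k)" if "\<theta> \<noteq> v" for v
    using that by (intro summable_geometric) simp
  interpret \<mu>: prob_space "laakso_measure v" for v by (rule prob_space_laakso_measure)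
  have L: "laakso - frequency_set \<theta> k \<in> sets laakso_borel" for k
    using sets.compl_sets[OF frequency_set_sets, of \<theta> k] by simp
  define A where "A = limsup (frequency_set \<theta>)"
  have A: "A \<in> null_sets (laakso_measure w)"
    unfolding A_def
  proof (rule borel_cantelli_limsup1)
    show "summable (\<lambda>k. measure (laakso_measure w) (frequency_set \<theta> k))"
      by (rule summable_comparison_test'[OF gs[of w]])
        (use measure_frequency_set_le[of w \<theta>] assms \<theta> in auto)
  qed (auto simp: sets_laakso_measure less_top[symmetric])
  have "limsup (\<lambda>k. laakso - frequency_set \<theta> k) \<in> null_sets (laakso_measure w')"
  proof (rule borel_cantelli_limsup1)
    show "summable (\<lambda>k. measure (laakso_measure w') (laakso - frequency_set \<theta> k))"
      by (rule summable_comparison_test'[OF gs[of w']])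
        (use measure_frequency_set_compl_le[of w' \<theta>] assms \<theta> in auto)
  qed (auto simp: sets_laakso_measure L less_top[symmetric])
  \<comment> \<open>A point outside \<open>A\<close> lies in only finitely many frequency sets,
    hence in all but finitely many of their complements.\<close>
  moreover have "laakso - A \<subseteq> limsup (\<lambda>k. laakso - frequency_set \<theta> k)"
    unfolding A_def limsup_INF_SUP by (auto simp: atLeast_def) (metis nat_le_linear)
  moreover have "laakso - A \<in> sets (laakso_measure w')"
    using sets.compl_sets[of A "laakso_measure w"] A by (auto simp: null_sets_def sets_laakso_measure)
  ultimately have c: "laakso - A \<in> null_sets (laakso_measure w')" by (blast intro: null_sets_subset)
  have "A \<subseteq> laakso" using A sets.sets_into_space[of A "laakso_measure w"] by (auto simp: null_sets_def)
  then have "laakso - (laakso - A) = A" by auto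
  then show ?thesis
    unfolding mutually_singular_def using A c
    by (intro bexI[of _ "laakso - A"]) (auto simp: null_sets_def sets_laakso_measure)
qed

theorem theorem1p1:
  shows "\<exists>(M :: real set) (d :: real \<Rightarrow> real \<Rightarrow> real) (\<mu> :: real \<Rightarrow> real measure).
           Metric_space M d \<and> compact_space (Metric_space.mtopology M d) \<and> geodesic_space M d \<and>
           (\<forall>w\<in>{0<..<1}. borel_prob_measure M d (\<mu> w) \<and> doubling_measure M d (\<mu> w)) \<and>
           (\<forall>w\<in>{0<..<1}. poincare_11 M d (\<mu> w)) \<and>
           (\<forall>w\<in>{0<..<1}. \<forall>w'\<in>{0<..<1}. w \<noteq> w' \<longrightarrow> mutually_singular (\<mu> w) (\<mu> w'))"
proof (intro exI conjI ballI impI)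
  show "Metric_space laakso laakso_dist" by (rule laakso.Metric_space_axioms)
  show "compact_space laakso.mtopology" by (rule compact_space_laakso)
  show "geodesic_space laakso laakso_dist" by (rule geodesic_space_laakso)
  fix w :: real assume w: "w \<in> {0<..<1}"
  show "borel_prob_measure laakso laakso_dist (laakso_measure w)" by (rule borel_prob_measure_laakso)
  show "doubling_measure laakso laakso_dist (laakso_measure w)" by (rule doubling_laakso[OF w])
  show "poincare_11 laakso laakso_dist (laakso_measure w)" by (rule poincare_laakso[OF w])
  fix w' :: real assume w': "w' \<in> {0<..<1}" and "w \<noteq> w'"
  then consider "w < w'" | "w' < w" by linarith
  then show "mutually_singular (laakso_measure w) (laakso_measure w')"
  proof cases
    case 2
    from mutually_singular_laakso_less[OF w' w this] show ?thesis
      by (rule mutually_singular_sym[rotated]) (simp add: sets_laakso_measure)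
  qed (rule mutually_singular_laakso_less[OF w w'])
qed

end
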